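(* Let $q<0$ and assume in addition that $g\ge0$ on $[0,\infty)$ and $sg(s)-G(s)\ge0$ for all $s\ge0$. Then for every $\gamma>0$ there exists $C_\gamma>0$ such that for every $u_0\in H^1(\mathbb R,\mathbb C)$ the corresponding global strong solution $u$ of ${\rm i}\dot u=H_qu+g(|u|^2)u$, $u(0)=u_0$, satisfies $$\int_0^\infty\|u(t)\|^2_{H^1_{-\gamma}}\,dt< C_\gamma\Big(\big(\mathbf E(u_0)\mathbf M(u_0)\big)^{1/2}+\mathbf M(u_0)\Big).$$
   Context: Standing assumptions: $g\in C([0,\infty),\mathbb R)\cap C^3((0,\infty),\mathbb R)$ and there exist $p>0$, $C>0$ with $|g^{(k)}(s)|\le Cs^{p-k}$ for $k=0,1,2,3$, $s\in(0,1]$; $G$ is the primitive of $g$ with $G(0)=0$. For $q\in\mathbb R\setminus\{0\}$, $H_q=-\partial_x^2-q\delta$ is $-\partial_x^2$ with domain $\{u\in H^1(\mathbb R,\mathbb C)\cap H^2(\mathbb R\setminus\{0\},\mathbb C): \partial_xu(0^+)-\partial_xu(0^-)=-q\,u(0)\}$. Energy and mass: $\mathbf E(u)=\frac12\|\partial_xu\|_{L^2}^2+\frac{|q|}{2}|u(0)|^2+\frac12\int_{\mathbb R}G(|u|^2)dx$, $\mathbf M(u)=\frac12\|u\|_{L^2}^2$; both are conserved by the flow, which is globally well posed in $H^1$. $H^1_{-\gamma}$ has norm $\|e^{-\gamma|x|}u\|_{H^1}$.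
   Formalization: The strict inequality is proved for every nonzero u_0; for u_0 = 0 the solution is zero, both sides vanish and strict inequality fails, so only ≤ is asserted in that case. *)

theory Defs
  imports "HOL-Analysis.Analysis"
begin

definition sq_int :: "(real \<Rightarrow> complex) \<Rightarrow> bool" where
  "sq_int f \<longleftrightarrow> f \<in> borel_measurable lborel \<and>
     integrable lborel (\<lambda>x. (cmod (f x))\<^sup>2)"

definition L2sq :: "(real \<Rightarrow> complex) \<Rightarrow> real" where
  "L2sq f = (\<integral>x. (cmod (f x))\<^sup>2 \<partial>lborel)"

definition L2inner :: "(real \<Rightarrow> complex) \<Rightarrow> (real \<Rightarrow> complex) \<Rightarrow> complex" where
  "L2inner f h = (\<integral>x. f x * cnj (h x) \<partial>lborel)"

text \<open>v is the (weak = a.e. classical) derivative of u in the H1 sense: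
  v is in L2 and u b - u a = integral of v over [a,b].  (So u is the
  continuous, locally absolutely continuous representative.)\<close>
definition is_H1_deriv :: "(real \<Rightarrow> complex) \<Rightarrow> (real \<Rightarrow> complex) \<Rightarrow> bool" where
  "is_H1_deriv u v \<longleftrightarrow> sq_int v \<and>
     (\<forall>a b. a \<le> b \<longrightarrow> (v has_integral (u b - u a)) {a..b})"

definition H1 :: "(real \<Rightarrow> complex) \<Rightarrow> bool" where
  "H1 u \<longleftrightarrow> sq_int u \<and> (\<exists>v. is_H1_deriv u v)"

definition H1_deriv :: "(real \<Rightarrow> complex) \<Rightarrow> (real \<Rightarrow> complex)" where
  "H1_deriv u = (SOME v. is_H1_deriv u v)"

definition H1sq :: "(real \<Rightarrow> complex) \<Rightarrow> real" where
  "H1sq u = L2sq u + L2sq (H1_deriv u)"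

definition H1w_sq :: "real \<Rightarrow> (real \<Rightarrow> complex) \<Rightarrow> real" where
  "H1w_sq \<gamma> u = H1sq (\<lambda>x. complex_of_real (exp (- \<gamma> * \<bar>x\<bar>)) * u x)"

definition prim :: "(real \<Rightarrow> real) \<Rightarrow> real \<Rightarrow> real" where
  "prim g s = integral {0..s} g"

definition energy :: "real \<Rightarrow> (real \<Rightarrow> real) \<Rightarrow> (real \<Rightarrow> complex) \<Rightarrow> real" where
  "energy q g u = L2sq (H1_deriv u) / 2 + \<bar>q\<bar> / 2 * (cmod (u 0))\<^sup>2
     + (\<integral>x. prim g ((cmod (u x))\<^sup>2) \<partial>lborel) / 2"

definition mass :: "(real \<Rightarrow> complex) \<Rightarrow> real" where
  "mass u = L2sq u / 2"

text \<open>Quadratic (sesquilinear) form of H_q = -d_x^2 - q \<delta> on H1: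
  <H_q u, \<phi>> = \<integral> u' conj(\<phi>') - q u(0) conj(\<phi>(0)).\<close>
definition Hq_form :: "real \<Rightarrow> (real \<Rightarrow> complex) \<Rightarrow> (real \<Rightarrow> complex) \<Rightarrow> complex" where
  "Hq_form q u \<phi> = L2inner (H1_deriv u) (H1_deriv \<phi>) - complex_of_real q * u 0 * cnj (\<phi> 0)"

text \<open>Global strong solution of  i u_t = H_q u + g(|u|^2) u,  u(0) = u0:
  u \<in> C([0,\<infinity>), H1) and the equation holds in H^{-1}, i.e. tested against
  every \<phi> \<in> H1 the map t \<mapsto> <u(t),\<phi>> is differentiable with
  i d/dt <u(t),\<phi>> = <H_q u(t), \<phi>> + <g(|u(t)|^2) u(t), \<phi>>.\<close>
definition NLS_solution ::
  "real \<Rightarrow> (real \<Rightarrow> real) \<Rightarrow> (real \<Rightarrow> real \<Rightarrow> complex) \<Rightarrow> (real \<Rightarrow> complex) \<Rightarrow> bool" where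
  "NLS_solution q g u u0 \<longleftrightarrow>
     u 0 = u0 \<and>
     (\<forall>t\<ge>0. H1 (u t)) \<and>
     (\<forall>t\<ge>0. ((\<lambda>s::real. H1sq (\<lambda>x. u s x - u t x)) \<longlongrightarrow> 0) (at t within {0..})) \<and>
     (\<forall>\<phi>. H1 \<phi> \<longrightarrow> (\<forall>t\<ge>0.
        ((\<lambda>s::real. L2inner (u s) \<phi>) has_vector_derivative
           (- \<i>) * (Hq_form q (u t) \<phi>
              + L2inner (\<lambda>x. complex_of_real (g ((cmod (u t x))\<^sup>2)) * u t x) \<phi>))
        (at t within {0..})))"

end

(* Virial argument for a repulsive delta. Let phi be the odd function with phi' = a exp(-2a|x|) and
   let B be the antisymmetric operator (phi d/dx + d/dx phi)/2. Then d/dt Im <u, B u> equals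
   -2 Re (<H_q u, B u> + <g(|u|^2) u, B u>). With w = exp(-a|x|) u the first term is exactly
   a (||w'||^2 + (|q|/2 - a) |w(0)|^2), because the potential created by commuting the weight
   cancels against the exponential and leaves only a multiple of delta; the second is
   (1/2) int phi' (s g(s) - G(s)) with s = |u|^2, hence nonnegative. For 2a < |q| the rate is
   coercive and controls exp(-c|x|) u in H^1 for every c > a, while |Im <u, B u>| is bounded
   through the conserved mass and energy.

   Solutions are only H^1 in space and the equation holds only weakly, so derivatives are replaced
   by differences. In space d/dx becomes the central difference with step e, which keeps B
   antisymmetric and H^1-preserving; the nonlinear term is nonnegative up to O(e), and the
   quadratic term converges as e tends to 0. In time the energy law comes from <u(t+h), u(t)>:
   the quadratic form cancels in its t-derivative, and -Im <u(t+h), u(t)> / h tends to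
   <H_q u + g(|u|^2) u, u> as h tends to 0. *)
theory Submission
  imports Defs
begin

section \<open>Square-integrable functions\<close>

text \<open>Two kinds of second-order smallness replace regularity. In time,
  \<open>u s - u t\<close> is O(|s - t|) only in the dual of H1, but it tends to 0 in H1; pairing it
  with itself shows that its squared L2 norm is o(|s - t|). In the nonlinearity, exchanging two
  states in Re <\<open>Nl\<close> b, a> produces the increment of s g(s) - G(s) up to an error
  quadratic in b - a, although near 0 only s g'(s), the derivative of s g(s) - G(s), is under
  control and g' itself may blow up. Together they give the energy law and the sign of the nonlinear
  virial term without a chain rule for G(|u|^2). The quotient -Im <u(t+h), u(t)> / h does not tend
  to twice the energy: its limit exceeds that by the integral of s g(s) - G(s). A time primitive of
  this integral is therefore subtracted before h tends to 0. The two terms of the final bound come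
  from B u = phi u' + phi' u / 2: Cauchy-Schwarz with ||u'||^2 <= 2E gives the square root of E M,
  and phi' <= a gives the mass.\<close>

abbreviation L2n :: "(real \<Rightarrow> complex) \<Rightarrow> real" where
  "L2n f \<equiv> sqrt (L2sq f)"

lemma sq_int_measurable: "sq_int f \<Longrightarrow> f \<in> borel_measurable borel"
  by (simp add: sq_int_def)

lemma sq_int_integrable: "sq_int f \<Longrightarrow> integrable lborel (\<lambda>x. (cmod (f x))\<^sup>2)"
  by (simp add: sq_int_def)

lemma sq_intI_bound:
  assumes "f \<in> borel_measurable borel" "integrable lborel w" "\<And>x. (cmod (f x))\<^sup>2 \<le> w x"
  shows "sq_int f"
  unfolding sq_int_def
proof
  show "f \<in> borel_measurable lborel" using assms(1) by simp
  show "integrable lborel (\<lambda>x. (cmod (f x))\<^sup>2)"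
    by (rule Bochner_Integration.integrable_bound[OF assms(2)])
       (use assms in \<open>auto intro!: AE_I2 order_trans[OF assms(3) abs_ge_self]\<close>)
qed

lemma sum_sq_bound: "(cmod (a + b))\<^sup>2 \<le> 2 * (cmod a)\<^sup>2 + 2 * (cmod b)\<^sup>2"
proof -
  have "(cmod (a + b))\<^sup>2 \<le> (cmod a + cmod b)\<^sup>2"
    by (intro power_mono norm_triangle_ineq) auto
  also have "\<dots> \<le> 2 * (cmod a)\<^sup>2 + 2 * (cmod b)\<^sup>2"
    using sum_squares_bound[of "cmod a" "cmod b"] by (simp add: power2_sum)
  finally show ?thesis .
qed

lemma sq_int_add: assumes "sq_int f" "sq_int h" shows "sq_int (\<lambda>x. f x + h x)"
  using assms
  by (intro sq_intI_bound[where w = "\<lambda>x. 2 * (cmod (f x))\<^sup>2 + 2 * (cmod (h x))\<^sup>2"] sum_sq_bound)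
     (auto simp: sq_int_def)

lemma sq_int_cmult: assumes "sq_int f" shows "sq_int (\<lambda>x. c * f x)"
  using assms
  by (intro sq_intI_bound[where w = "\<lambda>x. (cmod c)\<^sup>2 * (cmod (f x))\<^sup>2"])
     (auto simp: sq_int_def norm_mult power_mult_distrib)

lemma sq_int_diff: assumes "sq_int f" "sq_int h" shows "sq_int (\<lambda>x. f x - h x)"
  using sq_int_add[OF assms(1) sq_int_cmult[OF assms(2), of "-1"]] by simp

lemma sq_int_mult_bounded:
  assumes "sq_int f" "m \<in> borel_measurable borel" "\<And>x. cmod (m x) \<le> K"
  shows "sq_int (\<lambda>x. m x * f x)"
proof (rule sq_intI_bound[where w = "\<lambda>x. K\<^sup>2 * (cmod (f x))\<^sup>2"])
  show "(\<lambda>x. m x * f x) \<in> borel_measurable borel"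
    using assms(2) sq_int_measurable[OF assms(1)] by measurable
  show "integrable lborel (\<lambda>x. K\<^sup>2 * (cmod (f x))\<^sup>2)"
    using sq_int_integrable[OF assms(1)] by simp
  show "(cmod (m x * f x))\<^sup>2 \<le> K\<^sup>2 * (cmod (f x))\<^sup>2" for x
    by (simp add: norm_mult power_mult_distrib mult_right_mono power_mono assms(3))
qed

lemma L2sq_nonneg [simp]: "0 \<le> L2sq f"
  by (simp add: L2sq_def)

lemma L2sq_mult_bounded:
  assumes "sq_int f" "m \<in> borel_measurable borel" "\<And>x. cmod (m x) \<le> K"
  shows "L2sq (\<lambda>x. m x * f x) \<le> K\<^sup>2 * L2sq f"
proof -
  have "L2sq (\<lambda>x. m x * f x) \<le> (\<integral>x. K\<^sup>2 * (cmod (f x))\<^sup>2 \<partial>lborel)"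
    unfolding L2sq_def
    using sq_int_integrable[OF sq_int_mult_bounded[OF assms]] sq_int_integrable[OF assms(1)]
    by (intro integral_mono)
       (auto simp: norm_mult power_mult_distrib intro!: mult_right_mono power_mono assms(3))
  then show ?thesis by (simp add: L2sq_def)
qed

lemma sq_int_mult_integrable:
  assumes "sq_int f" "sq_int h"
  shows "integrable lborel (\<lambda>x. f x * cnj (h x))"
proof (rule Bochner_Integration.integrable_bound)
  show "integrable lborel (\<lambda>x. (cmod (f x))\<^sup>2 + (cmod (h x))\<^sup>2)"
    using assms by (simp add: sq_int_def)
  have [measurable]: "f \<in> borel_measurable borel" "h \<in> borel_measurable borel"
    using assms by (simp_all add: sq_int_measurable)
  show "(\<lambda>x. f x * cnj (h x)) \<in> borel_measurable lborel"
    by (simp, intro borel_measurable_times borel_measurable_continuous_on[OF continuous_on_cnj[OF continuous_on_id]])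
       auto
  show "AE x in lborel. norm (f x * cnj (h x)) \<le> norm ((cmod (f x))\<^sup>2 + (cmod (h x))\<^sup>2)"
  proof (rule AE_I2)
    fix x
    have "2 * (cmod (f x) * cmod (h x)) \<le> (cmod (f x))\<^sup>2 + (cmod (h x))\<^sup>2"
      using sum_squares_bound[of "cmod (f x)" "cmod (h x)"] by simp
    moreover have "0 \<le> cmod (f x) * cmod (h x)" by simp
    ultimately show "norm (f x * cnj (h x)) \<le> norm ((cmod (f x))\<^sup>2 + (cmod (h x))\<^sup>2)"
      using abs_ge_self[of "(cmod (f x))\<^sup>2 + (cmod (h x))\<^sup>2"]
      unfolding norm_mult complex_mod_cnj real_norm_def by linarith
  qed
qed

lemma L2inner_add_left:
  "\<lbrakk>sq_int f; sq_int g; sq_int h\<rbrakk> \<Longrightarrow> L2inner (\<lambda>x. f x + g x) h = L2inner f h + L2inner g h"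
  by (simp add: L2inner_def distrib_right sq_int_mult_integrable)

lemma L2inner_diff_left:
  "\<lbrakk>sq_int f; sq_int g; sq_int h\<rbrakk> \<Longrightarrow> L2inner (\<lambda>x. f x - g x) h = L2inner f h - L2inner g h"
  by (simp add: L2inner_def left_diff_distrib sq_int_mult_integrable)

lemma L2inner_add_right:
  "\<lbrakk>sq_int f; sq_int g; sq_int h\<rbrakk> \<Longrightarrow> L2inner f (\<lambda>x. g x + h x) = L2inner f g + L2inner f h"
  by (simp add: L2inner_def distrib_left sq_int_mult_integrable)

lemma L2inner_diff_right:
  "\<lbrakk>sq_int f; sq_int g; sq_int h\<rbrakk> \<Longrightarrow> L2inner f (\<lambda>x. g x - h x) = L2inner f g - L2inner f h"
  by (simp add: L2inner_def right_diff_distrib sq_int_mult_integrable)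

lemma L2inner_cmult_left: "L2inner (\<lambda>x. c * f x) h = c * L2inner f h"
  by (simp add: L2inner_def mult.assoc)

lemma L2inner_cmult_right: "L2inner f (\<lambda>x. c * h x) = cnj c * L2inner f h"
proof -
  have "L2inner f (\<lambda>x. c * h x) = (\<integral>x. cnj c * (f x * cnj (h x)) \<partial>lborel)"
    unfolding L2inner_def by (intro Bochner_Integration.integral_cong) (auto simp: algebra_simps)
  then show ?thesis by (simp add: L2inner_def)
qed

lemma L2inner_cnj: "cnj (L2inner f h) = L2inner h f"
  unfolding L2inner_def by (simp flip: Bochner_Integration.integral_cnj add: mult.commute)

lemma L2inner_self: "L2inner f f = complex_of_real (L2sq f)"
  unfolding L2inner_def L2sq_def integral_complex_of_real[symmetric]
  by (intro Bochner_Integration.integral_cong) (auto simp: complex_norm_square simp del: of_real_power)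

text \<open>Cauchy-Schwarz for the extended nonnegative integral, moved to the reals by finiteness.
  Bounding the moduli, and not only the inner product, supplies the majorants for Fubini and for
  \<open>Kint_Lipschitz\<close>.\<close>

lemma L2_abs_integral:
  assumes "sq_int f" "sq_int h"
  shows "integrable lborel (\<lambda>x. cmod (f x) * cmod (h x))"
    and "(\<integral>x. cmod (f x) * cmod (h x) \<partial>lborel) \<le> L2n f * L2n h"
proof -
  have [measurable]: "f \<in> borel_measurable borel" "h \<in> borel_measurable borel"
    using assms by (simp_all add: sq_int_measurable)
  have "integrable lborel (\<lambda>x. norm (f x * cnj (h x)))"
    using sq_int_mult_integrable[OF assms] by (rule integrable_norm)
  then show int: "integrable lborel (\<lambda>x. cmod (f x) * cmod (h x))"
    by (simp add: norm_mult)
  let ?I = "\<integral>x. cmod (f x) * cmod (h x) \<partial>lborel"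
  have e: "(\<integral>\<^sup>+x. (ennreal (cmod (k x)))\<^sup>2 \<partial>lborel) = ennreal (L2sq k)" if "sq_int k" for k
    unfolding L2sq_def using sq_int_integrable[OF that]
    by (subst nn_integral_eq_integral[symmetric]) (auto simp: ennreal_power)
  have "(\<integral>\<^sup>+x. ennreal (cmod (f x)) * ennreal (cmod (h x)) \<partial>lborel)\<^sup>2
      \<le> (\<integral>\<^sup>+x. (ennreal (cmod (f x)))\<^sup>2 \<partial>lborel) * (\<integral>\<^sup>+x. (ennreal (cmod (h x)))\<^sup>2 \<partial>lborel)"
    by (rule Cauchy_Schwarz_nn_integral) auto
  also have "\<dots> = ennreal (L2sq f * L2sq h)"
    using assms by (simp add: e ennreal_mult)
  also have "(\<integral>\<^sup>+x. ennreal (cmod (f x)) * ennreal (cmod (h x)) \<partial>lborel) = ennreal ?I"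
    using int by (subst nn_integral_eq_integral[symmetric]) (auto simp: ennreal_mult)
  finally have "ennreal (?I\<^sup>2) \<le> ennreal (L2sq f * L2sq h)"
    by (subst (asm) ennreal_power) auto
  then have "?I\<^sup>2 \<le> L2sq f * L2sq h"
    by (subst (asm) ennreal_le_iff) auto
  then have "?I \<le> sqrt (L2sq f * L2sq h)" by (rule real_le_rsqrt)
  then show "?I \<le> L2n f * L2n h" by (simp add: real_sqrt_mult)
qed

lemma L2_Cauchy_Schwarz:
  assumes "sq_int f" "sq_int h"
  shows "cmod (L2inner f h) \<le> L2n f * L2n h"
proof -
  have "cmod (L2inner f h) \<le> (\<integral>x. norm (f x * cnj (h x)) \<partial>lborel)"
    unfolding L2inner_def by (rule integral_norm_bound)
  also have "\<dots> \<le> L2n f * L2n h"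
    using L2_abs_integral(2)[OF assms] by (simp add: norm_mult)
  finally show ?thesis .
qed

lemma L2sq_add:
  assumes "sq_int f" "sq_int h"
  shows "L2sq (\<lambda>x. f x + h x) = L2sq f + L2sq h + 2 * Re (L2inner f h)"
proof -
  have "complex_of_real (L2sq (\<lambda>x. f x + h x)) = L2inner (\<lambda>x. f x + h x) (\<lambda>x. f x + h x)"
    by (simp add: L2inner_self)
  also have "\<dots> = L2inner f f + L2inner h h + (L2inner f h + L2inner h f)"
    using assms by (simp add: L2inner_add_left L2inner_add_right sq_int_add)
  finally have "L2sq (\<lambda>x. f x + h x) = Re (L2inner f f + L2inner h h + (L2inner f h + L2inner h f))"
    by (metis Re_complex_of_real)
  moreover have "Re (L2inner h f) = Re (L2inner f h)"
    using L2inner_cnj[of f h] by (metis complex_cnj(1) complex.sel(1) cnj.simps(1))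
  ultimately show ?thesis by (simp add: L2inner_self)
qed

lemma L2n_triangle:
  assumes "sq_int f" "sq_int h"
  shows "L2n (\<lambda>x. f x + h x) \<le> L2n f + L2n h"
proof (rule real_le_lsqrt)
  have "Re (L2inner f h) \<le> L2n f * L2n h"
    using L2_Cauchy_Schwarz[OF assms] complex_Re_le_cmod order_trans by blast
  then show "L2sq (\<lambda>x. f x + h x) \<le> (L2n f + L2n h)\<^sup>2"
    by (simp add: L2sq_add[OF assms] power2_sum)
qed auto

lemma L2n_cmult: "L2n (\<lambda>x. c * f x) = cmod c * L2n f"
  by (simp add: L2sq_def norm_mult power_mult_distrib real_sqrt_mult)

lemma L2n_diff:
  assumes "sq_int f" "sq_int h"
  shows "L2n (\<lambda>x. f x - h x) \<le> L2n f + L2n h"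
  using L2n_triangle[OF assms(1) sq_int_cmult[OF assms(2), of "-1"]] L2n_cmult[of "-1" h] by simp

lemma L2n_minus_commute: "L2n (\<lambda>x. f x - h x) = L2n (\<lambda>x. h x - f x)"
  by (simp add: L2sq_def norm_minus_commute)

lemma L2n_mult_bounded:
  assumes "sq_int f" "m \<in> borel_measurable borel" "\<And>x. cmod (m x) \<le> K"
  shows "L2n (\<lambda>x. m x * f x) \<le> K * L2n f"
proof -
  have "0 \<le> K" using assms(3)[of 0] norm_ge_zero order_trans by blast
  then show ?thesis
    using real_sqrt_le_mono[OF L2sq_mult_bounded[OF assms]] by (simp add: real_sqrt_mult)
qed

section \<open>Translation invariance and passage to the limit in inner products\<close>

lemma integral_shift:
  fixes f :: "real \<Rightarrow> 'a :: {banach, second_countable_topology}"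
  shows "(\<integral>x. f (x + h) \<partial>lborel) = (\<integral>x. f x \<partial>lborel)"
  using lborel_integral_real_affine[of 1 f h] by (simp add: add.commute)

lemma integrable_shift:
  fixes f :: "real \<Rightarrow> 'a :: {banach, second_countable_topology}"
  shows "integrable lborel (\<lambda>x. f (x + h)) \<longleftrightarrow> integrable lborel f"
  using lborel_integrable_real_affine_iff[of 1 f h] by (simp add: add.commute)

lemma sq_int_shift: assumes "sq_int f" shows "sq_int (\<lambda>x. f (x + h))"
proof -
  have "(\<lambda>x. f (x + h)) \<in> borel_measurable borel"
    using sq_int_measurable[OF assms] by measurable
  then show ?thesis
    using assms integrable_shift[of "\<lambda>x. (cmod (f x))\<^sup>2" h] by (simp add: sq_int_def)
qed

lemma L2sq_shift: "L2sq (\<lambda>x. f (x + h)) = L2sq f"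
  unfolding L2sq_def by (rule integral_shift)

lemma L2inner_shift: "L2inner (\<lambda>x. f (x + h)) (\<lambda>x. k (x + h)) = L2inner f k"
  unfolding L2inner_def by (rule integral_shift)

lemma L2inner_tendsto:
  assumes "eventually (\<lambda>s. sq_int (f s)) F" "eventually (\<lambda>s. sq_int (h s)) F" "sq_int f0" "sq_int h0"
    and f: "((\<lambda>s. L2n (\<lambda>x. f s x - f0 x)) \<longlongrightarrow> 0) F"
    and h: "((\<lambda>s. L2n (\<lambda>x. h s x - h0 x)) \<longlongrightarrow> 0) F"
  shows "((\<lambda>s. L2inner (f s) (h s)) \<longlongrightarrow> L2inner f0 h0) F"
proof (rule LIM_zero_cancel)
  have "eventually (\<lambda>s. norm (L2inner (f s) (h s) - L2inner f0 h0) \<le>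
      L2n (\<lambda>x. f s x - f0 x) * (L2n h0 + L2n (\<lambda>x. h s x - h0 x)) + L2n f0 * L2n (\<lambda>x. h s x - h0 x)) F"
    using assms(1,2)
  proof eventually_elim
    case (elim s)
    note i = elim assms(3,4) sq_int_diff
    have "L2inner (f s) (h s) - L2inner f0 h0
       = L2inner (\<lambda>x. f s x - f0 x) (h s) + L2inner f0 (\<lambda>x. h s x - h0 x)"
      using i by (simp add: L2inner_diff_left L2inner_diff_right)
    moreover have "cmod (L2inner (\<lambda>x. f s x - f0 x) (h s)) \<le> L2n (\<lambda>x. f s x - f0 x) * L2n (h s)"
      using i by (intro L2_Cauchy_Schwarz) auto
    moreover have "L2n (h s) \<le> L2n h0 + L2n (\<lambda>x. h s x - h0 x)"
      using L2n_triangle[OF i(4) sq_int_diff[OF i(2) i(4)]] by simp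
    moreover have "cmod (L2inner f0 (\<lambda>x. h s x - h0 x)) \<le> L2n f0 * L2n (\<lambda>x. h s x - h0 x)"
      using i by (intro L2_Cauchy_Schwarz) auto
    ultimately show ?case
      by (smt (verit) norm_triangle_ineq mult_left_mono L2sq_nonneg real_sqrt_ge_zero)
  qed
  moreover have "((\<lambda>s. L2n (\<lambda>x. f s x - f0 x) * (L2n h0 + L2n (\<lambda>x. h s x - h0 x)) + L2n f0 * L2n (\<lambda>x. h s x - h0 x)) \<longlongrightarrow> 0) F"
    by (rule tendsto_eq_intros f h refl | simp)+
  ultimately show "((\<lambda>s. L2inner (f s) (h s) - L2inner f0 h0) \<longlongrightarrow> 0) F"
    by (rule Lim_null_comparison)
qed

section \<open>Continuity of translations in the mean\<close>

text \<open>Translations are isometries of L2, so a three-epsilon argument shows that the functions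
  with continuous translations form a closed set.\<close>

lemma L2_translation_continuous_closure:
  assumes f: "sq_int f" and fn: "\<And>n::nat. sq_int (fn n)"
    and t: "\<And>n. ((\<lambda>s. L2n (\<lambda>x. fn n (x + s) - fn n x)) \<longlongrightarrow> 0) (at 0)"
    and lim: "(\<lambda>n. L2n (\<lambda>x. fn n x - f x)) \<longlonglongrightarrow> 0"
  shows "((\<lambda>s. L2n (\<lambda>x. f (x + s) - f x)) \<longlongrightarrow> 0) (at 0)"
proof (rule tendstoI)
  fix e :: real assume "0 < e"
  then have "eventually (\<lambda>n. dist (L2n (\<lambda>x. fn n x - f x)) 0 < e/3) sequentially"
    by (intro tendstoD[OF lim]) auto
  then obtain n where n: "L2n (\<lambda>x. fn n x - f x) < e/3"
    by (auto simp: eventually_sequentially)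
  have "eventually (\<lambda>s. dist (L2n (\<lambda>x. fn n (x + s) - fn n x)) 0 < e/3) (at 0)"
    using \<open>0 < e\<close> by (intro tendstoD[OF t]) auto
  then show "eventually (\<lambda>s. dist (L2n (\<lambda>x. f (x + s) - f x)) 0 < e) (at 0)"
  proof eventually_elim
    case (elim s)
    have d: "sq_int (\<lambda>x. fn n x - f x)" using f fn by (intro sq_int_diff)
    have "L2n (\<lambda>x. (f (x + s) - fn n (x + s)) + (fn n (x + s) - f x))
      \<le> L2n (\<lambda>x. f (x + s) - fn n (x + s)) + L2n (\<lambda>x. fn n (x + s) - f x)"
      by (intro L2n_triangle sq_int_diff sq_int_shift f fn)
    also have "L2n (\<lambda>x. f (x + s) - fn n (x + s)) = L2n (\<lambda>x. fn n x - f x)"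
      using L2sq_shift[of "\<lambda>x. f x - fn n x" s] L2n_minus_commute[of f "fn n"] by simp
    also have "L2n (\<lambda>x. fn n (x + s) - f x) = L2n (\<lambda>x. (fn n (x + s) - fn n x) + (fn n x - f x))"
      by simp
    also have "\<dots> \<le> L2n (\<lambda>x. fn n (x + s) - fn n x) + L2n (\<lambda>x. fn n x - f x)"
      by (intro L2n_triangle sq_int_diff sq_int_shift f fn)
    finally show ?case using elim n by simp
  qed
qed

lemma bounded_support_integrable_bound:
  fixes K R :: real
  shows "integrable lborel (\<lambda>x::real. K * indicator {-R..R} x)"
  by (intro integrable_mult_right integrable_real_indicator) (auto simp: emeasure_lborel_Icc_eq)

lemma L2_translation_continuous_cc:
  assumes g: "continuous_on UNIV g" and M: "\<And>x. cmod (g x) \<le> M" and R: "\<And>x. R < \<bar>x\<bar> \<Longrightarrow> g x = 0"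
  shows "((\<lambda>s. L2n (\<lambda>x. g (x + s) - g x)) \<longlongrightarrow> 0) (at 0)"
proof -
  have gm[measurable]: "g \<in> borel_measurable borel"
    using g by (rule borel_measurable_continuous_onI)
  have "((\<lambda>s. L2sq (\<lambda>x. g (x + s) - g x)) \<longlongrightarrow> 0) (at 0)"
    unfolding tendsto_at_iff_sequentially
  proof safe
    fix X :: "nat \<Rightarrow> real" assume X: "X \<longlonglongrightarrow> 0"
    \<comment> \<open>A convergent sequence of shifts is bounded by some \<open>B\<close>, so all
      shifted supports lie in one interval and a single dominating function serves.\<close>
    then obtain B where B: "\<And>n. \<bar>X n\<bar> \<le> B"
      using convergent_imp_Bseq[of X] unfolding Bseq_def convergent_def by auto
    have "(\<lambda>n. \<integral>x. (cmod (g (x + X n) - g x))\<^sup>2 \<partial>lborel) \<longlonglongrightarrow> (\<integral>x. 0 \<partial>(lborel :: real measure))"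
    proof (rule integral_dominated_convergence[where w = "\<lambda>x. (2*M)\<^sup>2 * indicator {-(R+B)..R+B} x"])
      show "integrable lborel (\<lambda>x. (2*M)\<^sup>2 * indicator {-(R+B)..R+B} x)"
        by (rule bounded_support_integrable_bound)
      show "AE x in lborel. norm ((cmod (g (x + X n) - g x))\<^sup>2) \<le> (2*M)\<^sup>2 * indicator {-(R+B)..R+B} x" for n
      proof (rule AE_I2)
        fix x
        show "norm ((cmod (g (x + X n) - g x))\<^sup>2) \<le> (2*M)\<^sup>2 * indicator {-(R+B)..R+B} x"
        proof (cases "x \<in> {-(R+B)..R+B}")
          case True
          have "cmod (g (x + X n) - g x) \<le> 2*M"
            using norm_triangle_ineq4[of "g (x + X n)" "g x"] M[of x] M[of "x + X n"] by linarith
          from power_mono[OF this norm_ge_zero, of 2] show ?thesis using True by simp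
        next
          case False
          then have "R < \<bar>x\<bar>" "R < \<bar>x + X n\<bar>"
            using B[of n] by (auto simp: abs_if split: if_splits)
          then show ?thesis using R by simp
        qed
      qed
      show "AE x in lborel. (\<lambda>n. (cmod (g (x + X n) - g x))\<^sup>2) \<longlonglongrightarrow> 0"
      proof (rule AE_I2)
        fix x
        have "(\<lambda>n. g (x + X n)) \<longlonglongrightarrow> g x"
          by (rule continuous_on_tendsto_compose[OF g]) (use tendsto_add[OF tendsto_const[of x] X] in auto)
        then have "(\<lambda>n. (cmod (g (x + X n) - g x))\<^sup>2) \<longlonglongrightarrow> (cmod (g x - g x))\<^sup>2"
          by (intro tendsto_intros)
        then show "(\<lambda>n. (cmod (g (x + X n) - g x))\<^sup>2) \<longlonglongrightarrow> 0" by simp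
      qed
    qed auto
    then show "((\<lambda>s. L2sq (\<lambda>x. g (x + s) - g x)) \<circ> X) \<longlonglongrightarrow> 0"
      by (simp add: L2sq_def o_def)
  qed
  from tendsto_real_sqrt[OF this] show ?thesis by simp
qed

lemma L2n_dominated_convergence:
  assumes [measurable]: "\<And>n::nat. fn n \<in> borel_measurable borel" "f \<in> borel_measurable borel"
    and w: "integrable lborel w" and b: "\<And>n x. (cmod (fn n x - f x))\<^sup>2 \<le> w x"
    and ae: "AE x in lborel. (\<lambda>n. fn n x) \<longlonglongrightarrow> f x"
  shows "(\<lambda>n. L2n (\<lambda>x. fn n x - f x)) \<longlonglongrightarrow> 0"
proof -
  have "(\<lambda>n. \<integral>x. (cmod (fn n x - f x))\<^sup>2 \<partial>lborel) \<longlonglongrightarrow> (\<integral>x. 0 \<partial>(lborel :: real measure))"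
  proof (rule integral_dominated_convergence[OF _ _ w])
    show "AE x in lborel. (\<lambda>n. (cmod (fn n x - f x))\<^sup>2) \<longlonglongrightarrow> 0"
      using ae
    proof eventually_elim
      case (elim x)
      then have "(\<lambda>n. (cmod (fn n x - f x))\<^sup>2) \<longlonglongrightarrow> (cmod (f x - f x))\<^sup>2"
        by (intro tendsto_intros)
      then show ?case by simp
    qed
  qed (use b in auto)
  from tendsto_real_sqrt[OF this] show ?thesis by (simp add: L2sq_def)
qed

text \<open>A measurable function is an a.e. limit of continuous ones. After truncation these have a
  common bound and a common compact support, so the a.e. convergence becomes convergence in
  L2.\<close>

lemma L2_translation_continuous_bounded:
  assumes f[measurable]: "f \<in> borel_measurable borel"
    and M: "\<And>x. cmod (f x) \<le> M" "0 < M" and R: "\<And>x. R < \<bar>x\<bar> \<Longrightarrow> f x = 0"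
  shows "sq_int f" "((\<lambda>s. L2n (\<lambda>x. f (x + s) - f x)) \<longlongrightarrow> 0) (at 0)"
proof -
  show sqf: "sq_int f"
    by (rule sq_intI_bound[OF f bounded_support_integrable_bound[of "M\<^sup>2" R]])
       (use M R in \<open>auto simp: indicator_def power_mono not_le abs_if split: if_splits\<close>)
  have "f \<in> borel_measurable lebesgue" by (intro measurable_completion) simp
  then have "f measurable_on UNIV"
    by (rule lebesgue_measurable_imp_measurable_on) simp
  then obtain N gn where N: "negligible N" and gn: "\<And>n. continuous_on UNIV (gn n)"
    and lim: "\<And>x. x \<notin> N \<Longrightarrow> (\<lambda>n. gn n x) \<longlonglongrightarrow> f x"
    by (auto simp: measurable_on_def)
  \<comment> \<open>The first factor is a continuous plateau equal to 1 on the support of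
    \<open>f\<close>; the second cuts the modulus down to \<open>M\<close> and is continuous because
    its denominator stays above \<open>M > 0\<close>. Both leave \<open>f\<close> itself unchanged,
    so \<open>h n\<close> still converges to \<open>f\<close> a.e.\<close>
  define h where "h n x = complex_of_real (max 0 (min 1 (R + 1 - \<bar>x\<bar>)) * (M / max M (cmod (gn n x)))) * gn n x" for n x
  have mx: "max M t \<noteq> 0" for t using M(2) by (auto simp: max_def)
  have hc: "continuous_on UNIV (h n)" for n
    unfolding h_def using mx by (intro continuous_intros gn) auto
  then have [measurable]: "h n \<in> borel_measurable borel" for n
    by (rule borel_measurable_continuous_onI)
  have hM: "cmod (h n x) \<le> M" for n x
  proof -
    have a: "0 \<le> max 0 (min 1 (R + 1 - \<bar>x\<bar>))" "max 0 (min 1 (R + 1 - \<bar>x\<bar>)) \<le> 1" by auto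
    have b: "M / max M (cmod (gn n x)) * cmod (gn n x) \<le> M"
      using M(2) by (simp add: divide_simps max_def)
    have "cmod (h n x) = max 0 (min 1 (R + 1 - \<bar>x\<bar>)) * (M / max M (cmod (gn n x)) * cmod (gn n x))"
      using M(2) a unfolding h_def norm_mult norm_of_real abs_mult by (simp add: abs_of_pos max.coboundedI1 mult.assoc)
    also have "\<dots> \<le> 1 * M"
      using a b M(2) by (intro mult_mono) (auto simp: max.coboundedI1)
    finally show ?thesis by simp
  qed
  have hR: "h n x = 0" if "R + 1 < \<bar>x\<bar>" for n x
    using that by (simp add: h_def)
  have hsq: "sq_int (h n)" for n
    by (rule sq_intI_bound[OF _ bounded_support_integrable_bound[of "M\<^sup>2" "R+1"]])
       (use hM hR in \<open>auto simp: indicator_def power_mono not_le abs_if split: if_splits\<close>)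
  have "(\<lambda>n. L2n (\<lambda>x. h n x - f x)) \<longlonglongrightarrow> 0"
  proof (rule L2n_dominated_convergence[OF _ _ bounded_support_integrable_bound[of "(2*M)\<^sup>2" "R+1"]])
    show "(cmod (h n x - f x))\<^sup>2 \<le> (2*M)\<^sup>2 * indicator {- (R+1)..R+1} x" for n x
    proof (cases "x \<in> {-(R+1)..R+1}")
      case True
      have "cmod (h n x - f x) \<le> 2*M"
        using norm_triangle_ineq4[of "h n x" "f x"] M(1)[of x] hM[of n x] by linarith
      from power_mono[OF this norm_ge_zero, of 2] show ?thesis using True by simp
    next
      case False
      then have "R + 1 < \<bar>x\<bar>" "R < \<bar>x\<bar>" by (auto simp: abs_if split: if_splits)
      then show ?thesis using R hR by simp
    qed
    have "N \<in> null_sets lebesgue" using N by (simp add: negligible_iff_null_sets)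
    then have "AE x in lebesgue. x \<notin> N" by (rule AE_not_in)
    then have "AE x in lborel. x \<notin> N" by (simp add: AE_completion_iff)
    then show "AE x in lborel. (\<lambda>n. h n x) \<longlonglongrightarrow> f x"
    proof eventually_elim
      case (elim x)
      have "(\<lambda>n. h n x) \<longlonglongrightarrow> complex_of_real (max 0 (min 1 (R + 1 - \<bar>x\<bar>)) * (M / max M (cmod (f x)))) * f x"
        unfolding h_def using mx by (intro tendsto_intros lim elim) auto
      also have "complex_of_real (max 0 (min 1 (R + 1 - \<bar>x\<bar>)) * (M / max M (cmod (f x)))) * f x = f x"
        using M R[of x] by (cases "R < \<bar>x\<bar>") (auto simp: max_absorb1)
      finally show ?case .
    qed
  qed auto
  moreover have "((\<lambda>s. L2n (\<lambda>x. h n (x + s) - h n x)) \<longlongrightarrow> 0) (at 0)" for n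
    by (rule L2_translation_continuous_cc[OF hc hM hR])
  ultimately show "((\<lambda>s. L2n (\<lambda>x. f (x + s) - f x)) \<longlongrightarrow> 0) (at 0)"
    by (intro L2_translation_continuous_closure[OF sqf hsq])
qed

text \<open>Cutting off both the variable and the values at \<open>n\<close> reduces to the bounded
  case, with |f|^2 as dominating function.\<close>

lemma L2_translation_continuous:
  assumes f: "sq_int f"
  shows "((\<lambda>s. L2n (\<lambda>x. f (x + s) - f x)) \<longlongrightarrow> 0) (at 0)"
proof -
  have [measurable]: "f \<in> borel_measurable borel" using f by (rule sq_int_measurable)
  define h where "h n x = (if \<bar>x\<bar> \<le> real n \<and> cmod (f x) \<le> real n then f x else 0)" for n x
  have [measurable]: "h n \<in> borel_measurable borel" for n
    unfolding h_def by measurable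
  have b: "sq_int (h n)" "((\<lambda>s. L2n (\<lambda>x. h n (x + s) - h n x)) \<longlongrightarrow> 0) (at 0)" for n
  proof -
    have 1: "cmod (h n x) \<le> real n + 1" for x by (simp add: h_def)
    have 2: "real n < \<bar>x\<bar> \<Longrightarrow> h n x = 0" for x by (simp add: h_def)
    show "sq_int (h n)" "((\<lambda>s. L2n (\<lambda>x. h n (x + s) - h n x)) \<longlongrightarrow> 0) (at 0)"
      using 1 2 by (intro L2_translation_continuous_bounded[of "h n" "real n + 1" "real n"]; simp)+
  qed
  have "(\<lambda>n. L2n (\<lambda>x. h n x - f x)) \<longlonglongrightarrow> 0"
  proof (rule L2n_dominated_convergence[OF _ _ sq_int_integrable[OF f]])
    show "AE x in lborel. (\<lambda>n. h n x) \<longlonglongrightarrow> f x"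
    proof (rule AE_I2)
      fix x
      obtain m :: nat where m: "max \<bar>x\<bar> (cmod (f x)) \<le> real m" using real_arch_simple by blast
      have "eventually (\<lambda>n. h n x = f x) sequentially"
        unfolding eventually_sequentially h_def using m by (intro exI[of _ m]) auto
      then show "(\<lambda>n. h n x) \<longlonglongrightarrow> f x" by (rule tendsto_eventually)
    qed
  qed (auto simp: h_def)
  then show ?thesis by (rule L2_translation_continuous_closure[OF f b])
qed

section \<open>Calculus of weakly differentiable functions\<close>

lemma sq_int_set_integrable:
  assumes "sq_int v"
  shows "set_integrable lborel {a..b} v"
  unfolding set_integrable_def
proof (rule Bochner_Integration.integrable_bound)
  have [measurable]: "v \<in> borel_measurable borel" using assms by (rule sq_int_measurable)
  show "integrable lborel (\<lambda>x. indicator {a..b} x + (cmod (v x))\<^sup>2)"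
    using sq_int_integrable[OF assms]
    by (intro Bochner_Integration.integrable_add integrable_real_indicator) (auto simp: emeasure_lborel_Icc_eq)
  show "(\<lambda>x. indicator {a..b} x *\<^sub>R v x) \<in> borel_measurable lborel" by measurable
  have "t \<le> 1 + t\<^sup>2" for t :: real
    using sum_squares_bound[of t 1] by (simp add: power2_eq_square) (smt (verit) zero_le_square)
  then show "AE x in lborel. norm (indicator {a..b} x *\<^sub>R v x) \<le> norm (indicator {a..b} x + (cmod (v x))\<^sup>2)"
    by (intro AE_I2) (auto simp: indicator_def)
qed

lemma has_integral_LBINT:
  fixes f :: "real \<Rightarrow> 'b::euclidean_space"
  assumes "set_integrable lborel S f"
  shows "(f has_integral (\<integral>x. indicator S x *\<^sub>R f x \<partial>lborel)) S"
  using set_borel_integral_eq_integral[OF assms]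
  by (metis integrable_integral set_lebesgue_integral_def)

lemma is_H1_deriv_sq_int: "is_H1_deriv u v \<Longrightarrow> sq_int v"
  by (simp add: is_H1_deriv_def)

lemma is_H1_deriv_LBINT:
  assumes "is_H1_deriv u v" "a \<le> b"
  shows "(\<integral>x. indicator {a..b} x *\<^sub>R v x \<partial>lborel) = u b - u a"
proof (rule has_integral_unique)
  show "(v has_integral (\<integral>x. indicator {a..b} x *\<^sub>R v x \<partial>lborel)) {a..b}"
    by (intro has_integral_LBINT sq_int_set_integrable is_H1_deriv_sq_int[OF assms(1)])
  show "(v has_integral (u b - u a)) {a..b}"
    using assms by (simp add: is_H1_deriv_def)
qed

lemma L2inner_shift_continuous:
  assumes "sq_int g" "sq_int v"
  shows "continuous_on UNIV (\<lambda>s. L2inner g (\<lambda>x. v (x + s)))"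
proof -
  have "isCont (\<lambda>s. L2inner g (\<lambda>x. v (x + s))) s0" for s0
    unfolding isCont_def
  proof (rule L2inner_tendsto)
    have "((\<lambda>h. L2n (\<lambda>x. v (x + h + s0) - v (x + s0))) \<longlongrightarrow> 0) (at 0)"
      by (rule L2_translation_continuous[OF sq_int_shift[OF assms(2), of s0]])
    then show "((\<lambda>s. L2n (\<lambda>x. v (x + s) - v (x + s0))) \<longlongrightarrow> 0) (at s0)"
      by (subst LIM_offset_zero_iff[of s0]) (auto simp: algebra_simps)
  qed (use assms in \<open>auto intro: sq_int_shift always_eventually simp: L2sq_def\<close>)
  then show ?thesis by (simp add: continuous_at_imp_continuous_on)
qed

text \<open>Fubini applied to u(x + b) - u(x + a) as the integral of v(x + s) over s in [a, b].
  Difference quotients thereby become averages of a continuous function of the shift.\<close>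

lemma L2inner_difference:
  assumes g: "sq_int g" and uv: "is_H1_deriv u v" and "a \<le> b"
  shows "L2inner g (\<lambda>x. u (x + b) - u (x + a)) = integral {a..b} (\<lambda>s. L2inner g (\<lambda>x. v (x + s)))"
proof -
  have v: "sq_int v" using uv by (rule is_H1_deriv_sq_int)
  have [measurable]: "g \<in> borel_measurable borel" "v \<in> borel_measurable borel"
    "cnj \<in> borel_measurable borel"
    using g v by (auto simp: sq_int_measurable intro!: borel_measurable_continuous_onI continuous_intros)
  let ?k = "\<lambda>s x. indicator {a..b} s *\<^sub>R (g x * cnj (v (x + s)))"
  have int: "integrable (lborel \<Otimes>\<^sub>M lborel) (case_prod ?k)"
  proof (rule lborel_pair.Fubini_integrable)
    show "case_prod ?k \<in> borel_measurable (lborel \<Otimes>\<^sub>M lborel)"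
      by measurable
    have "(\<lambda>s. \<integral>x. norm (?k s x) \<partial>lborel) \<in> borel_measurable lborel" by measurable
    then show "integrable lborel (\<lambda>s. \<integral>x. norm (case_prod ?k (s, x)) \<partial>lborel)"
      unfolding prod.case
    proof (rule Bochner_Integration.integrable_bound[rotated])
      show "integrable lborel (\<lambda>s. (L2n g * L2n v) * indicator {a..b} s)"
        by (intro integrable_mult_right integrable_real_indicator) (auto simp: emeasure_lborel_Icc_eq)
      show "AE s in lborel. norm (\<integral>x. norm (?k s x) \<partial>lborel) \<le> norm ((L2n g * L2n v) * indicator {a..b} s)"
      proof (rule AE_I2)
        fix s
        have "(\<integral>x. norm (?k s x) \<partial>lborel) = indicator {a..b} s * (\<integral>x. cmod (g x) * cmod (v (x + s)) \<partial>lborel)"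
          by (simp add: norm_mult)
        also have "\<dots> \<le> indicator {a..b} s * (L2n g * L2n v)"
          using L2_abs_integral(2)[OF g sq_int_shift[OF v, of s]] by (auto simp: indicator_def L2sq_shift)
        finally show "norm (\<integral>x. norm (?k s x) \<partial>lborel) \<le> norm ((L2n g * L2n v) * indicator {a..b} s)"
          by (simp add: abs_mult mult.commute)
      qed
    qed
    show "AE s in lborel. integrable lborel (\<lambda>x. case_prod ?k (s, x))"
      by (rule AE_I2) (use sq_int_mult_integrable[OF g sq_int_shift[OF v]] in auto)
  qed
  have "(\<integral>s. ?k s x \<partial>lborel) = g x * cnj (u (x + b) - u (x + a))" for x
  proof -
    have "u (x + b) - u (x + a) = (\<integral>s. indicator {x+a..x+b} (s + x) *\<^sub>R v (s + x) \<partial>lborel)"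
      using is_H1_deriv_LBINT[OF uv, of "x+a" "x+b"] \<open>a \<le> b\<close>
      by (simp add: integral_shift[of "\<lambda>y. indicator {x+a..x+b} y *\<^sub>R v y"])
    also have "\<dots> = (\<integral>s. indicator {a..b} s *\<^sub>R v (x + s) \<partial>lborel)"
      by (intro Bochner_Integration.integral_cong) (auto simp: indicator_def add.commute)
    finally have "g x * cnj (u (x + b) - u (x + a)) = g x * cnj (\<integral>s. indicator {a..b} s *\<^sub>R v (x + s) \<partial>lborel)"
      by simp
    also have "\<dots> = g x * (\<integral>s. cnj (indicator {a..b} s *\<^sub>R v (x + s)) \<partial>lborel)"
      by (simp only: Bochner_Integration.integral_cnj)
    also have "\<dots> = (\<integral>s. g x * cnj (indicator {a..b} s *\<^sub>R v (x + s)) \<partial>lborel)"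
      by (simp only: integral_mult_right_zero)
    also have "\<dots> = (\<integral>s. ?k s x \<partial>lborel)"
      by (intro Bochner_Integration.integral_cong) (auto simp: indicator_def)
    finally show ?thesis by simp
  qed
  then have "L2inner g (\<lambda>x. u (x + b) - u (x + a)) = (\<integral>x. (\<integral>s. ?k s x \<partial>lborel) \<partial>lborel)"
    by (simp add: L2inner_def)
  also have "\<dots> = (\<integral>s. (\<integral>x. ?k s x \<partial>lborel) \<partial>lborel)"
    by (rule lborel_pair.Fubini_integral[OF int])
  also have "\<dots> = (\<integral>s. indicator {a..b} s *\<^sub>R L2inner g (\<lambda>x. v (x + s)) \<partial>lborel)"
    by (simp add: L2inner_def)
  also have "\<dots> = integral {a..b} (\<lambda>s. L2inner g (\<lambda>x. v (x + s)))"
  proof -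
    have "continuous_on {a..b} (\<lambda>s. L2inner g (\<lambda>x. v (x + s)))"
      using L2inner_shift_continuous[OF g v] continuous_on_subset by blast
    then have "set_integrable lborel {a..b} (\<lambda>s. L2inner g (\<lambda>x. v (x + s)))"
      unfolding set_integrable_def by (intro borel_integrable_compact) auto
    then show ?thesis
      using integral_unique[OF has_integral_LBINT, of "{a..b}" "\<lambda>s. L2inner g (\<lambda>x. v (x + s))"] by simp
  qed
  finally show ?thesis .
qed

section \<open>Convergence and norm bounds of difference quotients\<close>

lemma average_tendsto:
  fixes c :: "real \<Rightarrow> complex"
  assumes "continuous_on UNIV c"
  shows "((\<lambda>h. integral {-h..h} c / (2 * complex_of_real h)) \<longlongrightarrow> c 0) (at_right 0)"
proof (rule tendstoI)
  fix e :: real assume "0 < e"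
  have "isCont c 0" using assms by (simp add: continuous_on_eq_continuous_at)
  then obtain d where d: "0 < d" "\<And>x. \<bar>x\<bar> < d \<Longrightarrow> dist (c x) (c 0) < e/2"
    using \<open>0 < e\<close> unfolding continuous_at_eps_delta by (metis diff_zero dist_real_def half_gt_zero)
  have "dist (integral {-h..h} c / (2 * complex_of_real h)) (c 0) < e" if h: "0 < h" "h < d" for h
  proof -
    have i: "c integrable_on {-h..h}"
      by (rule integrable_continuous_real) (use assms continuous_on_subset in blast)
    have "integral {-h..h} c - 2 * of_real h * c 0 = integral {-h..h} (\<lambda>s. c s - c 0)"
      using i h by (subst Henstock_Kurzweil_Integration.integral_diff) (auto simp: scaleR_conv_of_real)
    also have "norm \<dots> \<le> e/2 * (h - (-h))"
      by (rule integral_bound)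
         (use h d(2) assms in \<open>force simp: dist_norm abs_if intro!: continuous_intros
            intro: continuous_on_subset less_imp_le split: if_splits\<close>)+
    finally have "norm (integral {-h..h} c - 2 * of_real h * c 0) \<le> e * h" by simp
    then have "norm ((integral {-h..h} c - 2 * of_real h * c 0) / (2 * of_real h)) \<le> e / 2"
      using h by (simp add: norm_divide norm_mult field_simps)
    moreover have "(integral {-h..h} c - 2 * of_real h * c 0) / (2 * of_real h) = integral {-h..h} c / (2 * of_real h) - c 0"
      using h by (simp add: diff_divide_distrib)
    ultimately show ?thesis using \<open>0 < e\<close> by (simp add: dist_norm)
  qed
  then show "eventually (\<lambda>h. dist (integral {-h..h} c / (2 * complex_of_real h)) (c 0) < e) (at_right 0)"
    unfolding eventually_at_right_field using d(1) by (intro exI[of _ d]) auto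
qed

text \<open>The quotient is the mean over [-h, h] of the continuous function s -> <g, v(. + s)>.
  Only this weak convergence is needed to pass to the limit in the quadratic virial term.\<close>

lemma central_difference_tendsto:
  assumes g: "sq_int g" and uv: "is_H1_deriv u v"
  shows "((\<lambda>h. L2inner g (\<lambda>x. u (x + h) - u (x - h)) / (2 * complex_of_real h)) \<longlongrightarrow> L2inner g v) (at_right 0)"
proof -
  let ?c = "\<lambda>s. L2inner g (\<lambda>x. v (x + s))"
  have "((\<lambda>h. integral {-h..h} ?c / (2 * complex_of_real h)) \<longlongrightarrow> ?c 0) (at_right 0)"
    by (intro average_tendsto L2inner_shift_continuous g is_H1_deriv_sq_int[OF uv])
  moreover have "eventually (\<lambda>h. integral {-h..h} ?c / (2 * complex_of_real h) =
      L2inner g (\<lambda>x. u (x + h) - u (x - h)) / (2 * complex_of_real h)) (at_right 0)"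
    using eventually_at_right_less[of 0]
  proof eventually_elim
    case (elim h)
    then show ?case using L2inner_difference[OF g uv, of "-h" h] by simp
  qed
  ultimately show ?thesis by (simp add: tendsto_cong)
qed

text \<open>The difference is paired with itself, which bounds its squared norm by its norm times (b
  - a) times that of \<open>v\<close>; one factor is then cancelled.\<close>

lemma L2n_difference_le:
  assumes u: "sq_int u" and uv: "is_H1_deriv u v" and "a \<le> b"
  shows "L2n (\<lambda>x. u (x + b) - u (x + a)) \<le> (b - a) * L2n v"
proof -
  let ?D = "\<lambda>x. u (x + b) - u (x + a)"
  have D: "sq_int ?D" by (intro sq_int_diff sq_int_shift u)
  have v: "sq_int v" using uv by (rule is_H1_deriv_sq_int)
  have "L2sq ?D = norm (L2inner ?D ?D)" by (simp add: L2inner_self)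
  also have "L2inner ?D ?D = integral {a..b} (\<lambda>s. L2inner ?D (\<lambda>x. v (x + s)))"
    by (rule L2inner_difference[OF D uv \<open>a \<le> b\<close>])
  also have "norm \<dots> \<le> (L2n ?D * L2n v) * (b - a)"
  proof (rule integral_bound[OF \<open>a \<le> b\<close>])
    show "continuous_on {a..b} (\<lambda>s. L2inner ?D (\<lambda>x. v (x + s)))"
      using L2inner_shift_continuous[OF D v] continuous_on_subset by blast
    show "norm (L2inner ?D (\<lambda>x. v (x + s))) \<le> L2n ?D * L2n v" for s
      using L2_Cauchy_Schwarz[OF D sq_int_shift[OF v, of s]] by (simp add: L2sq_shift)
  qed
  finally have "L2n ?D * L2n ?D \<le> L2n ?D * ((b - a) * L2n v)"
    by (simp add: algebra_simps)
  moreover have "0 \<le> (b - a) * L2n v" using \<open>a \<le> b\<close> by simp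
  moreover have "x \<le> y" if "x * x \<le> x * y" "0 \<le> y" for x y :: real
    using that by (cases "0 < x") auto
  ultimately show ?thesis by blast
qed

section \<open>Algebra, uniqueness and pointwise consequences of the weak derivative\<close>

lemma is_H1_deriv_cmult:
  assumes "is_H1_deriv u v"
  shows "is_H1_deriv (\<lambda>x. c * u x) (\<lambda>x. c * v x)"
  unfolding is_H1_deriv_def
proof safe
  show "sq_int (\<lambda>x. c * v x)" using assms by (intro sq_int_cmult is_H1_deriv_sq_int)
  fix a b :: real assume "a \<le> b"
  then have "((\<lambda>x. c * v x) has_integral c * (u b - u a)) {a..b}"
    using assms by (intro has_integral_mult_right) (auto simp: is_H1_deriv_def)
  then show "((\<lambda>x. c * v x) has_integral c * u b - c * u a) {a..b}"
    by (simp add: right_diff_distrib)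
qed

lemma is_H1_deriv_add:
  assumes "is_H1_deriv u v" "is_H1_deriv u' v'"
  shows "is_H1_deriv (\<lambda>x. u x + u' x) (\<lambda>x. v x + v' x)"
  unfolding is_H1_deriv_def
proof safe
  show "sq_int (\<lambda>x. v x + v' x)" using assms by (intro sq_int_add is_H1_deriv_sq_int)
  fix a b :: real assume "a \<le> b"
  then have "((\<lambda>x. v x + v' x) has_integral (u b - u a) + (u' b - u' a)) {a..b}"
    using assms by (intro has_integral_add) (auto simp: is_H1_deriv_def)
  then show "((\<lambda>x. v x + v' x) has_integral u b + u' b - (u a + u' a)) {a..b}"
    by (simp add: add_diff_add)
qed

lemma is_H1_deriv_diff:
  assumes "is_H1_deriv u v" "is_H1_deriv u' v'"
  shows "is_H1_deriv (\<lambda>x. u x - u' x) (\<lambda>x. v x - v' x)"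
  using is_H1_deriv_add[OF assms(1) is_H1_deriv_cmult[OF assms(2), of "-1"]] by simp

lemma is_H1_deriv_shift:
  assumes "is_H1_deriv u v"
  shows "is_H1_deriv (\<lambda>x. u (x + h)) (\<lambda>x. v (x + h))"
  unfolding is_H1_deriv_def
proof safe
  show "sq_int (\<lambda>x. v (x + h))" using assms by (intro sq_int_shift is_H1_deriv_sq_int)
  fix a b :: real assume "a \<le> b"
  then have "(v has_integral (u (b + h) - u (a + h))) {a + h..b + h}"
    using assms by (simp add: is_H1_deriv_def)
  then show "((\<lambda>x. v (x + h)) has_integral u (b + h) - u (a + h)) {a..b}"
    using has_integral_affinity'[of v "u (b + h) - u (a + h)" "a + h" "b + h" 1 h] by simp
qed

text \<open>The difference quotients of 0, paired with \<open>f\<close>, vanish and at the same time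
  converge to <f, f>.\<close>

lemma is_H1_deriv_zero_imp:
  assumes "is_H1_deriv (\<lambda>_. 0) f"
  shows "L2sq f = 0"
proof -
  have f: "sq_int f" using assms by (rule is_H1_deriv_sq_int)
  have "((\<lambda>h. 0) \<longlongrightarrow> L2inner f f) (at_right (0::real))"
    using central_difference_tendsto[OF f assms] by (simp add: L2inner_def)
  then have "L2inner f f = 0" by (simp add: tendsto_const_iff)
  then show ?thesis by (simp add: L2inner_self)
qed

lemma is_H1_deriv_unique:
  assumes "is_H1_deriv u v" "is_H1_deriv u v'"
  shows "AE x in lborel. v x = v' x"
proof -
  have "is_H1_deriv (\<lambda>_. 0) (\<lambda>x. v x - v' x)"
    using is_H1_deriv_diff[OF assms] by simp
  from is_H1_deriv_zero_imp[OF this] is_H1_deriv_sq_int[OF this]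
  have "AE x in lborel. (cmod (v x - v' x))\<^sup>2 = 0"
    by (subst (asm) L2sq_def, subst (asm) integral_nonneg_eq_0_iff_AE) (auto simp: sq_int_def)
  then show ?thesis by eventually_elim simp
qed

lemma H1_deriv_is: "H1 u \<Longrightarrow> is_H1_deriv u (H1_deriv u)"
  unfolding H1_def H1_deriv_def by (metis someI_ex)

lemma is_H1_deriv_H1_deriv: "is_H1_deriv u v \<Longrightarrow> is_H1_deriv u (H1_deriv u)"
  unfolding H1_deriv_def by (metis someI)

text \<open>\<open>H1_deriv\<close> is an arbitrary choice among derivatives that agree a.e.; this
  lemma and the next allow any explicit derivative to be used in its place under the
  integral.\<close>

lemma L2sq_H1_deriv:
  assumes "is_H1_deriv u v" shows "L2sq (H1_deriv u) = L2sq v"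
  unfolding L2sq_def
proof (rule integral_cong_AE)
  show "AE x in lborel. (cmod (H1_deriv u x))\<^sup>2 = (cmod (v x))\<^sup>2"
    using is_H1_deriv_unique[OF is_H1_deriv_H1_deriv[OF assms] assms] by eventually_elim simp
qed (use is_H1_deriv_sq_int[OF is_H1_deriv_H1_deriv[OF assms]] is_H1_deriv_sq_int[OF assms] in \<open>auto dest!: sq_int_measurable\<close>)

lemma L2inner_H1_deriv_right:
  assumes "is_H1_deriv u v" "sq_int f" shows "L2inner f (H1_deriv u) = L2inner f v"
  unfolding L2inner_def
proof (rule integral_cong_AE)
  show "AE x in lborel. f x * cnj (H1_deriv u x) = f x * cnj (v x)"
    using is_H1_deriv_unique[OF is_H1_deriv_H1_deriv[OF assms(1)] assms(1)] by eventually_elim simp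
qed (use sq_int_mult_integrable[OF assms(2) is_H1_deriv_sq_int[OF is_H1_deriv_H1_deriv[OF assms(1)]]]
     sq_int_mult_integrable[OF assms(2) is_H1_deriv_sq_int[OF assms(1)]] in auto)

lemma H1I: "sq_int u \<Longrightarrow> is_H1_deriv u v \<Longrightarrow> H1 u"
  by (auto simp: H1_def)

lemma H1_sq_int: "H1 u \<Longrightarrow> sq_int u"
  by (simp add: H1_def)

lemma H1_deriv_sq_int: "H1 u \<Longrightarrow> sq_int (H1_deriv u)"
  by (rule is_H1_deriv_sq_int[OF H1_deriv_is])

text \<open>Cauchy-Schwarz of \<open>v\<close> against the indicator of the interval. The growth
  like the square root of the distance later controls the weighted function by its value at
  0.\<close>

lemma H1_deriv_increment:
  assumes "is_H1_deriv u v"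
  shows "cmod (u x - u y) \<le> sqrt \<bar>x - y\<bar> * L2n v"
proof -
  have *: "cmod (u b - u a) \<le> sqrt (b - a) * L2n v" if "a \<le> b" for a b
  proof -
    let ?i = "\<lambda>x. indicator {a..b} x :: complex"
    have v: "sq_int v" using assms by (rule is_H1_deriv_sq_int)
    have n: "(cmod (?i x))\<^sup>2 = indicator {a..b} x" for x by (simp add: indicator_def)
    have i: "sq_int ?i" unfolding sq_int_def n
      by (auto simp: emeasure_lborel_Icc_eq)
    have "L2sq ?i = b - a" unfolding L2sq_def n using that by simp
    moreover have "u b - u a = L2inner v ?i"
      unfolding is_H1_deriv_LBINT[OF assms that, symmetric] L2inner_def
      by (intro Bochner_Integration.integral_cong) (auto simp: indicator_def)
    ultimately show ?thesis using L2_Cauchy_Schwarz[OF v i] by (simp add: mult.commute)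
  qed
  show ?thesis
    using *[of x y] *[of y x] by (cases "x \<le> y") (auto simp: norm_minus_commute abs_if)
qed

lemma H1_deriv_increment_sq:
  assumes "is_H1_deriv u v"
  shows "(cmod (u x - u y))\<^sup>2 \<le> \<bar>x - y\<bar> * L2sq v"
  using power_mono[OF H1_deriv_increment[OF assms, of x y] norm_ge_zero, of 2]
  by (simp add: power_mult_distrib)

lemma is_H1_deriv_continuous:
  assumes "is_H1_deriv u v"
  shows "continuous_on UNIV u"
proof -
  have "isCont u y" for y
    unfolding isCont_def
  proof (rule LIM_zero_cancel, rule Lim_null_comparison)
    show "eventually (\<lambda>x. norm (u x - u y) \<le> sqrt \<bar>x - y\<bar> * L2n v) (at y)"
      using H1_deriv_increment[OF assms] by simp
    have "((\<lambda>x. sqrt \<bar>x - y\<bar> * L2n v) \<longlongrightarrow> sqrt \<bar>y - y\<bar> * L2n v) (at y)"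
      by (intro tendsto_intros)
    then show "((\<lambda>x. sqrt \<bar>x - y\<bar> * L2n v) \<longlongrightarrow> 0) (at y)" by simp
  qed
  then show ?thesis by (simp add: continuous_at_imp_continuous_on)
qed

text \<open>Average over y in [x, x + 1] the inequality |u(x)|^2 <= 2 |u(y)|^2 + 2 |x - y|
  ||v||^2.\<close>

lemma Sobolev_bound:
  assumes u: "sq_int u" and uv: "is_H1_deriv u v"
  shows "(cmod (u x))\<^sup>2 \<le> 2 * L2sq u + 2 * L2sq v"
proof -
  have "(\<integral>y. indicator {x..x+1} y * ((cmod (u x))\<^sup>2) \<partial>lborel)
     \<le> (\<integral>y. 2 * (cmod (u y))\<^sup>2 + (2 * L2sq v) * indicator {x..x+1} y \<partial>lborel)"
  proof (rule integral_mono)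
    show "integrable lborel (\<lambda>y. indicator {x..x+1} y * ((cmod (u x))\<^sup>2))"
      by (intro integrable_mult_left integrable_real_indicator) (auto simp: emeasure_lborel_Icc_eq)
    show "integrable lborel (\<lambda>y. 2 * (cmod (u y))\<^sup>2 + (2 * L2sq v) * indicator {x..x+1} y)"
      using sq_int_integrable[OF u]
      by (intro Bochner_Integration.integrable_add integrable_mult_right integrable_real_indicator)
         (auto simp: emeasure_lborel_Icc_eq)
    fix y
    have "(cmod (u x))\<^sup>2 \<le> 2 * (cmod (u y))\<^sup>2 + 2 * L2sq v" if "y \<in> {x..x+1}"
    proof -
      have "\<bar>x - y\<bar> * L2sq v \<le> 1 * L2sq v"
        using that by (intro mult_right_mono) auto
      then show ?thesis
        using sum_sq_bound[of "u y" "u x - u y"] H1_deriv_increment_sq[OF uv, of x y] by simp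
    qed
    then show "indicator {x..x+1} y * ((cmod (u x))\<^sup>2) \<le> 2 * (cmod (u y))\<^sup>2 + (2 * L2sq v) * indicator {x..x+1} y"
      by (auto simp: indicator_def)
  qed
  also have "\<dots> = 2 * L2sq u + 2 * L2sq v"
    using sq_int_integrable[OF u]
    by (subst Bochner_Integration.integral_add)
       (auto simp: L2sq_def emeasure_lborel_Icc_eq intro!: integrable_mult_right integrable_real_indicator)
  finally show ?thesis by simp
qed

text \<open>Fubini for f(x) r(y) on the triangle a <= x <= y <= b. Its two slices are the intervals
  [x, b] and [a, y], which is why the hypotheses on \<open>R\<close> and \<open>F\<close> are
  anchored at opposite ends.\<close>

lemma AC_product_rule:
  fixes f r F R :: "real \<Rightarrow> complex"
  assumes "a \<le> b"
    and f: "set_integrable lborel {a..b} f" and r: "set_integrable lborel {a..b} r"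
    and F: "\<And>x. x \<in> {a..b} \<Longrightarrow> (f has_integral F x - F a) {a..x}"
    and R: "\<And>x. x \<in> {a..b} \<Longrightarrow> (r has_integral R b - R x) {x..b}"
  shows "((\<lambda>x. f x * R x + F x * r x) has_integral F b * R b - F a * R a) {a..b}"
proof -
  let ?f = "\<lambda>x. indicator {a..b} x *\<^sub>R f x" and ?r = "\<lambda>x. indicator {a..b} x *\<^sub>R r x"
  have fi: "integrable lborel ?f" and ri: "integrable lborel ?r"
    using f r by (simp_all add: set_integrable_def)
  then have [measurable]: "?f \<in> borel_measurable borel" "?r \<in> borel_measurable borel"
    by (auto dest: borel_measurable_integrable)
  let ?k = "\<lambda>x y. indicator {z. fst z \<le> snd z} (x, y) *\<^sub>R (?f x * ?r y) :: complex"
  have T: "{z :: real \<times> real. fst z \<le> snd z} \<in> sets (borel \<Otimes>\<^sub>M borel)"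
    unfolding borel_prod by (intro borel_closed closed_Collect_le continuous_intros)
  have int: "integrable (lborel \<Otimes>\<^sub>M lborel) (case_prod ?k)"
  proof (rule Bochner_Integration.integrable_bound)
    show "integrable (lborel \<Otimes>\<^sub>M lborel) (\<lambda>(x, y). ?f x * ?r y)"
    proof (rule lborel_pair.Fubini_integrable)
      show "(\<lambda>(x, y). ?f x * ?r y) \<in> borel_measurable (lborel \<Otimes>\<^sub>M lborel)"
        by measurable
      show "integrable lborel (\<lambda>x. \<integral>y. norm (case_prod (\<lambda>x y. ?f x * ?r y) (x, y)) \<partial>lborel)"
        unfolding prod.case norm_mult
        using fi ri by (simp del: norm_scaleR)
      show "AE x in lborel. integrable lborel (\<lambda>y. case_prod (\<lambda>x y. ?f x * ?r y) (x, y))"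
        unfolding prod.case using ri by (intro AE_I2 integrable_mult_right)
    qed
    show "case_prod ?k \<in> borel_measurable (lborel \<Otimes>\<^sub>M lborel)"
      using T by measurable
    show "AE z in lborel \<Otimes>\<^sub>M lborel. norm (case_prod ?k z) \<le> norm (case_prod (\<lambda>x y. ?f x * ?r y) z)"
      by (intro AE_I2) (auto simp: indicator_def)
  qed
  have LB: "(\<integral>x. indicator {c..d} x *\<^sub>R h x \<partial>lborel) = I"
    if "(h has_integral I) {c..d}" "set_integrable lborel {a..b} h" "a \<le> c" "d \<le> b" for h :: "real \<Rightarrow> complex" and c d I
  proof -
    have "set_integrable lborel {c..d} h"
      by (rule set_integrable_subset[OF that(2)]) (use that in auto)
    from has_integral_LBINT[OF this] that(1) show ?thesis using has_integral_unique by blast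
  qed
  have x: "(\<integral>y. ?k x y \<partial>lborel) = ?f x * (R b - R x)" for x
  proof (cases "x \<in> {a..b}")
    case True
    have "(\<integral>y. ?k x y \<partial>lborel) = (\<integral>y. f x * (indicator {x..b} y *\<^sub>R r y) \<partial>lborel)"
      using True by (intro Bochner_Integration.integral_cong) (auto simp: indicator_def)
    also have "\<dots> = f x * (\<integral>y. indicator {x..b} y *\<^sub>R r y \<partial>lborel)"
      by (simp only: integral_mult_right_zero)
    also have "\<dots> = f x * (R b - R x)"
      using LB[OF R[OF True] r] True by simp
    finally show ?thesis using True by simp
  qed auto
  have y: "(\<integral>x. ?k x y \<partial>lborel) = ?r y * (F y - F a)" for y
  proof (cases "y \<in> {a..b}")
    case True
    have "(\<integral>x. ?k x y \<partial>lborel) = (\<integral>x. (indicator {a..y} x *\<^sub>R f x) * r y \<partial>lborel)"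
      using True by (intro Bochner_Integration.integral_cong) (auto simp: indicator_def)
    also have "\<dots> = (\<integral>x. indicator {a..y} x *\<^sub>R f x \<partial>lborel) * r y"
      by (simp only: integral_mult_left_zero)
    also have "\<dots> = (F y - F a) * r y"
      using LB[OF F[OF True] f] True by simp
    finally show ?thesis using True by (simp add: mult.commute)
  qed auto
  have eq: "(\<integral>x. ?f x * (R b - R x) \<partial>lborel) = (\<integral>y. ?r y * (F y - F a) \<partial>lborel)"
    using lborel_pair.Fubini_integral[OF int] unfolding x y by simp
  have i1: "integrable lborel (\<lambda>x. ?f x * (R b - R x))"
    using lborel_pair.integrable_fst[OF int] unfolding x .
  have i2: "integrable lborel (\<lambda>y. ?r y * (F y - F a))"
    using lborel_pair.integrable_snd[OF int] unfolding y .
  \<comment> \<open>The integrand is regrouped around the two iterated integrals over the triangle,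
    which are equal by \<open>eq\<close> and enter with opposite signs; only boundary terms
    survive.\<close>
  have e: "indicator {a..b} x *\<^sub>R (f x * R x + F x * r x)
      = (R b * ?f x - ?f x * (R b - R x)) + (?r x * (F x - F a) + F a * ?r x)" for x
    by (simp add: algebra_simps indicator_def)
  have "set_integrable lborel {a..b} (\<lambda>x. f x * R x + F x * r x)"
    unfolding set_integrable_def e
    using fi ri i1 i2 by (intro Bochner_Integration.integrable_add Bochner_Integration.integrable_diff integrable_mult_right)
  from has_integral_LBINT[OF this]
  have "((\<lambda>x. f x * R x + F x * r x) has_integral
     (\<integral>x. (R b * ?f x - ?f x * (R b - R x)) + (?r x * (F x - F a) + F a * ?r x) \<partial>lborel)) {a..b}"
    unfolding e .
  also have "(\<integral>x. (R b * ?f x - ?f x * (R b - R x)) + (?r x * (F x - F a) + F a * ?r x) \<partial>lborel)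
     = (R b * (\<integral>x. ?f x \<partial>lborel) - (\<integral>x. ?f x * (R b - R x) \<partial>lborel))
       + ((\<integral>x. ?r x * (F x - F a) \<partial>lborel) + F a * (\<integral>x. ?r x \<partial>lborel))"
    using fi ri i1 i2
    by (simp only: Bochner_Integration.integral_add Bochner_Integration.integral_diff integral_mult_right_zero
        Bochner_Integration.integrable_add Bochner_Integration.integrable_diff integrable_mult_right)
  also have "\<dots> = F b * R b - F a * R a"
  proof -
    have 1: "(\<integral>x. ?f x \<partial>lborel) = F b - F a" using LB[OF F[of b] f] \<open>a \<le> b\<close> by simp
    have 2: "(\<integral>x. ?r x \<partial>lborel) = R b - R a" using LB[OF R[of a] r] \<open>a \<le> b\<close> by simp
    show ?thesis unfolding eq 1 2 by (simp add: algebra_simps)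
  qed
  finally show ?thesis .
qed

section \<open>Multipliers and the nonlinearity\<close>

text \<open>Bounded multipliers with a bounded derivative, understood in the integrated sense: a
  derivative at every point would exclude \<open>expw\<close>, which has a kink at 0.\<close>

definition W1inf :: "(real \<Rightarrow> real) \<Rightarrow> (real \<Rightarrow> real) \<Rightarrow> bool" where
  "W1inf m m' \<longleftrightarrow> m \<in> borel_measurable borel \<and> m' \<in> borel_measurable borel \<and>
     (\<exists>K. \<forall>x. \<bar>m x\<bar> \<le> K \<and> \<bar>m' x\<bar> \<le> K) \<and>
     (\<forall>a b. a \<le> b \<longrightarrow> (m' has_integral (m b - m a)) {a..b})"

lemma W1inf_add: assumes "W1inf m m'" "W1inf n n'" shows "W1inf (\<lambda>x. m x + n x) (\<lambda>x. m' x + n' x)"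
proof -
  obtain K L where K: "\<And>x. \<bar>m x\<bar> \<le> K" "\<And>x. \<bar>m' x\<bar> \<le> K" and L: "\<And>x. \<bar>n x\<bar> \<le> L" "\<And>x. \<bar>n' x\<bar> \<le> L"
    using assms unfolding W1inf_def by blast
  have "\<bar>m x + n x\<bar> \<le> K + L" "\<bar>m' x + n' x\<bar> \<le> K + L" for x
    using K[of x] L[of x] by linarith+
  moreover have "((\<lambda>x. m' x + n' x) has_integral (m b + n b - (m a + n a))) {a..b}" if "a \<le> b" for a b
  proof -
    have "((\<lambda>x. m' x + n' x) has_integral (m b - m a) + (n b - n a)) {a..b}"
      using assms that by (intro has_integral_add) (auto simp: W1inf_def)
    then show ?thesis by (simp add: algebra_simps)
  qed
  ultimately show ?thesis
    using assms unfolding W1inf_def by (auto intro!: borel_measurable_add)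
qed

lemma W1inf_shift: assumes "W1inf m m'" shows "W1inf (\<lambda>x. m (x + h)) (\<lambda>x. m' (x + h))"
proof -
  have [measurable]: "m \<in> borel_measurable borel" "m' \<in> borel_measurable borel"
    using assms by (auto simp: W1inf_def)
  obtain K where "\<And>x. \<bar>m x\<bar> \<le> K" "\<And>x. \<bar>m' x\<bar> \<le> K"
    using assms unfolding W1inf_def by blast
  moreover have "((\<lambda>x. m' (x + h)) has_integral (m (b + h) - m (a + h))) {a..b}" if "a \<le> b" for a b
  proof -
    have "(m' has_integral (m (b + h) - m (a + h))) {a + h..b + h}"
      using assms that by (auto simp: W1inf_def)
    from has_integral_affinity'[OF this[unfolded interval_cbox], of 1 h] show ?thesis by simp
  qed
  moreover have "(\<lambda>x. m (x + h)) \<in> borel_measurable borel" "(\<lambda>x. m' (x + h)) \<in> borel_measurable borel"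
    by measurable
  ultimately show ?thesis unfolding W1inf_def by blast
qed

lemma is_H1_deriv_mult:
  assumes m: "W1inf m m'" and u: "sq_int u" and uv: "is_H1_deriv u v"
  shows "is_H1_deriv (\<lambda>x. complex_of_real (m x) * u x)
     (\<lambda>x. complex_of_real (m' x) * u x + complex_of_real (m x) * v x)"
  unfolding is_H1_deriv_def
proof safe
  have [measurable]: "m \<in> borel_measurable borel" "m' \<in> borel_measurable borel"
    using m by (auto simp: W1inf_def)
  obtain K where K: "\<And>x. \<bar>m x\<bar> \<le> K" "\<And>x. \<bar>m' x\<bar> \<le> K"
    using m unfolding W1inf_def by blast
  show "sq_int (\<lambda>x. complex_of_real (m' x) * u x + complex_of_real (m x) * v x)"
    by (intro sq_int_add sq_int_mult_bounded[where K = K] u is_H1_deriv_sq_int[OF uv])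
       (auto simp: K)
  fix a b :: real assume ab: "a \<le> b"
  show "((\<lambda>x. complex_of_real (m' x) * u x + complex_of_real (m x) * v x) has_integral
      complex_of_real (m b) * u b - complex_of_real (m a) * u a) {a..b}"
  proof (rule AC_product_rule[OF ab])
    show "set_integrable lborel {a..b} (\<lambda>x. complex_of_real (m' x))"
      unfolding set_integrable_def
    proof (rule Bochner_Integration.integrable_bound[where f = "\<lambda>x. K * indicator {a..b} x"])
      show "integrable lborel (\<lambda>x. K * indicator {a..b} x)"
        by (intro integrable_mult_right integrable_real_indicator) (auto simp: emeasure_lborel_Icc_eq)
      show "AE x in lborel. norm (indicator {a..b} x *\<^sub>R complex_of_real (m' x)) \<le> norm (K * indicator {a..b} x)"
        using K(2) by (intro AE_I2) (auto simp: indicator_def intro: order_trans[OF _ abs_ge_self])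
    qed measurable
    show "set_integrable lborel {a..b} v"
      by (intro sq_int_set_integrable is_H1_deriv_sq_int[OF uv])
    fix x assume x: "x \<in> {a..b}"
    have "(m' has_integral (m x - m a)) {a..x}" using m x by (auto simp: W1inf_def)
    from has_integral_linear[OF this bounded_linear_of_real]
    show "((\<lambda>x. complex_of_real (m' x)) has_integral complex_of_real (m x) - complex_of_real (m a)) {a..x}"
      by (simp add: o_def)
    show "(v has_integral u b - u x) {x..b}"
      using uv x by (auto simp: is_H1_deriv_def)
  qed
qed

section \<open>Pointwise estimates for the nonlinearity\<close>

locale nonlinearity =
  fixes g :: "real \<Rightarrow> real"
  assumes g_cont: "continuous_on {0..} g"
    and g_deriv: "\<And>s. 0 < s \<Longrightarrow> (g has_real_derivative deriv g s) (at s)"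
    and g_deriv_bound: "\<And>R. \<exists>C. \<forall>s. 0 < s \<longrightarrow> s \<le> R \<longrightarrow> \<bar>s * deriv g s\<bar> \<le> C"
    and g_nonneg: "\<And>s. 0 \<le> s \<Longrightarrow> 0 \<le> g s"
    and g_superlinear: "\<And>s. 0 \<le> s \<Longrightarrow> 0 \<le> s * g s - prim g s"
begin

text \<open>Density of the nonlinear virial term, and also the excess of <\<open>Nl\<close> u, u>
  over the potential term of the energy. Its derivative is \<open>s * deriv g s\<close>, which stays
  bounded near 0 even if \<open>deriv g\<close> does not.\<close>

definition defect :: "real \<Rightarrow> real" where
  "defect s = s * g s - prim g s"

lemma defect_nonneg: "0 \<le> s \<Longrightarrow> 0 \<le> defect s"
  using g_superlinear[of s] by (simp add: defect_def)

lemma g_cont_Icc: "0 \<le> a \<Longrightarrow> continuous_on {a..b} g"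
  by (rule continuous_on_subset[OF g_cont]) auto

lemma prim_increment:
  assumes "0 \<le> a" "a \<le> b"
  shows "prim g b - prim g a = integral {a..b} g"
  using Henstock_Kurzweil_Integration.integral_combine[of 0 a b g] assms g_cont_Icc[of 0 b]
  by (simp add: prim_def integrable_continuous_real)

lemma prim_nonneg: assumes "0 \<le> s" shows "0 \<le> prim g s"
  unfolding prim_def using g_nonneg by (intro Henstock_Kurzweil_Integration.integral_nonneg
      integrable_continuous_real g_cont_Icc) auto

lemma prim_continuous: "continuous_on {0..R} (prim g)"
  unfolding prim_def
  by (intro indefinite_integral_continuous_1 integrable_continuous_real g_cont_Icc) auto

lemma prim_deriv: assumes "0 < s" shows "(prim g has_real_derivative g s) (at s)"
proof -
  have "(prim g has_real_derivative g s) (at s within {0..s+1})"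
    unfolding prim_def by (rule integral_has_real_derivative[OF g_cont_Icc]) (use assms in auto)
  then show ?thesis
    by (subst (asm) at_within_interior) (use assms in \<open>auto simp: interior_atLeastAtMost_real\<close>)
qed

lemma g_bounded: "\<exists>C\<ge>0. \<forall>s. 0 \<le> s \<longrightarrow> s \<le> R \<longrightarrow> \<bar>g s\<bar> \<le> C"
proof -
  have "compact (g ` {0..R})" by (intro compact_continuous_image g_cont_Icc) auto
  then obtain C where "\<And>s. s \<in> {0..R} \<Longrightarrow> \<bar>g s\<bar> \<le> C"
    by (metis bounded_iff compact_imp_bounded image_eqI real_norm_def)
  then show ?thesis by (intro exI[of _ "max 0 C"]) (auto simp: le_max_iff_disj)
qed

lemma prim_le:
  assumes C: "\<And>s. 0 \<le> s \<Longrightarrow> s \<le> R \<Longrightarrow> \<bar>g s\<bar> \<le> C" and s: "0 \<le> s" "s \<le> R"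
  shows "prim g s \<le> C * s"
proof -
  have "norm (integral {0..s} g) \<le> C * (s - 0)"
    by (rule integral_bound) (use s C g_cont_Icc in auto)
  then show ?thesis by (simp add: prim_def)
qed

text \<open>Near \<open>0\<close> only \<open>s * deriv g s\<close> is bounded, not \<open>deriv g\<close>. The error is still quadratic in
  \<open>r2 - r1\<close>: if \<open>r2 \<ge> 2 * r1\<close> then \<open>r1 + r2\<close> is comparable to \<open>r2 - r1\<close>, and otherwise the
  derivative bound is applied on an interval whose end points are comparable.\<close>
lemma trapezoid_error:
  assumes C0: "\<And>s. 0 \<le> s \<Longrightarrow> s \<le> R \<Longrightarrow> \<bar>g s\<bar> \<le> C0"
    and C1: "\<And>s. 0 < s \<Longrightarrow> s \<le> R \<Longrightarrow> \<bar>s * deriv g s\<bar> \<le> C1"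
    and r: "0 \<le> r1" "r1 \<le> r2" "r2\<^sup>2 \<le> R"
  shows "\<bar>prim g (r2\<^sup>2) - prim g (r1\<^sup>2) - (r2\<^sup>2 - r1\<^sup>2) * (g (r1\<^sup>2) + g (r2\<^sup>2)) / 2\<bar>
     \<le> (6 * C0 + 9 * C1) * (r2 - r1)\<^sup>2"
proof (cases "r1 = r2")
  case False
  with r have r12: "r1 < r2" by simp
  let ?s1 = "r1\<^sup>2" and ?s2 = "r2\<^sup>2" let ?c = "(g (r1\<^sup>2) + g (r2\<^sup>2)) / 2"
  have s: "0 \<le> ?s1" "?s1 \<le> ?s2" using r by (auto intro: power_mono)
  have R: "0 < R" using r r12 by (smt (verit) zero_less_power)
  have C0': "0 \<le> C0" using C0[of 0] R by simp
  have C1': "0 \<le> C1" using C1[of R] R by simp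
  have eq: "prim g ?s2 - prim g ?s1 - (?s2 - ?s1) * (g ?s1 + g ?s2) / 2 = integral {?s1..?s2} (\<lambda>s. g s - ?c)"
    unfolding prim_increment[OF s]
    using s g_cont_Icc[OF s(1)] by (subst Henstock_Kurzweil_Integration.integral_diff) (auto intro: integrable_continuous_real)
  have bnd: "\<bar>integral {?s1..?s2} (\<lambda>s. g s - ?c)\<bar> \<le> B * (?s2 - ?s1)"
    if "\<And>s. s \<in> {?s1..?s2} \<Longrightarrow> \<bar>g s - ?c\<bar> \<le> B" for B
  proof -
    have "continuous_on {?s1..?s2} (\<lambda>s. g s - ?c)"
      by (intro continuous_intros g_cont_Icc s(1))
    from integral_bound[OF s(2) this] that show ?thesis by simp
  qed
  have d: "?s2 - ?s1 = (r2 - r1) * (r2 + r1)" by (simp add: power2_eq_square algebra_simps)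
  show ?thesis
  proof (cases "2 * r1 \<le> r2")
    case True
    have "\<bar>g s - ?c\<bar> \<le> 2 * C0" if "s \<in> {?s1..?s2}" for s
    proof -
      have "0 \<le> s" "s \<le> R" using that order_trans[OF s(1)] r(3) by auto
      then have "\<bar>g s\<bar> \<le> C0" "\<bar>g ?s1\<bar> \<le> C0" "\<bar>g ?s2\<bar> \<le> C0" using C0 s r(3) by auto
      then show ?thesis unfolding abs_le_iff by argo
    qed
    then have "\<bar>integral {?s1..?s2} (\<lambda>s. g s - ?c)\<bar> \<le> 2 * C0 * (?s2 - ?s1)" by (rule bnd)
    \<comment> \<open>From \<open>2 * r1 \<le> r2\<close> follows r1 + r2 <= 3 (r2 - r1); with the
      crude bound \<open>2 * C0\<close> this is the source of \<open>6 * C0\<close>.\<close>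
    also have "\<dots> \<le> 2 * C0 * ((r2 - r1) * (3 * (r2 - r1)))"
      unfolding d using True r C0' by (intro mult_left_mono) auto
    also have "\<dots> = 6 * C0 * (r2 - r1)\<^sup>2" by (simp add: power2_eq_square)
    also have "\<dots> \<le> (6 * C0 + 9 * C1) * (r2 - r1)\<^sup>2" using C1' by (intro mult_right_mono) auto
    finally show ?thesis unfolding eq .
  next
    case False
    then have r1: "0 < r1" using r by linarith
    then have s1: "0 < ?s1" by simp
    \<comment> \<open>The mean value theorem applies because \<open>?s1\<close> is positive here,
      and the derivative bound C1 / z is largest at that left end.\<close>
    have gd: "\<bar>g y - g x\<bar> \<le> C1 / ?s1 * (?s2 - ?s1)" if xy: "x \<in> {?s1..?s2}" "y \<in> {?s1..?s2}" "x \<le> y" for x y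
    proof (cases "x = y")
      case False
      with xy have "x < y" by simp
      have "\<exists>z. x < z \<and> z < y \<and> g y - g x = (y - x) * deriv g z"
      proof (rule MVT2[OF \<open>x < y\<close>])
        fix z assume "x \<le> z"
        then have "0 < z" using xy s1 by (meson atLeastAtMost_iff order_less_le_trans)
        then show "(g has_real_derivative deriv g z) (at z)" by (rule g_deriv)
      qed
      then obtain z where z: "x < z" "z < y" "g y - g x = (y - x) * deriv g z" by blast
      have "?s1 \<le> z" using z(1) xy by auto
      then have z0: "0 < z" "?s1 \<le> z" using s1 by linarith+
      have "\<bar>deriv g z\<bar> \<le> C1 / z"
        using C1[of z] z0 z xy r by (simp add: abs_mult field_simps)
      also have "\<dots> \<le> C1 / ?s1" by (intro divide_left_mono mult_pos_pos z0 s1 C1')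
      finally have "(y - x) * \<bar>deriv g z\<bar> \<le> (?s2 - ?s1) * (C1 / ?s1)"
        using xy s by (intro mult_mono) auto
      then show ?thesis using z \<open>x < y\<close> by (simp add: abs_mult mult.commute)
    qed (use C1' s in auto)
    have "\<bar>g s - ?c\<bar> \<le> C1 / ?s1 * (?s2 - ?s1)" if "s \<in> {?s1..?s2}" for s
    proof -
      have "\<bar>x - (y + z) / 2\<bar> \<le> B" if "\<bar>x - y\<bar> \<le> B" "\<bar>z - x\<bar> \<le> B" for x y z B :: real
        using that unfolding abs_le_iff by argo
      then show ?thesis using gd[of ?s1 s] gd[of s ?s2] that by auto
    qed
    then have "\<bar>integral {?s1..?s2} (\<lambda>s. g s - ?c)\<bar> \<le> C1 / ?s1 * (?s2 - ?s1) * (?s2 - ?s1)" by (rule bnd)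
    also have "\<dots> = C1 * (r2 - r1)\<^sup>2 * ((r2 + r1) / r1)\<^sup>2"
      unfolding d by (simp add: power2_eq_square field_simps)
    \<comment> \<open>Here r2 < 2 r1, so (r2 + r1) / r1 <= 3; its square gives the
      \<open>9 * C1\<close>.\<close>
    also have "\<dots> \<le> C1 * (r2 - r1)\<^sup>2 * 3\<^sup>2"
      using False r1 r C1' by (intro mult_left_mono power_mono) (auto simp: field_simps)
    also have "\<dots> = 9 * C1 * (r2 - r1)\<^sup>2" by simp
    also have "\<dots> \<le> (6 * C0 + 9 * C1) * (r2 - r1)\<^sup>2" using C0' by (intro mult_right_mono) auto
    finally show ?thesis unfolding eq .
  qed
qed simp

text \<open>Lets both the energy law and the virial identity avoid a chain rule for \<open>prim g\<close>
  along weakly differentiable functions.\<close>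
lemma nonlinear_commutator:
  "\<exists>C\<ge>0. \<forall>z1 z2. (cmod z1)\<^sup>2 \<le> R \<longrightarrow> (cmod z2)\<^sup>2 \<le> R \<longrightarrow>
     \<bar>(g ((cmod z2)\<^sup>2) - g ((cmod z1)\<^sup>2)) * Re (z2 * cnj z1) - (defect ((cmod z2)\<^sup>2) - defect ((cmod z1)\<^sup>2))\<bar>
       \<le> C * (cmod (z2 - z1))\<^sup>2"
proof -
  obtain C0 where C0: "C0 \<ge> 0" "\<And>s. 0 \<le> s \<Longrightarrow> s \<le> R \<Longrightarrow> \<bar>g s\<bar> \<le> C0"
    using g_bounded[of R] by blast
  obtain C1 where "\<And>s. 0 < s \<Longrightarrow> s \<le> R \<Longrightarrow> \<bar>s * deriv g s\<bar> \<le> C1"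
    using g_deriv_bound[of R] by blast
  then have C1: "\<And>s. 0 < s \<Longrightarrow> s \<le> R \<Longrightarrow> \<bar>s * deriv g s\<bar> \<le> max 0 C1" by (simp add: le_max_iff_disj)
  define C where "C = 6 * C0 + 9 * max 0 C1"
  have C: "0 \<le> C" using C0(1) by (simp add: C_def)
  show ?thesis
  proof (intro exI[of _ "C + C0"] conjI allI impI)
    fix z1 z2 assume z: "(cmod z1)\<^sup>2 \<le> R" "(cmod z2)\<^sup>2 \<le> R"
    let ?s1 = "(cmod z1)\<^sup>2" and ?s2 = "(cmod z2)\<^sup>2" and ?d = "(cmod (z2 - z1))\<^sup>2"
    let ?T = "prim g ?s2 - prim g ?s1 - (?s2 - ?s1) * (g ?s1 + g ?s2) / 2"
    \<comment> \<open>Polarization: up to the quadratic term \<open>?d\<close>, the real part is the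
      mean of \<open>?s1\<close> and \<open>?s2\<close>. With that mean in its place, the expression
      becomes the error \<open>?T\<close> of the trapezoid rule for the integral of \<open>g\<close>
      from \<open>?s1\<close> to \<open>?s2\<close>.\<close>
    have Re: "Re (z2 * cnj z1) = (?s1 + ?s2 - ?d) / 2"
      unfolding cmod_power2 by (simp add: power2_eq_square algebra_simps)
    have eq: "(g ?s2 - g ?s1) * Re (z2 * cnj z1) - (defect ?s2 - defect ?s1) = ?T - (g ?s2 - g ?s1) * ?d / 2"
      unfolding Re defect_def by (simp add: field_simps)
    have "\<bar>?T\<bar> \<le> C * (cmod z2 - cmod z1)\<^sup>2"
    proof (cases "cmod z1 \<le> cmod z2")
      case True
      then show ?thesis using trapezoid_error[OF C0(2) C1 norm_ge_zero True z(2)] by (simp add: C_def)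
    next
      case False
      have swap: "?T = - (prim g ?s1 - prim g ?s2 - (?s1 - ?s2) * (g ?s2 + g ?s1) / 2)"
        by (simp add: field_simps)
      from False have "cmod z2 \<le> cmod z1" by simp
      from trapezoid_error[OF C0(2) C1 norm_ge_zero this z(1)] show ?thesis
        unfolding swap abs_minus_cancel C_def power2_commute[of "cmod z2"] .
    qed
    also have "\<dots> \<le> C * ?d"
    proof (intro mult_left_mono C)
      have "\<bar>cmod z2 - cmod z1\<bar> \<le> \<bar>cmod (z2 - z1)\<bar>" using norm_triangle_ineq3[of z2 z1] by simp
      then show "(cmod z2 - cmod z1)\<^sup>2 \<le> ?d" by (simp only: abs_le_square_iff)
    qed
    finally have 1: "\<bar>?T\<bar> \<le> C * ?d" .
    have "\<bar>g ?s2 - g ?s1\<bar> \<le> 2 * C0" using C0(2)[of ?s1] C0(2)[of ?s2] z by (simp add: abs_le_iff)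
    then have "\<bar>g ?s2 - g ?s1\<bar> * ?d \<le> (2 * C0) * ?d" by (rule mult_right_mono) simp
    then have 2: "\<bar>(g ?s2 - g ?s1) * ?d / 2\<bar> \<le> C0 * ?d" by (simp add: abs_mult)
    show "\<bar>(g ?s2 - g ?s1) * Re (z2 * cnj z1) - (defect ?s2 - defect ?s1)\<bar> \<le> (C + C0) * ?d"
      unfolding eq using 1 2 by (simp add: distrib_right)
  qed (use C C0(1) in auto)
qed

lemma defect_Lipschitz:
  "\<exists>C\<ge>0. \<forall>s1 s2. 0 \<le> s1 \<longrightarrow> s1 \<le> R \<longrightarrow> 0 \<le> s2 \<longrightarrow> s2 \<le> R \<longrightarrow> \<bar>defect s2 - defect s1\<bar> \<le> C * \<bar>s2 - s1\<bar>"
proof -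
  obtain C1 where C1: "\<And>s. 0 < s \<Longrightarrow> s \<le> R \<Longrightarrow> \<bar>s * deriv g s\<bar> \<le> C1"
    using g_deriv_bound[of R] by blast
  have *: "\<bar>defect s2 - defect s1\<bar> \<le> max 0 C1 * \<bar>s2 - s1\<bar>" if s: "0 \<le> s1" "s1 < s2" "s2 \<le> R" for s1 s2
  proof -
    have c: "continuous_on {s1..s2} defect"
      unfolding defect_def
      by (intro continuous_intros g_cont_Icc s continuous_on_subset[OF prim_continuous[of s2]]) (use s in auto)
    have D: "(defect has_real_derivative x * deriv g x) (at x)" if "0 < x" for x
      unfolding defect_def
      by (rule derivative_eq_intros g_deriv prim_deriv that refl | simp)+
    have "\<exists>l z. s1 < z \<and> z < s2 \<and> (defect has_real_derivative l) (at z) \<and> defect s2 - defect s1 = (s2 - s1) * l"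
      by (rule MVT[OF s(2) c]) (use s D in \<open>auto simp: real_differentiable_def intro: order_le_less_trans\<close>)
    then obtain l z where z: "s1 < z" "z < s2" "(defect has_real_derivative l) (at z)" "defect s2 - defect s1 = (s2 - s1) * l"
      by blast
    have "l = z * deriv g z" using DERIV_unique[OF z(3) D] s z by simp
    then have "\<bar>l\<bar> \<le> max 0 C1" using C1[of z] s z by simp
    then show ?thesis using z(4) s by (simp add: abs_mult mult.commute mult_right_mono)
  qed
  show ?thesis
  proof (intro exI[of _ "max 0 C1"] conjI allI impI)
    fix s1 s2 assume "0 \<le> s1" "s1 \<le> R" "0 \<le> s2" "s2 \<le> R"
    then show "\<bar>defect s2 - defect s1\<bar> \<le> max 0 C1 * \<bar>s2 - s1\<bar>"
      using *[of s1 s2] *[of s2 s1] by (cases s1 s2 rule: linorder_cases) (auto simp: abs_minus_commute)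
  qed simp
qed

end

section \<open>Time-dependent functions\<close>

abbreviation H1n :: "(real \<Rightarrow> complex) \<Rightarrow> real" where
  "H1n f \<equiv> sqrt (H1sq f)"

lemma H1sq_nonneg [simp]: "0 \<le> H1sq f"
  by (simp add: H1sq_def)

lemma L2n_le_H1n: "L2n f \<le> H1n f" "L2n (H1_deriv f) \<le> H1n f"
  by (simp_all add: H1sq_def)

lemma H1_diff: "H1 f \<Longrightarrow> H1 h \<Longrightarrow> H1 (\<lambda>x. f x - h x)"
  unfolding H1_def using is_H1_deriv_diff sq_int_diff by blast

lemma L2n_H1_deriv_diff:
  "H1 f \<Longrightarrow> H1 h \<Longrightarrow> L2n (\<lambda>x. H1_deriv f x - H1_deriv h x) = L2n (H1_deriv (\<lambda>x. f x - h x))"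
  using L2sq_H1_deriv[OF is_H1_deriv_diff[OF H1_deriv_is H1_deriv_is]] by simp

lemma H1_sup_bound: assumes "H1 f" shows "(cmod (f x))\<^sup>2 \<le> 2 * H1sq f"
  using Sobolev_bound[OF H1_sq_int[OF assms] H1_deriv_is[OF assms], of x] by (simp add: H1sq_def)

lemma H1_sup_bound': assumes "H1 f" shows "cmod (f x) \<le> 2 * H1n f"
proof (rule power2_le_imp_le)
  show "(cmod (f x))\<^sup>2 \<le> (2 * H1n f)\<^sup>2"
    by (rule order_trans[OF H1_sup_bound[OF assms]]) (simp add: power_mult_distrib mult_right_mono)
qed simp

lemma H1_continuous: "H1 f \<Longrightarrow> continuous_on UNIV f"
  using H1_deriv_is is_H1_deriv_continuous by blast

lemma eventually_nonneg_within: "eventually (\<lambda>s::real. 0 \<le> s) (at t within {0..})"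
  by (simp add: eventually_at_filter)

lemma eventually_le_within: "t < T \<Longrightarrow> eventually (\<lambda>s::real. s \<le> T) (at t within S)"
  using order_tendstoD(2)[OF tendsto_ident_at, of t T S] by (auto elim: eventually_mono)

definition L2cont :: "(real \<Rightarrow> real \<Rightarrow> complex) \<Rightarrow> bool" where
  "L2cont f \<longleftrightarrow> (\<forall>t\<ge>0. sq_int (f t)) \<and>
     (\<forall>t\<ge>0. ((\<lambda>s. L2n (\<lambda>x. f s x - f t x)) \<longlongrightarrow> 0) (at t within {0..}))"

lemma L2cont_sq_int: "L2cont f \<Longrightarrow> 0 \<le> t \<Longrightarrow> sq_int (f t)"
  by (simp add: L2cont_def)

lemma L2cont_inner:
  assumes "L2cont f" "L2cont h"
  shows "continuous_on {0..} (\<lambda>t. L2inner (f t) (h t))"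
  unfolding continuous_on_def
proof
  fix t :: real assume t: "t \<in> {0..}"
  show "((\<lambda>t. L2inner (f t) (h t)) \<longlongrightarrow> L2inner (f t) (h t)) (at t within {0..})"
    by (rule L2inner_tendsto)
       (use assms t in \<open>auto simp: L2cont_def intro: eventually_mono[OF eventually_nonneg_within]\<close>)
qed

lemma L2cont_L2sq: assumes "L2cont f" shows "continuous_on {0..} (\<lambda>t. L2sq (f t))"
proof -
  have "continuous_on {0..} (\<lambda>t. Re (L2inner (f t) (f t)))"
    by (intro continuous_intros L2cont_inner assms)
  then show ?thesis by (simp add: L2inner_self)
qed

lemma L2cont_add: assumes "L2cont f" "L2cont h" shows "L2cont (\<lambda>t x. f t x + h t x)"
  unfolding L2cont_def
proof safe
  fix t :: real assume t: "0 \<le> t"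
  show "sq_int (\<lambda>x. f t x + h t x)" using assms t by (intro sq_int_add L2cont_sq_int)
  show "((\<lambda>s. L2n (\<lambda>x. f s x + h s x - (f t x + h t x))) \<longlongrightarrow> 0) (at t within {0..})"
  proof (rule Lim_null_comparison)
    show "eventually (\<lambda>s. norm (L2n (\<lambda>x. f s x + h s x - (f t x + h t x))) \<le>
       L2n (\<lambda>x. f s x - f t x) + L2n (\<lambda>x. h s x - h t x)) (at t within {0..})"
      using eventually_nonneg_within
    proof eventually_elim
      case (elim s)
      have "L2n (\<lambda>x. (f s x - f t x) + (h s x - h t x)) \<le> L2n (\<lambda>x. f s x - f t x) + L2n (\<lambda>x. h s x - h t x)"
        using assms t elim by (intro L2n_triangle sq_int_diff L2cont_sq_int)
      then show ?case by (simp add: algebra_simps)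
    qed
    show "((\<lambda>s. L2n (\<lambda>x. f s x - f t x) + L2n (\<lambda>x. h s x - h t x)) \<longlongrightarrow> 0) (at t within {0..})"
      using assms t by (intro tendsto_add_zero) (auto simp: L2cont_def)
  qed
qed

lemma L2cont_mult:
  assumes f: "L2cont f" and m: "m \<in> borel_measurable borel" "\<And>x. cmod (m x) \<le> K"
  shows "L2cont (\<lambda>t x. m x * f t x)"
  unfolding L2cont_def
proof safe
  fix t :: real assume t: "0 \<le> t"
  show "sq_int (\<lambda>x. m x * f t x)" using assms t by (intro sq_int_mult_bounded m L2cont_sq_int)
  show "((\<lambda>s. L2n (\<lambda>x. m x * f s x - m x * f t x)) \<longlongrightarrow> 0) (at t within {0..})"
  proof (rule Lim_null_comparison)
    show "eventually (\<lambda>s. norm (L2n (\<lambda>x. m x * f s x - m x * f t x)) \<le>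
       K * L2n (\<lambda>x. f s x - f t x)) (at t within {0..})"
      using eventually_nonneg_within
    proof eventually_elim
      case (elim s)
      have "L2n (\<lambda>x. m x * (f s x - f t x)) \<le> K * L2n (\<lambda>x. f s x - f t x)"
        using assms t elim by (intro L2n_mult_bounded sq_int_diff L2cont_sq_int m)
      then show ?case by (simp add: algebra_simps)
    qed
    show "((\<lambda>s. K * L2n (\<lambda>x. f s x - f t x)) \<longlongrightarrow> 0) (at t within {0..})"
      using assms t by (intro tendsto_mult_right_zero) (auto simp: L2cont_def)
  qed
qed

lemma L2cont_diff: assumes "L2cont f" "L2cont h" shows "L2cont (\<lambda>t x. f t x - h t x)"
  using L2cont_add[OF assms(1) L2cont_mult[OF assms(2), of "\<lambda>_. -1" 1]] by simp

lemma L2cont_shift: assumes "L2cont f" shows "L2cont (\<lambda>t x. f t (x + h))"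
  using assms L2sq_shift[of "\<lambda>x. f s x - f t x" h for s t] by (simp add: L2cont_def sq_int_shift)

text \<open>Neither factor needs a strong time derivative: the cross term
  \<open>\<langle>v1 s - v1 t, v2 s - v2 t\<rangle>\<close> is negligible as soon as one factor is Lipschitz in the dual of
  \<open>H1\<close> and the other one is continuous in \<open>H1\<close>.\<close>
lemma weak_product_rule:
  assumes t: "0 \<le> t" and H1: "\<And>s. 0 \<le> s \<Longrightarrow> H1 (v1 s)" "\<And>s. 0 \<le> s \<Longrightarrow> H1 (v2 s)"
    and D1: "((\<lambda>s. L2inner (v1 s) (v2 t)) has_vector_derivative D1) (at t within {0..})"
    and D2: "((\<lambda>s. L2inner (v1 t) (v2 s)) has_vector_derivative D2) (at t within {0..})"
    and lip: "\<And>s \<phi>. 0 \<le> s \<Longrightarrow> s \<le> t + 1 \<Longrightarrow> H1 \<phi> \<Longrightarrow>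
        cmod (L2inner (v1 s) \<phi> - L2inner (v1 t) \<phi>) \<le> C * \<bar>s - t\<bar> * H1n \<phi>"
    and lim: "((\<lambda>s. H1n (\<lambda>x. v2 s x - v2 t x)) \<longlongrightarrow> 0) (at t within {0..})"
  shows "((\<lambda>s. L2inner (v1 s) (v2 s)) has_vector_derivative (D1 + D2)) (at t within {0..})"
proof -
  let ?e = "\<lambda>s. L2inner (\<lambda>x. v1 s x - v1 t x) (\<lambda>x. v2 s x - v2 t x)"
  note sq = H1_sq_int[OF H1(1)] H1_sq_int[OF H1(2)]
  have "(?e has_vector_derivative 0) (at t within {0..})"
    unfolding has_vector_derivative_def has_derivative_within
  proof (intro conjI)
    have "((\<lambda>s. norm (?e s) / \<bar>s - t\<bar>) \<longlongrightarrow> 0) (at t within {0..})"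
    proof (rule Lim_null_comparison)
      show "eventually (\<lambda>s. norm (norm (?e s) / \<bar>s - t\<bar>) \<le> C * H1n (\<lambda>x. v2 s x - v2 t x)) (at t within {0..})"
        using eventually_nonneg_within eventually_le_within[of t "t + 1" "{0..}", simplified] eventually_neq_at_within[of t "t" "{0..}"]
      proof eventually_elim
        case (elim s)
        have "norm (?e s) \<le> C * \<bar>s - t\<bar> * H1n (\<lambda>x. v2 s x - v2 t x)"
          using lip[of s "\<lambda>x. v2 s x - v2 t x"] elim t
          by (simp add: L2inner_diff_left sq sq_int_diff H1_diff H1)
        then show ?case using elim by (simp add: field_simps)
      qed
      show "((\<lambda>s. C * H1n (\<lambda>x. v2 s x - v2 t x)) \<longlongrightarrow> 0) (at t within {0..})"
        by (intro tendsto_mult_right_zero lim)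
    qed
    then have "((\<lambda>s. ?e s /\<^sub>R \<bar>s - t\<bar>) \<longlongrightarrow> 0) (at t within {0..})"
      by (intro tendsto_norm_zero_cancel[of "\<lambda>s. ?e s /\<^sub>R \<bar>s - t\<bar>"]) (simp add: divide_inverse mult.commute)
    then show "((\<lambda>y. (1 / norm (y - t)) *\<^sub>R (?e y - (?e t + (y - t) *\<^sub>R 0))) \<longlongrightarrow> 0) (at t within {0..})"
      by (simp add: L2inner_def divide_inverse)
  qed (auto intro: bounded_linear_intros)
  \<comment> \<open>Expanding \<open>?e\<close> shows that <v1 s, v2 s> equals this sum, in which
    each of the two main terms has one factor frozen at time \<open>t\<close>.\<close>
  then have "((\<lambda>s. L2inner (v1 s) (v2 t) + L2inner (v1 t) (v2 s) - L2inner (v1 t) (v2 t) + ?e s)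
      has_vector_derivative (D1 + D2 - 0 + 0)) (at t within {0..})"
    by (intro has_vector_derivative_add has_vector_derivative_diff D1 D2 has_vector_derivative_const)
  from has_vector_derivative_transform[OF _ _ this, of "\<lambda>s. L2inner (v1 s) (v2 s)"] show ?thesis
    using t by (simp add: L2inner_diff_left L2inner_diff_right sq sq_int_diff)
qed

section \<open>The nonlinear terms\<close>

context nonlinearity begin

lemma g_measurable: assumes "f \<in> borel_measurable borel" shows "(\<lambda>x. g ((cmod (f x))\<^sup>2)) \<in> borel_measurable borel"
proof -
  \<comment> \<open>\<open>g\<close> is continuous only on the half line; \<open>max 0\<close>
    extends it continuously without changing its values at squared moduli.\<close>
  have "continuous_on UNIV (\<lambda>s. g (max 0 s))"
    by (rule continuous_on_compose2[OF g_cont]) (auto intro!: continuous_intros)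
  then have [measurable]: "(\<lambda>s. g (max 0 s)) \<in> borel_measurable borel"
    by (rule borel_measurable_continuous_onI)
  have "(\<lambda>x. (\<lambda>s. g (max 0 s)) ((cmod (f x))\<^sup>2)) \<in> borel_measurable borel"
    using assms by measurable
  then show ?thesis by simp
qed

lemma prim_measurable: assumes "f \<in> borel_measurable borel" shows "(\<lambda>x. prim g ((cmod (f x))\<^sup>2)) \<in> borel_measurable borel"
proof -
  have "isCont (\<lambda>s. prim g (max 0 s)) x" for x
  proof (rule continuous_on_interior)
    show "continuous_on {x-1..x+1} (\<lambda>s. prim g (max 0 s))"
      by (rule continuous_on_compose2[OF prim_continuous[of "max 0 (x+1)"]]) (auto intro!: continuous_intros)
  qed (auto simp: interior_atLeastAtMost_real)
  then have "continuous_on UNIV (\<lambda>s. prim g (max 0 s))"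
    by (simp add: continuous_at_imp_continuous_on)
  then have [measurable]: "(\<lambda>s. prim g (max 0 s)) \<in> borel_measurable borel"
    by (rule borel_measurable_continuous_onI)
  have "(\<lambda>x. (\<lambda>s. prim g (max 0 s)) ((cmod (f x))\<^sup>2)) \<in> borel_measurable borel"
    using assms by measurable
  then show ?thesis by simp
qed

definition Nl :: "(real \<Rightarrow> complex) \<Rightarrow> real \<Rightarrow> complex" where
  "Nl f x = complex_of_real (g ((cmod (f x))\<^sup>2)) * f x"

definition Kint :: "(real \<Rightarrow> complex) \<Rightarrow> real" where
  "Kint f = (\<integral>x. defect ((cmod (f x))\<^sup>2) \<partial>lborel)"

context
  fixes f :: "real \<Rightarrow> complex" and R C :: real
  assumes f: "sq_int f" "\<And>x. (cmod (f x))\<^sup>2 \<le> R"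
    and C: "\<And>s. 0 \<le> s \<Longrightarrow> s \<le> R \<Longrightarrow> \<bar>g s\<bar> \<le> C"
begin

lemma sq_int_Nl_aux: "sq_int (Nl f)" "L2n (Nl f) \<le> C * L2n f"
proof -
  have m: "(\<lambda>x. complex_of_real (g ((cmod (f x))\<^sup>2))) \<in> borel_measurable borel"
    using g_measurable[OF sq_int_measurable[OF f(1)]] by measurable
  have b: "cmod (complex_of_real (g ((cmod (f x))\<^sup>2))) \<le> C" for x
    using C f(2) by simp
  show "sq_int (Nl f)" "L2n (Nl f) \<le> C * L2n f"
    using sq_int_mult_bounded[OF f(1) m b] L2n_mult_bounded[OF f(1) m b]
    by (simp_all add: Nl_def[abs_def])
qed

lemma integrable_aux:
  assumes "k \<in> borel_measurable borel" "\<And>x. \<bar>k x\<bar> \<le> C * (cmod (f x))\<^sup>2"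
  shows "integrable lborel k"
proof (rule Bochner_Integration.integrable_bound)
  show "integrable lborel (\<lambda>x. C * (cmod (f x))\<^sup>2)" using sq_int_integrable[OF f(1)] by simp
  show "AE x in lborel. norm (k x) \<le> norm (C * (cmod (f x))\<^sup>2)"
    using assms(2) by (intro AE_I2) (simp, meson abs_ge_self order_trans)
qed (use assms in simp)

lemma integrable_prim_aux: "integrable lborel (\<lambda>x. prim g ((cmod (f x))\<^sup>2))"
  by (rule integrable_aux[OF prim_measurable[OF sq_int_measurable[OF f(1)]]])
     (use prim_nonneg prim_le[OF C] f(2) in simp)

lemma integrable_g_aux: "integrable lborel (\<lambda>x. (cmod (f x))\<^sup>2 * g ((cmod (f x))\<^sup>2))"
proof (rule integrable_aux)
  show "(\<lambda>x. (cmod (f x))\<^sup>2 * g ((cmod (f x))\<^sup>2)) \<in> borel_measurable borel"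
    using sq_int_measurable[OF f(1)] g_measurable[OF sq_int_measurable[OF f(1)]] by measurable
  show "\<bar>(cmod (f x))\<^sup>2 * g ((cmod (f x))\<^sup>2)\<bar> \<le> C * (cmod (f x))\<^sup>2" for x
    using mult_right_mono[OF C[of "(cmod (f x))\<^sup>2"], of "(cmod (f x))\<^sup>2"] f(2)[of x]
    by (simp add: abs_mult mult.commute)
qed

lemma integrable_defect_aux: "integrable lborel (\<lambda>x. defect ((cmod (f x))\<^sup>2))"
  unfolding defect_def by (intro Bochner_Integration.integrable_diff integrable_g_aux integrable_prim_aux)

lemma Kint_eq_aux: "Kint f = (\<integral>x. (cmod (f x))\<^sup>2 * g ((cmod (f x))\<^sup>2) \<partial>lborel) - (\<integral>x. prim g ((cmod (f x))\<^sup>2) \<partial>lborel)"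
  unfolding Kint_def defect_def
  by (rule Bochner_Integration.integral_diff[OF integrable_g_aux integrable_prim_aux])

end

context
  fixes f :: "real \<Rightarrow> complex" and R :: real
  assumes f: "sq_int f" "\<And>x. (cmod (f x))\<^sup>2 \<le> R"
begin

lemma integrable_defect: "integrable lborel (\<lambda>x. defect ((cmod (f x))\<^sup>2))"
  using integrable_defect_aux[OF f] g_bounded[of R] by blast

lemma sq_int_Nl: "sq_int (Nl f)"
  using sq_int_Nl_aux(1)[OF f] g_bounded[of R] by blast

lemma Kint_eq: "Kint f = Re (L2inner (Nl f) f) - (\<integral>x. prim g ((cmod (f x))\<^sup>2) \<partial>lborel)"
proof -
  have "L2inner (Nl f) f = (\<integral>x. complex_of_real ((cmod (f x))\<^sup>2 * g ((cmod (f x))\<^sup>2)) \<partial>lborel)"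
    unfolding L2inner_def Nl_def
    by (intro Bochner_Integration.integral_cong refl)
       (simp add: complex_norm_square mult.assoc mult.commute del: of_real_power)
  also have "\<dots> = complex_of_real (\<integral>x. (cmod (f x))\<^sup>2 * g ((cmod (f x))\<^sup>2) \<partial>lborel)"
    by (rule integral_complex_of_real)
  finally show ?thesis
    using Kint_eq_aux[OF f] g_bounded[of R] by auto
qed

end

text \<open>Integrated form of \<open>nonlinear_commutator\<close>, with a constant depending only
  on the sup bound \<open>R\<close>. It is used twice: with \<open>m = 1\<close> and the solution at
  two times for the energy law, and with \<open>m\<close> the virial weight and a spatial translate
  for the virial inequality.\<close>

lemma Nl_commutator:
  "\<exists>C\<ge>0. \<forall>(m :: real \<Rightarrow> real) a b. m \<in> borel_measurable borel \<longrightarrow> (\<forall>x. \<bar>m x\<bar> \<le> 1) \<longrightarrow> sq_int a \<longrightarrow> sq_int b \<longrightarrow>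
     (\<forall>x. (cmod (a x))\<^sup>2 \<le> R) \<longrightarrow> (\<forall>x. (cmod (b x))\<^sup>2 \<le> R) \<longrightarrow>
     \<bar>Re (L2inner (\<lambda>x. complex_of_real (m x) * Nl b x) a) - Re (L2inner (\<lambda>x. complex_of_real (m x) * Nl a x) b)
       - (\<integral>x. m x * (defect ((cmod (b x))\<^sup>2) - defect ((cmod (a x))\<^sup>2)) \<partial>lborel)\<bar>
     \<le> C * L2sq (\<lambda>x. b x - a x)"
proof -
  obtain C where C: "0 \<le> C" "\<And>z1 z2. (cmod z1)\<^sup>2 \<le> R \<Longrightarrow> (cmod z2)\<^sup>2 \<le> R \<Longrightarrow>
     \<bar>(g ((cmod z2)\<^sup>2) - g ((cmod z1)\<^sup>2)) * Re (z2 * cnj z1) - (defect ((cmod z2)\<^sup>2) - defect ((cmod z1)\<^sup>2))\<bar>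
       \<le> C * (cmod (z2 - z1))\<^sup>2"
    using nonlinear_commutator[of R] by blast
  show ?thesis
  proof (intro exI[of _ C] conjI C(1) allI impI)
    fix m :: "real \<Rightarrow> real" and a b
    assume m: "m \<in> borel_measurable borel" "\<forall>x. \<bar>m x\<bar> \<le> 1" and a: "sq_int a" and b: "sq_int b"
      and R: "\<forall>x. (cmod (a x))\<^sup>2 \<le> R" "\<forall>x. (cmod (b x))\<^sup>2 \<le> R"
    note [measurable] = m(1)
    have sa: "sq_int (\<lambda>x. complex_of_real (m x) * Nl a x)" and sb: "sq_int (\<lambda>x. complex_of_real (m x) * Nl b x)"
      using m R by (auto intro!: sq_int_mult_bounded[where K = 1] sq_int_Nl a b)
    have i1: "integrable lborel (\<lambda>x. Re (complex_of_real (m x) * Nl b x * cnj (a x)))"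
      and i2: "integrable lborel (\<lambda>x. Re (complex_of_real (m x) * Nl a x * cnj (b x)))"
      by (rule integrable_Re[OF sq_int_mult_integrable[OF sb a]], rule integrable_Re[OF sq_int_mult_integrable[OF sa b]])
    have id: "integrable lborel (\<lambda>x. defect ((cmod (b x))\<^sup>2) - defect ((cmod (a x))\<^sup>2))"
      using R by (intro Bochner_Integration.integrable_diff integrable_defect a b) auto
    have i3: "integrable lborel (\<lambda>x. m x * (defect ((cmod (b x))\<^sup>2) - defect ((cmod (a x))\<^sup>2)))"
    proof (rule Bochner_Integration.integrable_bound[OF id])
      show "(\<lambda>x. m x * (defect ((cmod (b x))\<^sup>2) - defect ((cmod (a x))\<^sup>2))) \<in> borel_measurable lborel"
        using borel_measurable_integrable[OF id] by measurable
      show "AE x in lborel. norm (m x * (defect ((cmod (b x))\<^sup>2) - defect ((cmod (a x))\<^sup>2)))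
          \<le> norm (defect ((cmod (b x))\<^sup>2) - defect ((cmod (a x))\<^sup>2))"
        using m(2) by (intro AE_I2) (simp add: abs_mult mult_left_le_one_le)
    qed
    let ?k = "\<lambda>x. Re (complex_of_real (m x) * Nl b x * cnj (a x)) - Re (complex_of_real (m x) * Nl a x * cnj (b x))
         - m x * (defect ((cmod (b x))\<^sup>2) - defect ((cmod (a x))\<^sup>2))"
    have eq: "Re (L2inner (\<lambda>x. complex_of_real (m x) * Nl b x) a) - Re (L2inner (\<lambda>x. complex_of_real (m x) * Nl a x) b)
       - (\<integral>x. m x * (defect ((cmod (b x))\<^sup>2) - defect ((cmod (a x))\<^sup>2)) \<partial>lborel) = (\<integral>x. ?k x \<partial>lborel)"
      unfolding L2inner_def
      by (simp only: Bochner_Integration.integral_diff Bochner_Integration.integrable_diff i1 i2 i3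
          integral_Re[OF sq_int_mult_integrable[OF sb a]] integral_Re[OF sq_int_mult_integrable[OF sa b]])
    have "\<bar>\<integral>x. ?k x \<partial>lborel\<bar> \<le> (\<integral>x. C * (cmod (b x - a x))\<^sup>2 \<partial>lborel)"
    proof (rule order_trans[OF integral_abs_bound], rule integral_mono)
      show "integrable lborel (\<lambda>x. \<bar>?k x\<bar>)"
        using i1 i2 i3 by (intro integrable_abs Bochner_Integration.integrable_diff)
      show "integrable lborel (\<lambda>x. C * (cmod (b x - a x))\<^sup>2)"
        using sq_int_integrable[OF sq_int_diff[OF b a]] by simp
      fix x
      have e: "?k x = m x * ((g ((cmod (b x))\<^sup>2) - g ((cmod (a x))\<^sup>2)) * Re (b x * cnj (a x))
          - (defect ((cmod (b x))\<^sup>2) - defect ((cmod (a x))\<^sup>2)))"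
        unfolding Nl_def by (simp add: algebra_simps)
      show "\<bar>?k x\<bar> \<le> C * (cmod (b x - a x))\<^sup>2"
        unfolding e abs_mult
        by (rule order_trans[OF mult_left_le_one_le C(2)]) (use m(2) R in auto)
    qed
    also have "\<dots> = C * L2sq (\<lambda>x. b x - a x)" by (simp add: L2sq_def)
    finally show "\<bar>Re (L2inner (\<lambda>x. complex_of_real (m x) * Nl b x) a) - Re (L2inner (\<lambda>x. complex_of_real (m x) * Nl a x) b)
       - (\<integral>x. m x * (defect ((cmod (b x))\<^sup>2) - defect ((cmod (a x))\<^sup>2)) \<partial>lborel)\<bar>
     \<le> C * L2sq (\<lambda>x. b x - a x)"
      unfolding eq .
  qed
qed

text \<open>| |b|^2 - |a|^2 | <= (|a| + |b|) |b - a|, followed by Cauchy-Schwarz. It makes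
  \<open>Kint (u t)\<close> continuous in time, so that it has a primitive.\<close>

lemma Kint_Lipschitz:
  "\<exists>C\<ge>0. \<forall>a b. sq_int a \<longrightarrow> sq_int b \<longrightarrow> (\<forall>x. (cmod (a x))\<^sup>2 \<le> R) \<longrightarrow> (\<forall>x. (cmod (b x))\<^sup>2 \<le> R) \<longrightarrow>
     \<bar>Kint b - Kint a\<bar> \<le> C * ((L2n a + L2n b) * L2n (\<lambda>x. b x - a x))"
proof -
  obtain C where C: "0 \<le> C" "\<And>s1 s2. 0 \<le> s1 \<Longrightarrow> s1 \<le> R \<Longrightarrow> 0 \<le> s2 \<Longrightarrow> s2 \<le> R \<Longrightarrow> \<bar>defect s2 - defect s1\<bar> \<le> C * \<bar>s2 - s1\<bar>"
    using defect_Lipschitz[of R] by blast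
  show ?thesis
  proof (intro exI[of _ C] conjI C(1) allI impI)
    fix a b assume a: "sq_int a" and b: "sq_int b"
      and R: "\<forall>x. (cmod (a x))\<^sup>2 \<le> R" "\<forall>x. (cmod (b x))\<^sup>2 \<le> R"
    have d: "sq_int (\<lambda>x. b x - a x)" using b a by (rule sq_int_diff)
    have ia: "integrable lborel (\<lambda>x. defect ((cmod (a x))\<^sup>2))" and ib: "integrable lborel (\<lambda>x. defect ((cmod (b x))\<^sup>2))"
      using R by (auto intro!: integrable_defect a b)
    have "Kint b - Kint a = (\<integral>x. defect ((cmod (b x))\<^sup>2) - defect ((cmod (a x))\<^sup>2) \<partial>lborel)"
      unfolding Kint_def using ia ib by simp
    also have "\<bar>\<dots>\<bar> \<le> (\<integral>x. C * (cmod (a x) * cmod (b x - a x) + cmod (b x) * cmod (b x - a x)) \<partial>lborel)"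
    proof (rule order_trans[OF integral_abs_bound], rule integral_mono)
      show "integrable lborel (\<lambda>x. \<bar>defect ((cmod (b x))\<^sup>2) - defect ((cmod (a x))\<^sup>2)\<bar>)"
        using ia ib by (intro integrable_abs Bochner_Integration.integrable_diff)
      show "integrable lborel (\<lambda>x. C * (cmod (a x) * cmod (b x - a x) + cmod (b x) * cmod (b x - a x)))"
        by (intro integrable_mult_right Bochner_Integration.integrable_add L2_abs_integral a b d)
      fix x
      have "\<bar>defect ((cmod (b x))\<^sup>2) - defect ((cmod (a x))\<^sup>2)\<bar> \<le> C * \<bar>(cmod (b x))\<^sup>2 - (cmod (a x))\<^sup>2\<bar>"
        using R by (intro C) auto
      also have "\<bar>(cmod (b x))\<^sup>2 - (cmod (a x))\<^sup>2\<bar> = (cmod (a x) + cmod (b x)) * \<bar>cmod (b x) - cmod (a x)\<bar>"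
        by (simp add: power2_eq_square square_diff_square_factored abs_mult add.commute)
      also have "C * ((cmod (a x) + cmod (b x)) * \<bar>cmod (b x) - cmod (a x)\<bar>)
          \<le> C * ((cmod (a x) + cmod (b x)) * cmod (b x - a x))"
        using norm_triangle_ineq3[of "b x" "a x"] C(1) by (intro mult_left_mono) auto
      finally show "\<bar>defect ((cmod (b x))\<^sup>2) - defect ((cmod (a x))\<^sup>2)\<bar>
          \<le> C * (cmod (a x) * cmod (b x - a x) + cmod (b x) * cmod (b x - a x))"
        by (simp add: distrib_right)
    qed
    also have "\<dots> = C * ((\<integral>x. cmod (a x) * cmod (b x - a x) \<partial>lborel) + (\<integral>x. cmod (b x) * cmod (b x - a x) \<partial>lborel))"
      by (simp add: L2_abs_integral a b d)
    also have "\<dots> \<le> C * (L2n a * L2n (\<lambda>x. b x - a x) + L2n b * L2n (\<lambda>x. b x - a x))"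
      by (intro mult_left_mono add_mono L2_abs_integral a b d C(1))
    finally show "\<bar>Kint b - Kint a\<bar> \<le> C * ((L2n a + L2n b) * L2n (\<lambda>x. b x - a x))"
      by (simp add: distrib_right)
  qed
qed

end

lemma Hq_form_cnj: "cnj (Hq_form q v w) = Hq_form q w v"
  by (simp add: Hq_form_def L2inner_cnj mult.commute mult.assoc)

text \<open>Each point value at 0 costs a factor 2 from the Sobolev bound, hence
  \<open>4 * \<bar>q\<bar>\<close>.\<close>

lemma Hq_form_bound:
  assumes "H1 v" "H1 \<phi>"
  shows "cmod (Hq_form q v \<phi>) \<le> (1 + 4 * \<bar>q\<bar>) * H1n v * H1n \<phi>"
proof -
  have "cmod (L2inner (H1_deriv v) (H1_deriv \<phi>)) \<le> L2n (H1_deriv v) * L2n (H1_deriv \<phi>)"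
    using assms by (intro L2_Cauchy_Schwarz H1_deriv_sq_int)
  also have "\<dots> \<le> H1n v * H1n \<phi>"
    by (intro mult_mono L2n_le_H1n) auto
  finally have 1: "cmod (L2inner (H1_deriv v) (H1_deriv \<phi>)) \<le> H1n v * H1n \<phi>" .
  have "cmod (v 0) * cmod (\<phi> 0) \<le> (2 * H1n v) * (2 * H1n \<phi>)"
    using assms by (intro mult_mono H1_sup_bound') auto
  then have "\<bar>q\<bar> * (cmod (v 0) * cmod (\<phi> 0)) \<le> \<bar>q\<bar> * ((2 * H1n v) * (2 * H1n \<phi>))"
    by (intro mult_left_mono) auto
  then have 2: "cmod (complex_of_real q * v 0 * cnj (\<phi> 0)) \<le> \<bar>q\<bar> * ((2 * H1n v) * (2 * H1n \<phi>))"
    by (simp add: norm_mult mult.assoc)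
  show ?thesis
    unfolding Hq_form_def
    by (rule order_trans[OF norm_triangle_ineq4]) (use 1 2 in \<open>simp add: algebra_simps\<close>)
qed

section \<open>Weak solutions and conservation of mass\<close>

locale nls = nonlinearity g for g +
  fixes q :: real and u :: "real \<Rightarrow> real \<Rightarrow> complex" and u0 :: "real \<Rightarrow> complex"
  assumes q_neg: "q < 0" and solution: "NLS_solution q g u u0"
begin

abbreviation dx :: "real \<Rightarrow> real \<Rightarrow> complex" where "dx t \<equiv> H1_deriv (u t)"

definition rhs :: "real \<Rightarrow> (real \<Rightarrow> complex) \<Rightarrow> complex" where
  "rhs t \<phi> = - \<i> * (Hq_form q (u t) \<phi> + L2inner (Nl (u t)) \<phi>)"

lemma u_H1: "0 \<le> t \<Longrightarrow> H1 (u t)"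
  using solution by (simp add: NLS_solution_def)

lemma u_sq_int: "0 \<le> t \<Longrightarrow> sq_int (u t)"
  by (simp add: u_H1 H1_sq_int)

lemma dx_sq_int: "0 \<le> t \<Longrightarrow> sq_int (dx t)"
  by (simp add: u_H1 H1_deriv_sq_int)

lemma u_initial: "u 0 = u0"
  using solution by (simp add: NLS_solution_def)

lemma u_tendsto:
  assumes "0 \<le> t" shows "((\<lambda>s. H1n (\<lambda>x. u s x - u t x)) \<longlongrightarrow> 0) (at t within {0..})"
proof -
  have "((\<lambda>s. H1sq (\<lambda>x. u s x - u t x)) \<longlongrightarrow> 0) (at t within {0..})"
    using solution assms by (simp add: NLS_solution_def)
  from tendsto_real_sqrt[OF this] show ?thesis by simp
qed

lemma u_equation:
  assumes "0 \<le> t" "H1 \<phi>"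
  shows "((\<lambda>s. L2inner (u s) \<phi>) has_vector_derivative rhs t \<phi>) (at t within {0..})"
  using solution assms unfolding NLS_solution_def rhs_def Nl_def[abs_def] by blast

lemma L2cont_u: "L2cont u"
  unfolding L2cont_def
proof safe
  fix t :: real assume t: "0 \<le> t"
  show "sq_int (u t)" using t by (rule u_sq_int)
  show "((\<lambda>s. L2n (\<lambda>x. u s x - u t x)) \<longlongrightarrow> 0) (at t within {0..})"
    by (rule Lim_null_comparison[OF _ u_tendsto[OF t]]) (use L2n_le_H1n in auto)
qed

lemma L2cont_dx: "L2cont dx"
  unfolding L2cont_def
proof safe
  fix t :: real assume t: "0 \<le> t"
  show "sq_int (dx t)" using t by (rule dx_sq_int)
  show "((\<lambda>s. L2n (\<lambda>x. dx s x - dx t x)) \<longlongrightarrow> 0) (at t within {0..})"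
  proof (rule Lim_null_comparison[OF _ u_tendsto[OF t]])
    show "eventually (\<lambda>s. norm (L2n (\<lambda>x. dx s x - dx t x)) \<le> H1n (\<lambda>x. u s x - u t x)) (at t within {0..})"
      using eventually_nonneg_within
      by eventually_elim (use t L2n_le_H1n(2) in \<open>simp add: L2n_H1_deriv_diff u_H1\<close>)
  qed
qed

lemma u_at_continuous: "continuous_on {0..} (\<lambda>t. u t x)"
  unfolding continuous_on_def
proof
  fix t :: real assume t: "t \<in> {0..}"
  show "((\<lambda>t. u t x) \<longlongrightarrow> u t x) (at t within {0..})"
  proof (rule LIM_zero_cancel, rule Lim_null_comparison)
    show "eventually (\<lambda>s. norm (u s x - u t x) \<le> 2 * H1n (\<lambda>x. u s x - u t x)) (at t within {0..})"
      using eventually_nonneg_within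
    proof eventually_elim
      case (elim s)
      then show ?case using t H1_sup_bound'[OF H1_diff[OF u_H1 u_H1], of s t x] by simp
    qed
    show "((\<lambda>s. 2 * H1n (\<lambda>x. u s x - u t x)) \<longlongrightarrow> 0) (at t within {0..})"
      using u_tendsto[of t] t by (intro tendsto_mult_right_zero) simp
  qed
qed

lemma u_bounded: "\<exists>B\<ge>0. \<forall>t. 0 \<le> t \<longrightarrow> t \<le> T \<longrightarrow> H1n (u t) \<le> B"
proof -
  have "continuous_on {0..} (\<lambda>t. H1n (u t))"
    unfolding H1sq_def by (intro continuous_intros L2cont_L2sq L2cont_u L2cont_dx)
  then have "continuous_on {0..T} (\<lambda>t. H1n (u t))" by (rule continuous_on_subset) auto
  then have "compact ((\<lambda>t. H1n (u t)) ` {0..T})" by (intro compact_continuous_image) auto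
  then obtain B where "\<And>t. t \<in> {0..T} \<Longrightarrow> \<bar>H1n (u t)\<bar> \<le> B"
    by (metis bounded_iff compact_imp_bounded image_eqI real_norm_def)
  then show ?thesis by (intro exI[of _ "max 0 B"]) (auto simp: le_max_iff_disj)
qed

lemma u_sup_bounded: "\<exists>R. \<forall>t x. 0 \<le> t \<longrightarrow> t \<le> T \<longrightarrow> (cmod (u t x))\<^sup>2 \<le> R"
proof -
  obtain B where B: "0 \<le> B" "\<And>t. 0 \<le> t \<Longrightarrow> t \<le> T \<Longrightarrow> H1n (u t) \<le> B"
    using u_bounded[of T] by blast
  show ?thesis
  proof (intro exI[of _ "(2 * B)\<^sup>2"] allI impI)
    fix t x assume "0 \<le> t" "t \<le> T"
    then show "(cmod (u t x))\<^sup>2 \<le> (2 * B)\<^sup>2"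
      using H1_sup_bound'[OF u_H1, of t x] B(2)[of t] by (intro power_mono) auto
  qed
qed

lemma u_Nl_sq_int: assumes "0 \<le> t" shows "sq_int (Nl (u t))"
proof -
  obtain R where "\<And>x. (cmod (u t x))\<^sup>2 \<le> R" using u_sup_bounded[of t] assms by blast
  from sq_int_Nl[OF u_sq_int[OF assms] this] show ?thesis .
qed

lemma rhs_bound: "\<exists>C\<ge>0. \<forall>t \<phi>. 0 \<le> t \<longrightarrow> t \<le> T \<longrightarrow> H1 \<phi> \<longrightarrow> cmod (rhs t \<phi>) \<le> C * H1n \<phi>"
proof -
  obtain B where B: "0 \<le> B" "\<And>t. 0 \<le> t \<Longrightarrow> t \<le> T \<Longrightarrow> H1n (u t) \<le> B"
    using u_bounded[of T] by blast
  obtain R where R: "\<And>t x. 0 \<le> t \<Longrightarrow> t \<le> T \<Longrightarrow> (cmod (u t x))\<^sup>2 \<le> R"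
    using u_sup_bounded[of T] by blast
  obtain D where D: "0 \<le> D" "\<And>s. 0 \<le> s \<Longrightarrow> s \<le> R \<Longrightarrow> \<bar>g s\<bar> \<le> D" using g_bounded[of R] by blast
  show ?thesis
  proof (intro exI[of _ "(1 + 4 * \<bar>q\<bar>) * B + D * B"] conjI allI impI)
    show "0 \<le> (1 + 4 * \<bar>q\<bar>) * B + D * B" using B D by simp
    fix t \<phi> assume t: "0 \<le> t" "t \<le> T" and \<phi>: "H1 \<phi>"
    have "cmod (L2inner (Nl (u t)) \<phi>) \<le> L2n (Nl (u t)) * L2n \<phi>"
      by (intro L2_Cauchy_Schwarz u_Nl_sq_int H1_sq_int \<phi> t)
    also have "\<dots> \<le> (D * L2n (u t)) * H1n \<phi>"
      by (intro mult_mono L2n_le_H1n sq_int_Nl_aux(2)[of _ R] u_sq_int R t D) (use D(1) in auto)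
    also have "\<dots> \<le> (D * B) * H1n \<phi>"
      using order_trans[OF L2n_le_H1n(1) B(2)[OF t]] D(1) by (intro mult_right_mono mult_left_mono) auto
    finally have 1: "cmod (L2inner (Nl (u t)) \<phi>) \<le> (D * B) * H1n \<phi>" .
    have "cmod (Hq_form q (u t) \<phi>) \<le> (1 + 4 * \<bar>q\<bar>) * H1n (u t) * H1n \<phi>"
      by (rule Hq_form_bound[OF u_H1[OF t(1)] \<phi>])
    also have "\<dots> \<le> (1 + 4 * \<bar>q\<bar>) * B * H1n \<phi>"
      using B(2)[OF t] by (intro mult_right_mono mult_left_mono) auto
    finally have 2: "cmod (Hq_form q (u t) \<phi>) \<le> (1 + 4 * \<bar>q\<bar>) * B * H1n \<phi>" .
    have "cmod (rhs t \<phi>) = cmod (Hq_form q (u t) \<phi> + L2inner (Nl (u t)) \<phi>)"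
      by (simp add: rhs_def norm_mult)
    also have "\<dots> \<le> ((1 + 4 * \<bar>q\<bar>) * B + D * B) * H1n \<phi>"
      by (rule order_trans[OF norm_triangle_ineq]) (use 1 2 in \<open>simp add: distrib_right\<close>)
    finally show "cmod (rhs t \<phi>) \<le> ((1 + 4 * \<bar>q\<bar>) * B + D * B) * H1n \<phi>" .
  qed
qed

text \<open>Mean value inequality for each fixed test function. The constant does not depend on it,
  so \<open>u\<close> is Lipschitz in the dual of H1, as \<open>weak_product_rule\<close>
  requires.\<close>

lemma u_weak_Lipschitz:
  obtains C where "0 \<le> C"
    "\<And>s t \<phi>. 0 \<le> s \<Longrightarrow> s \<le> T \<Longrightarrow> 0 \<le> t \<Longrightarrow> t \<le> T \<Longrightarrow> H1 \<phi> \<Longrightarrow>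
     cmod (L2inner (u s) \<phi> - L2inner (u t) \<phi>) \<le> C * \<bar>s - t\<bar> * H1n \<phi>"
proof -
  obtain C where C: "0 \<le> C" "\<And>t \<phi>. 0 \<le> t \<Longrightarrow> t \<le> T \<Longrightarrow> H1 \<phi> \<Longrightarrow> cmod (rhs t \<phi>) \<le> C * H1n \<phi>"
    using rhs_bound[of T] by blast
  have *: "cmod (L2inner (u b) \<phi> - L2inner (u a) \<phi>) \<le> C * (b - a) * H1n \<phi>"
    if ab: "0 \<le> a" "a < b" "b \<le> T" and \<phi>: "H1 \<phi>" for a b \<phi>
  proof -
    have "continuous_on {0..} (\<lambda>s. L2inner (u s) \<phi>)"
      unfolding continuous_on_eq_continuous_within
      using has_vector_derivative_continuous[OF u_equation[OF _ \<phi>]] by simp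
    then have c: "continuous_on {a..b} (\<lambda>s. L2inner (u s) \<phi>)"
      by (rule continuous_on_subset) (use ab in auto)
    have "norm (L2inner (u b) \<phi> - L2inner (u a) \<phi>) \<le> (C * H1n \<phi>) * b - (C * H1n \<phi>) * a"
    proof (rule differentiable_bound_general[OF ab(2) c])
      show "continuous_on {a..b} (\<lambda>x. C * H1n \<phi> * x)" by (intro continuous_intros)
      fix x assume x: "a < x" "x < b"
      have "((\<lambda>s. L2inner (u s) \<phi>) has_vector_derivative rhs x \<phi>) (at x within {0..})"
        by (rule u_equation[OF _ \<phi>]) (use x ab in simp)
      then show "((\<lambda>s. L2inner (u s) \<phi>) has_vector_derivative rhs x \<phi>) (at x)"
        by (subst (asm) at_within_interior) (use x ab in \<open>auto simp: interior_real_atLeast\<close>)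
      show "((\<lambda>x. C * H1n \<phi> * x) has_vector_derivative C * H1n \<phi>) (at x)"
        by (auto intro!: derivative_eq_intros)
      show "norm (rhs x \<phi>) \<le> C * H1n \<phi>" by (rule C(2)[OF _ _ \<phi>]) (use x ab in auto)
    qed
    then show ?thesis by (simp add: algebra_simps)
  qed
  show thesis
  proof (rule that[OF C(1)])
    fix s t \<phi> assume "0 \<le> s" "s \<le> T" "0 \<le> t" "t \<le> T" "H1 \<phi>"
    then show "cmod (L2inner (u s) \<phi> - L2inner (u t) \<phi>) \<le> C * \<bar>s - t\<bar> * H1n \<phi>"
      using *[of s t \<phi>] *[of t s \<phi>] by (cases s t rule: linorder_cases) (auto simp: norm_minus_commute)
  qed
qed

lemma u_equation_right:
  assumes "0 \<le> t" "H1 \<phi>"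
  shows "((\<lambda>s. L2inner \<phi> (u s)) has_vector_derivative cnj (rhs t \<phi>)) (at t within {0..})"
  using has_vector_derivative_cnj[OF u_equation[OF assms]] by (simp add: L2inner_cnj)

text \<open>The form is Hermitian and <\<open>Nl\<close> u, u> is real, so
  \<open>rhs t (u t)\<close> is purely imaginary and cancels against its conjugate.\<close>

lemma mass_derivative:
  assumes t: "0 \<le> t"
  shows "((\<lambda>s. L2inner (u s) (u s)) has_vector_derivative 0) (at t within {0..})"
proof -
  obtain C where C': "\<And>r s \<phi>. 0 \<le> r \<Longrightarrow> r \<le> t + 1 \<Longrightarrow> 0 \<le> s \<Longrightarrow> s \<le> t + 1 \<Longrightarrow> H1 \<phi> \<Longrightarrow>
     cmod (L2inner (u r) \<phi> - L2inner (u s) \<phi>) \<le> C * \<bar>r - s\<bar> * H1n \<phi>"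
    using u_weak_Lipschitz[of "t + 1"] by metis
  have C: "cmod (L2inner (u s) \<phi> - L2inner (u t) \<phi>) \<le> C * \<bar>s - t\<bar> * H1n \<phi>"
    if "0 \<le> s" "s \<le> t + 1" "H1 \<phi>" for s \<phi>
    using C'[of s t \<phi>] that t by simp
  have "((\<lambda>s. L2inner (u s) (u s)) has_vector_derivative (rhs t (u t) + cnj (rhs t (u t)))) (at t within {0..})"
    by (rule weak_product_rule[OF t u_H1 u_H1 u_equation[OF t u_H1[OF t]] u_equation_right[OF t u_H1[OF t]] C u_tendsto[OF t]])
  moreover have "rhs t (u t) + cnj (rhs t (u t)) = 0"
  proof -
    have "cnj (L2inner (Nl (u t)) (u t)) = L2inner (Nl (u t)) (u t)"
      unfolding L2inner_cnj unfolding L2inner_def Nl_def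
      by (intro Bochner_Integration.integral_cong) auto
    then show ?thesis by (simp add: rhs_def Hq_form_cnj)
  qed
  ultimately show ?thesis by simp
qed

lemma mass_conservation: assumes "0 \<le> t" shows "L2sq (u t) = L2sq u0"
proof -
  have "\<exists>c. \<forall>t\<in>{0..}. L2inner (u t) (u t) = c"
    by (rule has_derivative_zero_constant)
       (use mass_derivative in \<open>auto simp: has_vector_derivative_def\<close>)
  then have "L2inner (u t) (u t) = L2inner (u 0) (u 0)" using assms by auto
  then show ?thesis by (simp add: L2inner_self u_initial)
qed

end

section \<open>Conservation of energy\<close>

context nls begin

lemma shifted_correlation_derivative:
  assumes t: "0 \<le> t" and h: "0 \<le> h"
  shows "((\<lambda>s. L2inner (u (s + h)) (u s)) has_vector_derivative
     (rhs (t + h) (u t) + cnj (rhs t (u (t + h))))) (at t within {0..})"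
proof -
  have th: "0 \<le> t + h" using t h by simp
  obtain C where C': "\<And>r s \<phi>. 0 \<le> r \<Longrightarrow> r \<le> t + h + 1 \<Longrightarrow> 0 \<le> s \<Longrightarrow> s \<le> t + h + 1 \<Longrightarrow> H1 \<phi> \<Longrightarrow>
     cmod (L2inner (u r) \<phi> - L2inner (u s) \<phi>) \<le> C * \<bar>r - s\<bar> * H1n \<phi>"
    using u_weak_Lipschitz[of "t + h + 1"] by metis
  have C: "cmod (L2inner (u (s + h)) \<phi> - L2inner (u (t + h)) \<phi>) \<le> C * \<bar>s - t\<bar> * H1n \<phi>"
    if "0 \<le> s" "s \<le> t + 1" "H1 \<phi>" for s \<phi>
    using C'[of "s + h" "t + h" \<phi>] that t h by simp
  have D1: "((\<lambda>s. L2inner (u (s + h)) (u t)) has_vector_derivative rhs (t + h) (u t)) (at t within {0..})"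
  proof -
    have "((\<lambda>s. L2inner (u s) (u t)) has_vector_derivative rhs (t + h) (u t)) (at (t + h) within (\<lambda>s. s + h) ` {0..})"
      by (rule has_vector_derivative_within_subset[OF u_equation[OF th u_H1[OF t]]]) (use h in auto)
    moreover have "((\<lambda>s. s + h) has_vector_derivative 1) (at t within {0..})"
      by (auto intro!: derivative_eq_intros)
    ultimately show ?thesis
      using vector_diff_chain_within[of "\<lambda>s. s + h" 1 t "{0..}" "\<lambda>s. L2inner (u s) (u t)"] by (simp add: o_def)
  qed
  show ?thesis
    by (rule weak_product_rule[OF t _ u_H1 D1 u_equation_right[OF t u_H1[OF th]] C u_tendsto[OF t]])
       (use h in \<open>auto intro: u_H1\<close>)
qed

text \<open>What is left of the derivative of -Im <u(t+h), u(t)> once the Hermitian form has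
  cancelled. By \<open>Nl_commutator\<close> it is the increment of \<open>Kint\<close> up to a
  quadratic error.\<close>

definition exchange :: "real \<Rightarrow> real \<Rightarrow> real" where
  "exchange h t = Re (L2inner (Nl (u (t + h))) (u t)) - Re (L2inner (Nl (u t)) (u (t + h)))"

lemma Re_Hq_form_commute: "Re (Hq_form q v w) = Re (Hq_form q w v)"
  by (metis Hq_form_cnj complex_cnj(1) cnj.simps(1))

lemma shifted_correlation_Im_derivative:
  assumes "0 \<le> t" "0 \<le> h"
  shows "((\<lambda>s. Im (L2inner (u (s + h)) (u s))) has_real_derivative - exchange h t) (at t within {0..})"
proof -
  have "Im (rhs (t + h) (u t) + cnj (rhs t (u (t + h)))) = - exchange h t"
    using Re_Hq_form_commute[of "u t" "u (t + h)"] by (simp add: rhs_def exchange_def)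
  then show ?thesis
    using bounded_linear.has_vector_derivative[OF bounded_linear_Im shifted_correlation_derivative[OF assms]]
    by (simp add: has_real_derivative_iff_has_vector_derivative)
qed

lemma Kint_continuous: "continuous_on {0..} (\<lambda>t. Kint (u t))"
  unfolding continuous_on_def
proof
  fix t :: real assume "t \<in> {0..}"
  then have t: "0 \<le> t" by simp
  obtain R where R: "\<And>s x. 0 \<le> s \<Longrightarrow> s \<le> t + 1 \<Longrightarrow> (cmod (u s x))\<^sup>2 \<le> R"
    using u_sup_bounded[of "t + 1"] by blast
  obtain C where C: "\<And>a b. sq_int a \<Longrightarrow> sq_int b \<Longrightarrow> \<forall>x. (cmod (a x))\<^sup>2 \<le> R \<Longrightarrow> \<forall>x. (cmod (b x))\<^sup>2 \<le> R \<Longrightarrow>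
     \<bar>Kint b - Kint a\<bar> \<le> C * ((L2n a + L2n b) * L2n (\<lambda>x. b x - a x))"
    using Kint_Lipschitz[of R] by blast
  show "((\<lambda>t. Kint (u t)) \<longlongrightarrow> Kint (u t)) (at t within {0..})"
  proof (rule LIM_zero_cancel, rule Lim_null_comparison)
    show "eventually (\<lambda>s. norm (Kint (u s) - Kint (u t)) \<le> C * ((L2n (u t) + L2n (u s)) * L2n (\<lambda>x. u s x - u t x))) (at t within {0..})"
      using eventually_nonneg_within eventually_le_within[of t "t + 1" "{0..}", simplified]
    proof eventually_elim
      case (elim s)
      then show ?case using C[OF u_sq_int[OF t] u_sq_int[of s]] R t by simp
    qed
    have "((\<lambda>s. L2n (u s)) \<longlongrightarrow> L2n (u t)) (at t within {0..})"
      using L2cont_L2sq[OF L2cont_u] t by (intro tendsto_real_sqrt) (simp add: continuous_on_def)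
    moreover have "((\<lambda>s. L2n (\<lambda>x. u s x - u t x)) \<longlongrightarrow> 0) (at t within {0..})"
      using L2cont_u t by (simp add: L2cont_def)
    ultimately have "((\<lambda>s. C * ((L2n (u t) + L2n (u s)) * L2n (\<lambda>x. u s x - u t x))) \<longlongrightarrow>
        C * ((L2n (u t) + L2n (u t)) * 0)) (at t within {0..})"
      by (intro tendsto_mult tendsto_add tendsto_const)
    then show "((\<lambda>s. C * ((L2n (u t) + L2n (u s)) * L2n (\<lambda>x. u s x - u t x))) \<longlongrightarrow> 0) (at t within {0..})"
      by simp
  qed
qed

definition Kint_primitive :: "real \<Rightarrow> real" where "Kint_primitive t = integral {0..t} (\<lambda>s. Kint (u s))"

lemma Kint_primitive_derivative:
  assumes "0 \<le> t" shows "(Kint_primitive has_real_derivative Kint (u t)) (at t within {0..})"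
proof -
  have "continuous_on {0..t+1} (\<lambda>s. Kint (u s))"
    by (rule continuous_on_subset[OF Kint_continuous]) auto
  from integral_has_real_derivative[OF this, of t] assms
  have "(Kint_primitive has_real_derivative Kint (u t)) (at t within {0..t+1})"
    by (simp add: Kint_primitive_def[abs_def])
  moreover have "at t within {0..t+1} = at t within {0..}"
    by (rule at_within_nhd[of t "{..<t+1}"]) auto
  ultimately show ?thesis by simp
qed

text \<open>Tends to \<open>2 * energy q g (u t)\<close> as \<open>h \<longrightarrow> 0\<close>, while its derivative in \<open>t\<close> tends to \<open>0\<close>.\<close>
definition energy_quotient :: "real \<Rightarrow> real \<Rightarrow> real" where
  "energy_quotient h t = (- Im (L2inner (u (t + h)) (u t)) - (Kint_primitive (t + h) - Kint_primitive t)) / h"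

definition energy_quotient_deriv :: "real \<Rightarrow> real \<Rightarrow> real" where
  "energy_quotient_deriv h t = (exchange h t - (Kint (u (t + h)) - Kint (u t))) / h"

lemma energy_quotient_derivative:
  assumes t: "0 \<le> t" and h: "0 < h"
  shows "(energy_quotient h has_real_derivative energy_quotient_deriv h t) (at t within {0..})"
proof -
  have "(Kint_primitive has_real_derivative Kint (u (t + h))) (at (t + h) within (\<lambda>s. s + h) ` {0..})"
    by (rule DERIV_subset[OF Kint_primitive_derivative]) (use t h in auto)
  moreover have "((\<lambda>s. s + h) has_real_derivative 1) (at t within {0..})"
    by (auto intro!: derivative_eq_intros)
  ultimately have "((\<lambda>s. Kint_primitive (s + h)) has_real_derivative Kint (u (t + h))) (at t within {0..})"
    using DERIV_image_chain[of Kint_primitive "Kint (u (t + h))" "\<lambda>s. s + h" t "{0..}" 1] by (simp add: o_def)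
  then have "((\<lambda>s. (- Im (L2inner (u (s + h)) (u s)) - (Kint_primitive (s + h) - Kint_primitive s)) / h) has_real_derivative
      (- (- exchange h t) - (Kint (u (t + h)) - Kint (u t))) / h) (at t within {0..})"
    using h by (intro DERIV_cdivide DERIV_diff DERIV_minus shifted_correlation_Im_derivative Kint_primitive_derivative t) auto
  then show ?thesis by (simp add: energy_quotient_def[abs_def] energy_quotient_deriv_def)
qed

text \<open>The numerator is bounded by the squared L2 norm of d = u(t+h) - u(t). Writing this as
  <u(t+h), d> - <u(t), d> and using the Lipschitz bound in the dual of H1 gains a factor h, which
  cancels the denominator; what remains is the H1 norm of d, which tends to 0.\<close>

lemma energy_quotient_deriv_bound:
  obtains C where "0 \<le> C" "\<And>t h. 0 \<le> t \<Longrightarrow> t \<le> T \<Longrightarrow> 0 < h \<Longrightarrow> h \<le> 1 \<Longrightarrow>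
     \<bar>energy_quotient_deriv h t\<bar> \<le> C * H1n (\<lambda>x. u (t + h) x - u t x)"
proof -
  obtain R where R: "\<And>s x. 0 \<le> s \<Longrightarrow> s \<le> T + 1 \<Longrightarrow> (cmod (u s x))\<^sup>2 \<le> R"
    using u_sup_bounded[of "T + 1"] by blast
  obtain C1 where C1: "0 \<le> C1" "\<And>(m :: real \<Rightarrow> real) a b. m \<in> borel_measurable borel \<Longrightarrow> \<forall>x. \<bar>m x\<bar> \<le> 1 \<Longrightarrow> sq_int a \<Longrightarrow> sq_int b \<Longrightarrow>
     \<forall>x. (cmod (a x))\<^sup>2 \<le> R \<Longrightarrow> \<forall>x. (cmod (b x))\<^sup>2 \<le> R \<Longrightarrow>
     \<bar>Re (L2inner (\<lambda>x. complex_of_real (m x) * Nl b x) a) - Re (L2inner (\<lambda>x. complex_of_real (m x) * Nl a x) b)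
       - (\<integral>x. m x * (defect ((cmod (b x))\<^sup>2) - defect ((cmod (a x))\<^sup>2)) \<partial>lborel)\<bar>
     \<le> C1 * L2sq (\<lambda>x. b x - a x)"
    using Nl_commutator[of R] by blast
  obtain C2 where C2: "0 \<le> C2" "\<And>r s \<phi>. 0 \<le> r \<Longrightarrow> r \<le> T + 1 \<Longrightarrow> 0 \<le> s \<Longrightarrow> s \<le> T + 1 \<Longrightarrow> H1 \<phi> \<Longrightarrow>
     cmod (L2inner (u r) \<phi> - L2inner (u s) \<phi>) \<le> C2 * \<bar>r - s\<bar> * H1n \<phi>"
    using u_weak_Lipschitz[of "T + 1"] by metis
  show thesis
  proof (rule that[of "C1 * C2"])
    fix t h :: real assume t: "0 \<le> t" "t \<le> T" and h: "0 < h" "h \<le> 1"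
    let ?a = "u t" and ?b = "u (t + h)" let ?d = "\<lambda>x. ?b x - ?a x"
    have th: "0 \<le> t + h" using t h by simp
    have "\<bar>exchange h t - (\<integral>x. 1 * (defect ((cmod (?b x))\<^sup>2) - defect ((cmod (?a x))\<^sup>2)) \<partial>lborel)\<bar> \<le> C1 * L2sq ?d"
      using C1(2)[of "\<lambda>_. 1" ?a ?b] u_sq_int[OF t(1)] u_sq_int[OF th] R t h by (simp add: exchange_def)
    moreover have "(\<integral>x. 1 * (defect ((cmod (?b x))\<^sup>2) - defect ((cmod (?a x))\<^sup>2)) \<partial>lborel) = Kint ?b - Kint ?a"
      unfolding Kint_def
      using integrable_defect[OF u_sq_int[OF t(1)], of R] integrable_defect[OF u_sq_int[OF th], of R] R t h by simp
    ultimately have 1: "\<bar>exchange h t - (Kint ?b - Kint ?a)\<bar> \<le> C1 * L2sq ?d" by simp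
    have "L2sq ?d = cmod (L2inner ?d ?d)" by (simp add: L2inner_self)
    also have "L2inner ?d ?d = L2inner ?b ?d - L2inner ?a ?d"
      using u_sq_int[OF t(1)] u_sq_int[OF th] by (intro L2inner_diff_left sq_int_diff)
    also have "cmod \<dots> \<le> C2 * \<bar>(t + h) - t\<bar> * H1n ?d"
      using t h by (intro C2 H1_diff u_H1) auto
    finally have "C1 * L2sq ?d \<le> C1 * (C2 * h * H1n ?d)"
      using C1(1) h by (intro mult_left_mono) auto
    with 1 have "\<bar>exchange h t - (Kint ?b - Kint ?a)\<bar> \<le> C1 * (C2 * h * H1n ?d)" by linarith
    then show "\<bar>energy_quotient_deriv h t\<bar> \<le> C1 * C2 * H1n ?d"
      using h by (simp add: energy_quotient_deriv_def abs_div field_simps)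
  qed (use C1 C2 in simp)
qed

lemma step_filterlim: "filterlim (\<lambda>n. t + inverse (real (Suc n))) (at t within {t..}) sequentially"
  unfolding filterlim_at
  using tendsto_add[OF tendsto_const[of t] LIMSEQ_inverse_real_of_nat] by auto

text \<open>-Im \<open>rhs\<close> is the full pairing <H_q u + \<open>Nl\<close> u, u>, and
  \<open>Kint\<close> is its excess over twice the energy. The sign of \<open>q\<close> turns -q
  into the absolute value in the energy.\<close>

lemma energy_double:
  assumes t: "0 \<le> t"
  shows "2 * energy q g (u t) = - Im (rhs t (u t)) - Kint (u t)"
proof -
  obtain R where R: "\<And>x. (cmod (u t x))\<^sup>2 \<le> R"
    using u_sup_bounded[of t] t by blast
  have "- Im (rhs t (u t)) = Re (Hq_form q (u t) (u t)) + Re (L2inner (Nl (u t)) (u t))"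
    by (simp add: rhs_def)
  also have "Re (Hq_form q (u t) (u t)) = L2sq (dx t) + \<bar>q\<bar> * (cmod (u t 0))\<^sup>2"
    using q_neg unfolding Hq_form_def L2inner_self cmod_power2
    by (simp add: power2_eq_square algebra_simps)
  finally show ?thesis
    using Kint_eq[OF u_sq_int[OF t] R] by (simp add: energy_def)
qed

text \<open>For every h the increment of \<open>energy_quotient h\<close> over [0, T] is the
  integral of its derivative. Dominated convergence along h = 1 / (n + 1) sends that integral to 0
  and the increment to twice the difference of the energies, so the energy itself is never
  differentiated.\<close>

lemma energy_conservation:
  assumes T: "0 \<le> T"
  shows "energy q g (u T) = energy q g u0"
proof -
  let ?h = "\<lambda>n. inverse (real (Suc n))"
  have h: "0 < ?h n" "?h n \<le> 1" for n by (auto simp: inverse_le_1_iff)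
  have lim: "(\<lambda>n. energy_quotient (?h n) t) \<longlonglongrightarrow> 2 * energy q g (u t)" if t: "0 \<le> t" for t
  proof -
    let ?E = "\<lambda>s. - Im (L2inner (u s) (u t)) - Kint_primitive s"
    have "((\<lambda>s. Im (L2inner (u s) (u t))) has_real_derivative Im (rhs t (u t))) (at t within {0..})"
      using bounded_linear.has_vector_derivative[OF bounded_linear_Im u_equation[OF t u_H1[OF t]]]
      by (simp add: has_real_derivative_iff_has_vector_derivative)
    then have "(?E has_real_derivative - Im (rhs t (u t)) - Kint (u t)) (at t within {0..})"
      by (intro DERIV_diff DERIV_minus Kint_primitive_derivative t)
    \<comment> \<open>Only the right derivative matters, since the steps h are positive; this also
      covers t = 0.\<close>
    then have "(?E has_real_derivative 2 * energy q g (u t)) (at t within {t..})"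
      unfolding energy_double[OF t] by (rule DERIV_subset) (use t in auto)
    then have "((\<lambda>s. (?E s - ?E t) / (s - t)) \<longlongrightarrow> 2 * energy q g (u t)) (at t within {t..})"
      by (simp only: has_field_derivative_iff)
    from filterlim_compose[OF this step_filterlim]
    have "(\<lambda>n. (?E (t + ?h n) - ?E t) / (t + ?h n - t)) \<longlonglongrightarrow> 2 * energy q g (u t)" .
    moreover have "(?E (t + ?h n) - ?E t) / (t + ?h n - t) = energy_quotient (?h n) t" for n
      by (simp add: energy_quotient_def L2inner_self)
    ultimately show ?thesis by simp
  qed
  obtain C where C: "0 \<le> C" "\<And>t h. 0 \<le> t \<Longrightarrow> t \<le> T \<Longrightarrow> 0 < h \<Longrightarrow> h \<le> 1 \<Longrightarrow>
     \<bar>energy_quotient_deriv h t\<bar> \<le> C * H1n (\<lambda>x. u (t + h) x - u t x)"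
    using energy_quotient_deriv_bound[of T] by metis
  obtain B where B: "0 \<le> B" "\<And>t. 0 \<le> t \<Longrightarrow> t \<le> T + 1 \<Longrightarrow> H1n (u t) \<le> B"
    using u_bounded[of "T + 1"] by blast
  have "((\<lambda>_. 0::real) has_integral (2 * energy q g (u T) - 2 * energy q g (u 0))) {0..T}"
  proof (rule has_integral_dominated_convergence)
    show "(energy_quotient_deriv (?h n) has_integral energy_quotient (?h n) T - energy_quotient (?h n) 0) {0..T}" for n
    proof (rule fundamental_theorem_of_calculus[OF T])
      fix t assume "t \<in> {0..T}"
      then have "(energy_quotient (?h n) has_real_derivative energy_quotient_deriv (?h n) t) (at t within {0..T})"
        by (intro DERIV_subset[OF energy_quotient_derivative]) (use h in auto)
      then show "(energy_quotient (?h n) has_vector_derivative energy_quotient_deriv (?h n) t) (at t within {0..T})"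
        by (simp add: has_real_derivative_iff_has_vector_derivative)
    qed
    \<comment> \<open>The 4 counts the norms of \<open>u\<close> and \<open>dx\<close> at the two
      times t and t + h; since h <= 1, the bound \<open>B\<close> is taken on [0, T + 1].\<close>
    show "(\<lambda>_. C * (4 * B)) integrable_on {0..T}" by (intro integrable_continuous_real continuous_intros)
    show "\<forall>t\<in>{0..T}. norm (energy_quotient_deriv (?h n) t) \<le> C * (4 * B)" for n
    proof
      fix t assume t: "t \<in> {0..T}"
      let ?b = "u (t + ?h n)"
      have th: "0 \<le> t + ?h n" "t + ?h n \<le> T + 1" using t h[of n] by auto
      have "H1n (\<lambda>x. ?b x - u t x) \<le> L2n (\<lambda>x. ?b x - u t x) + L2n (\<lambda>x. dx (t + ?h n) x - dx t x)"
        using t th by (subst L2n_H1_deriv_diff) (auto simp: u_H1 H1sq_def sqrt_add_le_add_sqrt)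
      also have "\<dots> \<le> (L2n ?b + L2n (u t)) + (L2n (dx (t + ?h n)) + L2n (dx t))"
        using t th by (intro add_mono L2n_diff u_sq_int dx_sq_int) auto
      also have "\<dots> \<le> (B + B) + (B + B)"
      proof -
        have b: "H1n ?b \<le> B" "H1n (u t) \<le> B" using t th by (auto intro!: B(2))
        show ?thesis
          by (intro add_mono order_trans[OF L2n_le_H1n(1) b(1)] order_trans[OF L2n_le_H1n(1) b(2)]
              order_trans[OF L2n_le_H1n(2) b(1)] order_trans[OF L2n_le_H1n(2) b(2)])
      qed
      finally have "C * H1n (\<lambda>x. ?b x - u t x) \<le> C * (4 * B)" using C(1) by (intro mult_left_mono) auto
      then show "norm (energy_quotient_deriv (?h n) t) \<le> C * (4 * B)"
        using C(2)[OF _ _ h(1) h(2), of t n] t by simp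
    qed
    show "\<forall>t\<in>{0..T}. (\<lambda>n. energy_quotient_deriv (?h n) t) \<longlonglongrightarrow> 0"
    proof
      fix t assume t: "t \<in> {0..T}"
      have "((\<lambda>s. H1n (\<lambda>x. u s x - u t x)) \<longlongrightarrow> 0) (at t within {t..})"
        by (rule tendsto_within_subset[OF u_tendsto]) (use t in auto)
      from filterlim_compose[OF this step_filterlim]
      have "(\<lambda>n. C * H1n (\<lambda>x. u (t + ?h n) x - u t x)) \<longlonglongrightarrow> 0"
        by (rule tendsto_mult_right_zero)
      then show "(\<lambda>n. energy_quotient_deriv (?h n) t) \<longlonglongrightarrow> 0"
        by (rule Lim_null_comparison[rotated]) (use C(2)[OF _ _ h(1) h(2), of t] t in \<open>auto intro!: always_eventually\<close>)
    qed
    show "(\<lambda>n. energy_quotient (?h n) T - energy_quotient (?h n) 0) \<longlonglongrightarrow> 2 * energy q g (u T) - 2 * energy q g (u 0)"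
      by (intro tendsto_diff lim T) simp
  qed
  from has_integral_unique[OF this has_integral_0] show ?thesis by (simp add: u_initial)
qed

text \<open>The other two terms of the energy are nonnegative, the potential one because
  \<open>g \<ge> 0\<close>.\<close>

lemma energy_ge_dx:
  assumes t: "0 \<le> t" shows "L2sq (dx t) \<le> 2 * energy q g u0"
proof -
  have "0 \<le> (\<integral>x. prim g ((cmod (u t x))\<^sup>2) \<partial>lborel)"
    by (intro Bochner_Integration.integral_nonneg prim_nonneg) auto
  moreover have "0 \<le> \<bar>q\<bar> * (cmod (u t 0))\<^sup>2" by simp
  ultimately have "L2sq (dx t) \<le> 2 * energy q g (u t)"
    unfolding energy_def by simp
  then show ?thesis by (simp add: energy_conservation[OF t])
qed

end

section \<open>Weights and the commutator operator\<close>

definition expw :: "real \<Rightarrow> real \<Rightarrow> real" where "expw c x = exp (- c * \<bar>x\<bar>)"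

lemma expw_continuous: "continuous_on S (expw c)"
  unfolding expw_def[abs_def] by (intro continuous_intros)

lemma expw_measurable [measurable]: "expw c \<in> borel_measurable borel"
  by (intro borel_measurable_continuous_onI expw_continuous)

lemma expw_bounds: "0 \<le> c \<Longrightarrow> expw c x \<le> 1" "0 < expw c x"
  by (simp_all add: expw_def)

lemma expw_add: "expw c x * expw d x = expw (c + d) x"
  by (simp add: expw_def algebra_simps flip: exp_add)

text \<open>The fundamental theorem of calculus tolerates the exceptional point 0: continuity of
  \<open>m\<close> is enough there, and \<open>m'\<close> need not be its derivative.\<close>

lemma W1infI:
  assumes m: "continuous_on UNIV m" and m': "m' \<in> borel_measurable borel"
    and K: "\<And>x. \<bar>m x\<bar> \<le> K" "\<And>x. \<bar>m' x\<bar> \<le> K"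
    and pos: "\<And>x. 0 < x \<Longrightarrow> m x = mp x" "\<And>x. 0 < x \<Longrightarrow> (mp has_real_derivative m' x) (at x)"
    and neg: "\<And>x. x < 0 \<Longrightarrow> m x = mn x" "\<And>x. x < 0 \<Longrightarrow> (mn has_real_derivative m' x) (at x)"
  shows "W1inf m m'"
  unfolding W1inf_def
proof (intro conjI allI impI)
  show "m \<in> borel_measurable borel" using m by (rule borel_measurable_continuous_onI)
  show "\<exists>K. \<forall>x. \<bar>m x\<bar> \<le> K \<and> \<bar>m' x\<bar> \<le> K" using K by blast
  fix a b :: real assume "a \<le> b"
  show "(m' has_integral (m b - m a)) {a..b}"
  proof (rule fundamental_theorem_of_calculus_interior_strong[of "{0}"])
    fix x assume x: "x \<in> {a<..<b} - {0}"
    show "(m has_vector_derivative m' x) (at x)"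
    proof (cases "0 < x")
      case True
      have "(m has_real_derivative m' x) (at x)"
        by (rule has_field_derivative_transform_within_open[OF pos(2)[OF True], of "{0<..}"])
           (use True pos(1) in auto)
      then show ?thesis by (simp add: has_real_derivative_iff_has_vector_derivative)
    next
      case False
      with x have "x < 0" by auto
      have "(m has_real_derivative m' x) (at x)"
        by (rule has_field_derivative_transform_within_open[OF neg(2)[OF \<open>x < 0\<close>], of "{..<0}"])
           (use \<open>x < 0\<close> neg(1) in auto)
      then show ?thesis by (simp add: has_real_derivative_iff_has_vector_derivative)
    qed
  qed (use \<open>a \<le> b\<close> continuous_on_subset[OF m] in auto)
qed (rule m')

lemma W1inf_expw:
  assumes "0 < c" shows "W1inf (expw c) (\<lambda>x. - c * sgn x * expw c x)"
proof (rule W1infI[where K = "max 1 c" and mp = "\<lambda>x. exp (- c * x)" and mn = "\<lambda>x. exp (c * x)"])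
  show "(\<lambda>x. - c * sgn x * expw c x) \<in> borel_measurable borel" by measurable
  show "\<bar>expw c x\<bar> \<le> max 1 c" for x
    using expw_bounds[of c x] assms by simp
  show "\<bar>- c * sgn x * expw c x\<bar> \<le> max 1 c" for x
    using assms expw_bounds[of c x] mult_left_mono[of "expw c x" 1 c]
    by (auto simp: abs_mult sgn_if max.coboundedI2)
qed (rule expw_continuous, use assms in \<open>auto simp: expw_def intro!: derivative_eq_intros\<close>)

text \<open>\<open>phi a x = sgn x * (1 - exp (- 2 * a * \<bar>x\<bar>)) / 2\<close>, written without the discontinuous sign.\<close>
definition phi :: "real \<Rightarrow> real \<Rightarrow> real" where
  "phi a x = (exp (2 * a * min x 0) - exp (- 2 * a * max x 0)) / 2"

lemma W1inf_phi:
  assumes "0 < a" shows "W1inf (phi a) (\<lambda>x. a * expw (2 * a) x)"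
proof (rule W1infI[where K = "max 1 a" and mp = "\<lambda>x. (1 - exp (- 2 * a * x)) / 2" and mn = "\<lambda>x. (exp (2 * a * x) - 1) / 2"])
  show "continuous_on UNIV (phi a)" unfolding phi_def[abs_def] by (intro continuous_intros) auto
  show "\<bar>phi a x\<bar> \<le> max 1 a" for x
  proof -
    have "\<bar>(s - t) / 2\<bar> \<le> 1" if "0 < s" "s \<le> 1" "0 < t" "t \<le> 1" for s t :: real
      using that by (auto simp: abs_if)
    moreover have "exp (2 * a * min x 0) \<le> 1" "exp (- 2 * a * max x 0) \<le> 1"
      using assms by (auto simp: mult_nonneg_nonpos)
    ultimately show ?thesis unfolding phi_def by (intro max.coboundedI1) auto
  qed
  show "\<bar>a * expw (2 * a) x\<bar> \<le> max 1 a" for x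
    using assms expw_bounds[of "2 * a" x] by (simp add: abs_mult max.coboundedI2)
qed (use assms in \<open>auto simp: expw_def phi_def intro!: derivative_eq_intros\<close>)

text \<open>The value 1/2 makes \<open>virial_weight\<close>, a sum of two values of
  \<open>phi\<close>, bounded by 1 as \<open>Nl_commutator\<close> demands.\<close>

lemma phi_bound: assumes "0 < a" shows "\<bar>phi a x\<bar> \<le> 1 / 2"
proof -
  have *: "exp (- 2 * a * y) \<le> 1" if "0 \<le> y" for y using assms that by simp
  have **: "exp (2 * a * y) \<le> 1" if "y \<le> 0" for y using assms that by (simp add: mult_nonneg_nonpos)
  show ?thesis using *[of x] **[of x] by (cases "0 \<le> x") (auto simp: phi_def abs_if)
qed

lemma phi_mono: assumes "0 < a" "x \<le> y" shows "phi a x \<le> phi a y"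
proof -
  have "((\<lambda>x. a * expw (2 * a) x) has_integral (phi a y - phi a x)) {x..y}"
    using W1inf_phi[OF assms(1)] assms(2) by (simp add: W1inf_def)
  from has_integral_nonneg[OF this] show ?thesis
    using assms expw_bounds(2)[of "2 * a"] by (simp add: less_imp_le)
qed

lemma phi_0 [simp]: "phi a 0 = 0" by (simp add: phi_def)

lemma phi_minus: "phi a (- x) = - phi a x"
  by (cases "0 \<le> x") (auto simp: phi_def field_simps)

lemma phi_le: assumes "0 < a" "0 \<le> x" shows "0 \<le> phi a x" "phi a x \<le> a * x"
proof -
  show "0 \<le> phi a x" using phi_mono[OF assms] by simp
  show "phi a x \<le> a * x"
    using exp_ge_add_one_self[of "- 2 * a * x"] assms by (simp add: phi_def)
qed

text \<open>The slope of \<open>phi\<close> at the origin; in the limit it is all that the point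
  interaction sees of the multiplier.\<close>

lemma phi_ratio: "((\<lambda>e. phi a e / e) \<longlongrightarrow> a) (at_right 0)"
proof -
  have "((\<lambda>x. (1 - exp (- 2 * a * x)) / 2) has_real_derivative a) (at 0 within {0<..})"
    by (auto intro!: derivative_eq_intros)
  then have "((\<lambda>e. ((1 - exp (- 2 * a * e)) / 2 - (1 - exp (- 2 * a * 0)) / 2) / (e - 0)) \<longlongrightarrow> a) (at_right 0)"
    by (simp only: has_field_derivative_iff)
  moreover have "eventually (\<lambda>e. ((1 - exp (- 2 * a * e)) / 2 - (1 - exp (- 2 * a * 0)) / 2) / (e - 0) = phi a e / e) (at_right 0)"
    using eventually_at_right_less[of 0] by eventually_elim (auto simp: phi_def)
  ultimately show ?thesis by (simp only: tendsto_cong)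
qed

text \<open>With \<open>m x = phi a x + phi a (x + e)\<close>, \<open>Aop e m / (4 * e)\<close> is the finite-difference
  version of \<open>(phi d/dx + d/dx phi) / 2\<close>.\<close>
definition Aop :: "real \<Rightarrow> (real \<Rightarrow> real) \<Rightarrow> (real \<Rightarrow> complex) \<Rightarrow> real \<Rightarrow> complex" where
  "Aop e m f x = complex_of_real (m x) * f (x + e) - complex_of_real (m (x - e)) * f (x - e)"

lemma sq_int_shift_minus: "sq_int f \<Longrightarrow> sq_int (\<lambda>x. f (x - e))"
  using sq_int_shift[of f "- e"] by simp

lemma sq_int_real_mult:
  assumes "sq_int f" "m \<in> borel_measurable borel" "\<And>x. \<bar>m x\<bar> \<le> K"
  shows "sq_int (\<lambda>x. complex_of_real (m x) * f x)"
  by (rule sq_int_mult_bounded[where K = K]) (use assms in auto)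

lemma L2n_real_mult:
  assumes "sq_int f" "m \<in> borel_measurable borel" "\<And>x. \<bar>m x\<bar> \<le> K"
  shows "L2n (\<lambda>x. complex_of_real (m x) * f x) \<le> K * L2n f"
  by (rule L2n_mult_bounded) (use assms in auto)

lemma L2inner_real_mult: "L2inner (\<lambda>x. complex_of_real (m x) * f x) h = L2inner f (\<lambda>x. complex_of_real (m x) * h x)"
  unfolding L2inner_def by (intro Bochner_Integration.integral_cong) (auto simp: ac_simps)

context
  fixes m :: "real \<Rightarrow> real" and K :: real
  assumes m: "m \<in> borel_measurable borel" and K: "\<And>x. \<bar>m x\<bar> \<le> K"
begin

lemma measurable_shift_minus: "(\<lambda>x. m (x - e)) \<in> borel_measurable borel"
  using m by measurable

lemma Aop_sq_int: assumes "sq_int f" shows "sq_int (Aop e m f)"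
  unfolding Aop_def[abs_def]
  by (intro sq_int_diff sq_int_real_mult[OF _ m K] sq_int_real_mult[OF _ measurable_shift_minus K]
      sq_int_shift sq_int_shift_minus assms)

lemma Aop_L2n: assumes f: "sq_int f" shows "L2n (Aop e m f) \<le> 2 * K * L2n f"
proof -
  have "L2n (Aop e m f) \<le> L2n (\<lambda>x. complex_of_real (m x) * f (x + e)) + L2n (\<lambda>x. complex_of_real (m (x - e)) * f (x - e))"
    unfolding Aop_def[abs_def]
    by (intro L2n_diff sq_int_real_mult[OF _ m K] sq_int_real_mult[OF _ measurable_shift_minus K]
      sq_int_shift sq_int_shift_minus f)
  also have "\<dots> \<le> K * L2n (\<lambda>x. f (x + e)) + K * L2n (\<lambda>x. f (x - e))"
    by (intro add_mono L2n_real_mult[OF _ m K] L2n_real_mult[OF _ measurable_shift_minus K]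
        sq_int_shift sq_int_shift_minus f)
  also have "L2n (\<lambda>x. f (x - e)) = L2n f" using L2sq_shift[of f "- e"] by simp
  finally show ?thesis by (simp add: L2sq_shift)
qed

text \<open>Translation by \<open>e\<close> carries each of the two terms of \<open>Aop\<close> into
  the adjoint of the other; the argument \<open>x - e\<close> in the second weight is there for
  this.\<close>

lemma Aop_antisym:
  assumes f: "sq_int f" and h: "sq_int h"
  shows "L2inner (Aop e m f) h = - L2inner f (Aop e m h)"
proof -
  note s = sq_int_real_mult[OF _ m K] sq_int_real_mult[OF _ measurable_shift_minus K] sq_int_shift sq_int_shift_minus
  have "L2inner (Aop e m f) h = L2inner (\<lambda>x. complex_of_real (m x) * f (x + e)) h
     - L2inner (\<lambda>x. complex_of_real (m (x - e)) * f (x - e)) h"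
    unfolding Aop_def[abs_def] by (intro L2inner_diff_left s f h)
  also have "L2inner (\<lambda>x. complex_of_real (m x) * f (x + e)) h
      = L2inner (\<lambda>x. complex_of_real (m (x - e)) * f x) (\<lambda>x. h (x - e))"
    using L2inner_shift[of "\<lambda>x. complex_of_real (m x) * f (x + e)" "- e" h] by simp
  also have "\<dots> = L2inner f (\<lambda>x. complex_of_real (m (x - e)) * h (x - e))"
    by (rule L2inner_real_mult)
  also have "L2inner (\<lambda>x. complex_of_real (m (x - e)) * f (x - e)) h
      = L2inner (\<lambda>x. complex_of_real (m x) * f x) (\<lambda>x. h (x + e))"
    using L2inner_shift[of "\<lambda>x. complex_of_real (m (x - e)) * f (x - e)" "e" h] by simp
  also have "\<dots> = L2inner f (\<lambda>x. complex_of_real (m x) * h (x + e))"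
    by (rule L2inner_real_mult)
  also have "L2inner f (\<lambda>x. complex_of_real (m (x - e)) * h (x - e)) - L2inner f (\<lambda>x. complex_of_real (m x) * h (x + e))
     = - L2inner f (Aop e m h)"
    unfolding Aop_def[abs_def] by (subst L2inner_diff_right) (auto intro!: s f h)
  finally show ?thesis .
qed

lemma Re_Aop_self: assumes f: "sq_int f" shows "Re (L2inner f (Aop e m f)) = 0"
  using Aop_antisym[OF f f] L2inner_cnj[of f "Aop e m f"] by (metis add.inverse_neutral
      cnj.simps(1) complex_cnj_minus equation_minus_iff neg_equal_zero uminus_complex.sel(1))

end

text \<open>Translations commute with d/dx, so the commutator of d/dx with \<open>Aop e m\<close> is
  \<open>Aop e m'\<close>.\<close>

lemma Aop_deriv:
  assumes m: "W1inf m m'" and f: "sq_int f" and d: "is_H1_deriv f d"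
  shows "is_H1_deriv (Aop e m f) (\<lambda>x. Aop e m' f x + Aop e m d x)"
proof -
  have 1: "is_H1_deriv (\<lambda>x. complex_of_real (m x) * f (x + e))
     (\<lambda>x. complex_of_real (m' x) * f (x + e) + complex_of_real (m x) * d (x + e))"
    by (intro is_H1_deriv_mult m sq_int_shift f is_H1_deriv_shift d)
  have 2: "is_H1_deriv (\<lambda>x. complex_of_real (m (x + - e)) * f (x + - e))
     (\<lambda>x. complex_of_real (m' (x + - e)) * f (x + - e) + complex_of_real (m (x + - e)) * d (x + - e))"
    by (intro is_H1_deriv_mult W1inf_shift m sq_int_shift f is_H1_deriv_shift d)
  show ?thesis
    using is_H1_deriv_diff[OF 1 2] by (simp add: Aop_def[abs_def] algebra_simps)
qed

text \<open>The two summands are the discrete forms of p d/dx and of d/dx p: a central difference of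
  \<open>f\<close> and one of the product p f. Bounds and limits are obtained for each
  separately.\<close>

lemma Aop_sum_weight:
  "Aop e (\<lambda>x. p x + p (x + e)) f x =
     complex_of_real (p x) * (f (x + e) - f (x - e))
     + (complex_of_real (p (x + e)) * f (x + e) - complex_of_real (p (x - e)) * f (x - e))"
  by (simp add: Aop_def algebra_simps)

text \<open>The derivative of \<open>sgn\<close> is twice the point mass at 0: integrate on each
  half line, where the contributions at infinity vanish.\<close>

lemma integral_sgn_mult_derivative:
  fixes G P :: "real \<Rightarrow> complex"
  assumes G: "integrable lborel G" and P: "\<And>a b. a \<le> b \<Longrightarrow> (G has_integral (P b - P a)) {a..b}"
    and top: "(\<lambda>n. P (real n)) \<longlonglongrightarrow> 0" and bot: "(\<lambda>n. P (- real n)) \<longlonglongrightarrow> 0"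
  shows "(\<integral>x. complex_of_real (sgn x) * G x \<partial>lborel) = - 2 * P 0"
proof -
  have [measurable]: "G \<in> borel_measurable borel" using G by simp
  have ind: "set_integrable lborel {a..b} G" for a b
    unfolding set_integrable_def using G by (intro integrable_mult_indicator) auto
  have I: "(\<integral>x. indicator {a..b} x *\<^sub>R G x \<partial>lborel) = P b - P a" if "a \<le> b" for a b
    using has_integral_LBINT[OF ind] P[OF that] has_integral_unique by blast
  have "(\<lambda>n. \<integral>x. indicator {- real n..real n} x *\<^sub>R (complex_of_real (sgn x) * G x) \<partial>lborel)
     \<longlonglongrightarrow> (\<integral>x. complex_of_real (sgn x) * G x \<partial>lborel)"
  proof (rule integral_dominated_convergence[where w = "\<lambda>x. norm (G x)"])
    show "AE x in lborel. (\<lambda>n. indicator {- real n..real n} x *\<^sub>R (complex_of_real (sgn x) * G x))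
       \<longlonglongrightarrow> complex_of_real (sgn x) * G x"
    proof (rule AE_I2)
      fix x :: real
      obtain N :: nat where "\<bar>x\<bar> \<le> real N" using real_arch_simple by blast
      then have "eventually (\<lambda>n. indicator {- real n..real n} x *\<^sub>R (complex_of_real (sgn x) * G x)
          = complex_of_real (sgn x) * G x) sequentially"
        unfolding eventually_sequentially by (intro exI[of _ N]) (auto simp: indicator_def)
      then show "(\<lambda>n. indicator {- real n..real n} x *\<^sub>R (complex_of_real (sgn x) * G x))
         \<longlonglongrightarrow> complex_of_real (sgn x) * G x" by (rule tendsto_eventually)
    qed
    show "AE x in lborel. norm (indicator {- real n..real n} x *\<^sub>R (complex_of_real (sgn x) * G x)) \<le> norm (G x)" for n
      by (intro AE_I2) (auto simp: indicator_def norm_mult sgn_if)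
  qed (use G in auto)
  moreover have "(\<integral>x. indicator {- real n..real n} x *\<^sub>R (complex_of_real (sgn x) * G x) \<partial>lborel)
      = P (real n) + P (- real n) - 2 * P 0" for n
  proof -
    \<comment> \<open>The two integrands differ at most at the origin, where \<open>sgn\<close> is 0
      and the two intervals overlap.\<close>
    have "(\<integral>x. indicator {- real n..real n} x *\<^sub>R (complex_of_real (sgn x) * G x) \<partial>lborel)
       = (\<integral>x. indicator {0..real n} x *\<^sub>R G x - indicator {- real n..0} x *\<^sub>R G x \<partial>lborel)"
      by (intro integral_cong_AE) (auto simp: indicator_def sgn_if intro!: eventually_mono[OF AE_lborel_singleton[of 0]])
    also have "\<dots> = (P (real n) - P 0) - (P 0 - P (- real n))"
      using ind unfolding set_integrable_def by (subst Bochner_Integration.integral_diff) (auto simp: I)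
    finally show ?thesis by simp
  qed
  ultimately have "(\<lambda>n. P (real n) + P (- real n) - 2 * P 0) \<longlonglongrightarrow> (\<integral>x. complex_of_real (sgn x) * G x \<partial>lborel)"
    by simp
  moreover have "(\<lambda>n. P (real n) + P (- real n) - 2 * P 0) \<longlonglongrightarrow> 0 + 0 - 2 * P 0"
    by (intro tendsto_intros top bot)
  ultimately show ?thesis using LIMSEQ_unique by fastforce
qed

section \<open>The commutator form\<close>

lemma Re_L2inner_commute: "Re (L2inner f h) = Re (L2inner h f)"
  by (subst L2inner_cnj[symmetric]) simp

text \<open>Explicit derivative of w = \<open>expw a\<close> f, used instead of the chosen
  \<open>H1_deriv\<close>: being linear in f and f' with bounded coefficients, it inherits the
  continuity in time of both.\<close>

definition weighted_deriv :: "real \<Rightarrow> (real \<Rightarrow> complex) \<Rightarrow> real \<Rightarrow> complex" where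
  "weighted_deriv a f x = complex_of_real (- a * sgn x * expw a x) * f x + complex_of_real (expw a x) * H1_deriv f x"

definition virial_weight :: "real \<Rightarrow> real \<Rightarrow> real \<Rightarrow> real" where "virial_weight a e x = phi a x + phi a (x + e)"

definition virial_weight_deriv :: "real \<Rightarrow> real \<Rightarrow> real \<Rightarrow> real" where
  "virial_weight_deriv a e x = a * expw (2 * a) x + a * expw (2 * a) (x + e)"

lemma W1inf_virial_weight: "0 < a \<Longrightarrow> W1inf (virial_weight a e) (virial_weight_deriv a e)"
  unfolding virial_weight_def[abs_def] virial_weight_deriv_def[abs_def] by (intro W1inf_add W1inf_shift[of "phi a" "\<lambda>x. a * expw (2 * a) x"] W1inf_phi)

lemma virial_weight_measurable: "0 < a \<Longrightarrow> virial_weight a e \<in> borel_measurable borel" "0 < a \<Longrightarrow> virial_weight_deriv a e \<in> borel_measurable borel"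
  using W1inf_virial_weight[of a e] by (auto simp: W1inf_def)

lemma virial_weight_bound: assumes "0 < a" shows "\<bar>virial_weight a e x\<bar> \<le> 1"
  using phi_bound[OF assms, of x] phi_bound[OF assms, of "x + e"] unfolding virial_weight_def by linarith

lemma virial_weight_deriv_bound: assumes "0 < a" shows "\<bar>virial_weight_deriv a e x\<bar> \<le> 2 * a"
proof -
  have "\<bar>a * expw (2 * a) y\<bar> \<le> a" for y
    using assms expw_bounds[of "2 * a" y] by (simp add: abs_mult)
  from this[of x] this[of "x + e"] show ?thesis unfolding virial_weight_deriv_def by linarith
qed

lemma weighted_deriv_is:
  assumes "0 < a" "H1 f"
  shows "is_H1_deriv (\<lambda>x. complex_of_real (expw a x) * f x) (weighted_deriv a f)"
  unfolding weighted_deriv_def[abs_def]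
  by (intro is_H1_deriv_mult W1inf_expw H1_sq_int H1_deriv_is assms)

section \<open>The quadratic part of the virial identity for a fixed H1 function\<close>

context
  fixes a :: real and f d :: "real \<Rightarrow> complex"
  assumes a: "0 < a" and H1f: "H1 f"
  defines "d \<equiv> H1_deriv f"
begin

lemma f_sq: "sq_int f" and d_sq: "sq_int d" and fd: "is_H1_deriv f d"
  using H1f by (simp_all add: d_def H1_sq_int H1_deriv_sq_int H1_deriv_is)

lemma psi_le: "\<bar>expw (2 * a) x\<bar> \<le> 1" "\<bar>expw a x\<bar> \<le> 1"
  using a expw_bounds[of "2 * a" x] expw_bounds[of a x] by auto

lemma sgn_psi: "(\<lambda>x. sgn x * expw c x) \<in> borel_measurable borel" "(\<lambda>x. sgn x * (sgn x * expw c x)) \<in> borel_measurable borel"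
  by measurable

lemma sgn_psi_le: "\<bar>sgn x * expw (2 * a) x\<bar> \<le> 1" "\<bar>sgn x * expw a x\<bar> \<le> 1" "\<bar>sgn x * (sgn x * expw (2 * a) x)\<bar> \<le> 1"
  using psi_le[of x] by (auto simp: abs_mult sgn_if)

lemmas real_mults =
  sq_int_real_mult[OF _ expw_measurable psi_le(1)]
  sq_int_real_mult[OF _ expw_measurable psi_le(2)]
  sq_int_real_mult[OF _ sgn_psi(1) sgn_psi_le(1)]
  sq_int_real_mult[OF _ sgn_psi(1) sgn_psi_le(2)]
  sq_int_real_mult[OF _ sgn_psi(2) sgn_psi_le(3)]

text \<open>The three quadratic quantities with density \<open>expw (2 * a)\<close> in which both
  the commutator limit and \<open>L2sq (weighted_deriv a f)\<close> expand. They are tied by the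
  relation \<open>weighted_cross_eq\<close>, which is what closes the computation.\<close>

definition "weighted_mass = Re (L2inner f (\<lambda>x. complex_of_real (sgn x * (sgn x * expw (2 * a) x)) * f x))"
definition "weighted_cross = Re (L2inner d (\<lambda>x. complex_of_real (sgn x * expw (2 * a) x) * f x))"
definition "weighted_kinetic = Re (L2inner d (\<lambda>x. complex_of_real (expw (2 * a) x) * d x))"

text \<open>The factor \<open>sgn x * sgn x\<close> below is not simplified to \<open>1\<close>, which would fail at \<open>x = 0\<close>.\<close>
lemma expw_double: "expw (2 * a) x = expw a x * expw a x"
  by (simp add: expw_add)

lemma L2sq_weighted_deriv: "L2sq (weighted_deriv a f) = a\<^sup>2 * weighted_mass - 2 * a * weighted_cross + weighted_kinetic"
proof -
  let ?X = "\<lambda>x. complex_of_real (- a) * (complex_of_real (sgn x * expw a x) * f x)"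
  let ?Y = "\<lambda>x. complex_of_real (expw a x) * d x"
  have X: "sq_int ?X" and Y: "sq_int ?Y"
    by (intro sq_int_cmult real_mults f_sq d_sq)+
  have "weighted_deriv a f = (\<lambda>x. ?X x + ?Y x)"
    by (simp add: weighted_deriv_def[abs_def] d_def mult.assoc)
  then have "L2sq (weighted_deriv a f) = L2sq ?X + L2sq ?Y + 2 * Re (L2inner ?X ?Y)"
    using L2sq_add[OF X Y] by simp
  moreover have "L2sq ?X = a\<^sup>2 * weighted_mass"
  proof -
    have "L2sq ?X = Re (L2inner ?X ?X)" by (simp add: L2inner_self)
    also have "L2inner ?X ?X = complex_of_real (a\<^sup>2) * L2inner f (\<lambda>x. complex_of_real (sgn x * expw a x) * (complex_of_real (sgn x * expw a x) * f x))"
      by (simp only: L2inner_cmult_left L2inner_cmult_right L2inner_real_mult) (simp add: power2_eq_square)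
    also have "(\<lambda>x. complex_of_real (sgn x * expw a x) * (complex_of_real (sgn x * expw a x) * f x))
       = (\<lambda>x. complex_of_real (sgn x * (sgn x * expw (2 * a) x)) * f x)"
      unfolding expw_double of_real_mult by (simp only: mult_ac)
    finally show ?thesis by (simp add: weighted_mass_def)
  qed
  moreover have "L2sq ?Y = weighted_kinetic"
  proof -
    have "L2sq ?Y = Re (L2inner ?Y ?Y)" by (simp add: L2inner_self)
    also have "L2inner ?Y ?Y = L2inner d (\<lambda>x. complex_of_real (expw a x) * (complex_of_real (expw a x) * d x))"
      by (rule L2inner_real_mult)
    also have "(\<lambda>x. complex_of_real (expw a x) * (complex_of_real (expw a x) * d x))
       = (\<lambda>x. complex_of_real (expw (2 * a) x) * d x)"
      unfolding expw_double of_real_mult by (simp only: mult_ac)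
    finally show ?thesis by (simp add: weighted_kinetic_def)
  qed
  moreover have "Re (L2inner ?X ?Y) = - a * weighted_cross"
  proof -
    have "Re (L2inner ?X ?Y) = Re (L2inner ?Y ?X)" by (rule Re_L2inner_commute)
    also have "L2inner ?Y ?X = complex_of_real (- a) * L2inner d (\<lambda>x. complex_of_real (expw a x) * (complex_of_real (sgn x * expw a x) * f x))"
      by (simp only: L2inner_cmult_right L2inner_real_mult) simp
    also have "(\<lambda>x. complex_of_real (expw a x) * (complex_of_real (sgn x * expw a x) * f x))
       = (\<lambda>x. complex_of_real (sgn x * expw (2 * a) x) * f x)"
      unfolding expw_double of_real_mult by (simp only: mult_ac)
    finally show ?thesis by (simp add: weighted_cross_def)
  qed
  ultimately show ?thesis by simp
qed

lemma psi_f_deriv: "is_H1_deriv (\<lambda>x. complex_of_real (expw (2 * a) x) * f x)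
   (\<lambda>x. complex_of_real (- (2 * a) * sgn x * expw (2 * a) x) * f x + complex_of_real (expw (2 * a) x) * d x)"
  using a by (intro is_H1_deriv_mult W1inf_expw f_sq fd) auto

lemma expw_tendsto: "(\<lambda>n. expw (2 * a) (real n)) \<longlonglongrightarrow> 0" "(\<lambda>n. expw (2 * a) (- real n)) \<longlonglongrightarrow> 0"
proof -
  have "(\<lambda>n. exp (- (2 * a)) ^ n) \<longlonglongrightarrow> 0" using a by (intro LIMSEQ_realpow_zero) auto
  then show "(\<lambda>n. expw (2 * a) (real n)) \<longlonglongrightarrow> 0" "(\<lambda>n. expw (2 * a) (- real n)) \<longlonglongrightarrow> 0"
    by (simp_all add: expw_def mult.commute flip: exp_of_nat_mult)
qed

text \<open>The jump of \<open>sgn\<close> at the origin produces the boundary term.\<close>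
lemma weighted_cross_eq: "weighted_cross = a * weighted_mass - (cmod (f 0))\<^sup>2"
proof -
  let ?F = "\<lambda>x. complex_of_real (expw (2 * a) x) * f x"
  let ?F' = "\<lambda>x. complex_of_real (- (2 * a) * sgn x * expw (2 * a) x) * f x + complex_of_real (expw (2 * a) x) * d x"
  let ?G = "\<lambda>x. ?F' x * cnj (f x) + ?F x * cnj (d x)"
  let ?P = "\<lambda>x. ?F x * cnj (f x)"
  have F'sq: "sq_int ?F'" using psi_f_deriv by (rule is_H1_deriv_sq_int)
  have Gi: "integrable lborel ?G"
    by (intro Bochner_Integration.integrable_add sq_int_mult_integrable F'sq f_sq d_sq real_mults)
  obtain B where B: "0 \<le> B" "\<And>x. cmod (f x) \<le> B"
    using H1_sup_bound'[OF H1f] by (meson mult_nonneg_nonneg real_sqrt_ge_zero H1sq_nonneg zero_le_numeral)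
  have Plim: "(\<lambda>n. ?P (k n)) \<longlonglongrightarrow> 0" if "(\<lambda>n. expw (2 * a) (k n)) \<longlonglongrightarrow> 0" for k :: "nat \<Rightarrow> real"
  proof (rule Lim_null_comparison)
    show "eventually (\<lambda>n. norm (?P (k n)) \<le> expw (2 * a) (k n) * (B * B)) sequentially"
      using B expw_bounds(2)[of "2 * a"] by (intro always_eventually allI)
        (auto simp: norm_mult mult.assoc less_imp_le intro!: mult_left_mono mult_mono)
    show "(\<lambda>n. expw (2 * a) (k n) * (B * B)) \<longlonglongrightarrow> 0" using that by (rule tendsto_mult_left_zero)
  qed
  \<comment> \<open>\<open>?G\<close> is the derivative of \<open>?P\<close>, the density |f|^2
    times \<open>expw (2 * a)\<close>. Expanding the left side below gives -2 a
    \<open>weighted_mass\<close> + 2 \<open>weighted_cross\<close> as its real part.\<close>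
  have "(\<integral>x. complex_of_real (sgn x) * ?G x \<partial>lborel) = - 2 * ?P 0"
  proof (rule integral_sgn_mult_derivative[OF Gi _ Plim[OF expw_tendsto(1)] Plim[OF expw_tendsto(2)]])
    fix s t :: real assume st: "s \<le> t"
    show "(?G has_integral ?P t - ?P s) {s..t}"
    proof (rule AC_product_rule[OF st])
      show "set_integrable lborel {s..t} ?F'" by (rule sq_int_set_integrable[OF F'sq])
      have "integrable lborel (\<lambda>x. cnj (indicator {s..t} x *\<^sub>R d x))"
        using sq_int_set_integrable[OF d_sq, of s t] unfolding set_integrable_def by (rule integrable_cnj)
      then show "set_integrable lborel {s..t} (\<lambda>x. cnj (d x))" by (simp add: set_integrable_def)
      fix x assume x: "x \<in> {s..t}"
      show "(?F' has_integral ?F x - ?F s) {s..x}"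
        using psi_f_deriv x by (simp add: is_H1_deriv_def)
      have "(d has_integral f t - f x) {x..t}" using fd x by (simp add: is_H1_deriv_def)
      from has_integral_linear[OF this bounded_linear_cnj]
      show "((\<lambda>x. cnj (d x)) has_integral cnj (f t) - cnj (f x)) {x..t}" by (simp add: o_def)
    qed
  qed
  moreover have "(\<integral>x. complex_of_real (sgn x) * ?G x \<partial>lborel) =
     complex_of_real (- (2 * a)) * L2inner f (\<lambda>x. complex_of_real (sgn x * (sgn x * expw (2 * a) x)) * f x)
     + (L2inner d (\<lambda>x. complex_of_real (sgn x * expw (2 * a) x) * f x)
        + L2inner (\<lambda>x. complex_of_real (sgn x * expw (2 * a) x) * f x) d)"
  proof -
    let ?p = "\<lambda>x. f x * cnj (complex_of_real (sgn x * (sgn x * expw (2 * a) x)) * f x)"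
    let ?q = "\<lambda>x. d x * cnj (complex_of_real (sgn x * expw (2 * a) x) * f x)"
    let ?r = "\<lambda>x. complex_of_real (sgn x * expw (2 * a) x) * f x * cnj (d x)"
    have i: "integrable lborel ?p" "integrable lborel ?q" "integrable lborel ?r"
      by (intro sq_int_mult_integrable f_sq d_sq real_mults)+
    have "(\<lambda>x. complex_of_real (sgn x) * ?G x) = (\<lambda>x. complex_of_real (- (2 * a)) * ?p x + (?q x + ?r x))"
      by (rule ext) (auto simp: sgn_if algebra_simps)
    then show ?thesis
      unfolding L2inner_def using i
      by (simp only: Bochner_Integration.integral_add integral_mult_right_zero
          Bochner_Integration.integrable_add integrable_mult_right)
  qed
  ultimately have "Re (complex_of_real (- (2 * a)) * L2inner f (\<lambda>x. complex_of_real (sgn x * (sgn x * expw (2 * a) x)) * f x)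
     + (L2inner d (\<lambda>x. complex_of_real (sgn x * expw (2 * a) x) * f x)
        + L2inner (\<lambda>x. complex_of_real (sgn x * expw (2 * a) x) * f x) d)) = Re (- 2 * ?P 0)"
    by simp
  moreover have "Re (L2inner (\<lambda>x. complex_of_real (sgn x * expw (2 * a) x) * f x) d) = weighted_cross"
    unfolding weighted_cross_def by (rule Re_L2inner_commute)
  moreover have "Re (- 2 * ?P 0) = - 2 * (cmod (f 0))\<^sup>2"
    unfolding cmod_power2 by (simp add: expw_def power2_eq_square)
  ultimately show ?thesis by (simp add: weighted_cross_def weighted_mass_def)
qed

text \<open>With p = \<open>expw (2 * a)\<close>: the limits Re <p f', f'> and Re <f', (p f)'> of
  the two central-difference parts of the discrete commutator.\<close>

definition "commutator_limit = Re (L2inner (\<lambda>x. complex_of_real (expw (2 * a) x) * d x) d)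
   + Re (L2inner d (\<lambda>x. complex_of_real (- (2 * a) * sgn x * expw (2 * a) x) * f x + complex_of_real (expw (2 * a) x) * d x))"

text \<open>Completing the square: subtracting ||w'||^2 leaves -a (a \<open>weighted_mass\<close> -
  \<open>weighted_cross\<close>), and the bracket is just |f(0)|^2. This is the cancellation of the
  potential away from the origin.\<close>

lemma commutator_limit_eq: "commutator_limit / 2 = L2sq (weighted_deriv a f) - a * (cmod (f 0))\<^sup>2"
proof -
  have e: "complex_of_real (- (2 * a) * sgn x * expw (2 * a) x) * f x
     = complex_of_real (- (2 * a)) * (complex_of_real (sgn x * expw (2 * a) x) * f x)" for x
    by (simp only: of_real_mult mult.assoc)
  have "L2inner d (\<lambda>x. complex_of_real (- (2 * a) * sgn x * expw (2 * a) x) * f x + complex_of_real (expw (2 * a) x) * d x)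
     = complex_of_real (- (2 * a)) * L2inner d (\<lambda>x. complex_of_real (sgn x * expw (2 * a) x) * f x)
      + L2inner d (\<lambda>x. complex_of_real (expw (2 * a) x) * d x)"
    unfolding e L2inner_add_right[OF d_sq sq_int_cmult[OF real_mults(3)[OF f_sq], of "complex_of_real (- (2 * a))"] real_mults(1)[OF d_sq]]
      L2inner_cmult_right complex_cnj_complex_of_real ..
  then have "commutator_limit = weighted_kinetic + (- (2 * a) * weighted_cross + weighted_kinetic)"
    unfolding commutator_limit_def L2inner_real_mult by (simp add: weighted_kinetic_def weighted_cross_def)
  then have "commutator_limit / 2 = weighted_kinetic - a * weighted_cross" by simp
  also have "\<dots> = L2sq (weighted_deriv a f) - a * (a * weighted_mass - weighted_cross)"
    unfolding L2sq_weighted_deriv by (simp add: power2_eq_square algebra_simps)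
  also have "a * weighted_mass - weighted_cross = (cmod (f 0))\<^sup>2" using weighted_cross_eq by simp
  finally show ?thesis .
qed

lemma commutator_split:
  "L2inner d (Aop e (virial_weight_deriv a e) f) = complex_of_real a *
     (L2inner (\<lambda>x. complex_of_real (expw (2 * a) x) * d x) (\<lambda>x. f (x + e) - f (x - e))
      + L2inner d (\<lambda>x. complex_of_real (expw (2 * a) (x + e)) * f (x + e) - complex_of_real (expw (2 * a) (x - e)) * f (x - e)))"
proof -
  let ?u = "\<lambda>x. complex_of_real (expw (2 * a) x) * (f (x + e) - f (x - e))"
  let ?v = "\<lambda>x. complex_of_real (expw (2 * a) (x + e)) * f (x + e) - complex_of_real (expw (2 * a) (x - e)) * f (x - e)"
  have "Aop e (virial_weight_deriv a e) f = (\<lambda>x. complex_of_real a * (?u x + ?v x))"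
    using Aop_sum_weight[of e "\<lambda>x. a * expw (2 * a) x" f] by (auto simp: virial_weight_deriv_def[abs_def] algebra_simps)
  then have "L2inner d (Aop e (virial_weight_deriv a e) f) = complex_of_real a * L2inner d (\<lambda>x. ?u x + ?v x)"
    by (simp add: L2inner_cmult_right)
  also have "L2inner d (\<lambda>x. ?u x + ?v x) = L2inner d ?u + L2inner d ?v"
    by (intro L2inner_add_right d_sq real_mults sq_int_diff sq_int_shift f_sq sq_int_shift_minus
        sq_int_shift[OF real_mults(1)[OF f_sq]] sq_int_shift_minus[OF real_mults(1)[OF f_sq]])
  also have "L2inner d ?u = L2inner (\<lambda>x. complex_of_real (expw (2 * a) x) * d x) (\<lambda>x. f (x + e) - f (x - e))"
    by (simp only: L2inner_real_mult)
  finally show ?thesis .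
qed

lemma commutator_tendsto:
  "((\<lambda>e. Re (L2inner d (Aop e (virial_weight_deriv a e) f)) / (4 * e)) \<longlongrightarrow> a * (L2sq (weighted_deriv a f) - a * (cmod (f 0))\<^sup>2)) (at_right 0)"
proof -
  let ?c1 = "\<lambda>e. L2inner (\<lambda>x. complex_of_real (expw (2 * a) x) * d x) (\<lambda>x. f (x + e) - f (x - e))"
  let ?c2 = "\<lambda>e. L2inner d (\<lambda>x. complex_of_real (expw (2 * a) (x + e)) * f (x + e) - complex_of_real (expw (2 * a) (x - e)) * f (x - e))"
  \<comment> \<open>Division by 4e averages two central differences, each normalised by 2e; hence
    the factor a/2.\<close>
  have "((\<lambda>e. a / 2 * (Re (?c1 e / (2 * complex_of_real e)) + Re (?c2 e / (2 * complex_of_real e)))) \<longlongrightarrow> a / 2 * commutator_limit) (at_right 0)"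
    unfolding commutator_limit_def
    by (intro tendsto_intros central_difference_tendsto[OF real_mults(1)[OF d_sq] fd] central_difference_tendsto[OF d_sq psi_f_deriv])
  moreover have "a / 2 * commutator_limit = a * (L2sq (weighted_deriv a f) - a * (cmod (f 0))\<^sup>2)"
    by (simp flip: commutator_limit_eq)
  moreover have "a / 2 * (Re (?c1 e / (2 * complex_of_real e)) + Re (?c2 e / (2 * complex_of_real e)))
      = Re (L2inner d (Aop e (virial_weight_deriv a e) f)) / (4 * e)" for e
  proof -
    have r: "Re (z / (2 * complex_of_real e)) = Re z / (2 * e)" for z
      using Re_divide_of_real[of z "2 * e"] by simp
    show ?thesis unfolding commutator_split r by (cases "e = 0") (simp_all add: field_simps)
  qed
  ultimately show ?thesis by (simp only:)
qed

lemma L2n_product_deriv: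
  assumes W: "W1inf m m'" and m: "\<And>x. \<bar>m x\<bar> \<le> K" and m': "\<And>x. \<bar>m' x\<bar> \<le> L" and e: "0 \<le> e"
  shows "L2n (\<lambda>x. complex_of_real (m (x + e)) * f (x + e) - complex_of_real (m (x - e)) * f (x - e)) \<le> 2 * e * (L * L2n f + K * L2n d)"
proof -
  have mb: "m \<in> borel_measurable borel" "m' \<in> borel_measurable borel" using W by (auto simp: W1inf_def)
  have "L2n (\<lambda>x. complex_of_real (m (x + e)) * f (x + e) - complex_of_real (m (x + - e)) * f (x + - e))
      \<le> (e - - e) * L2n (\<lambda>x. complex_of_real (m' x) * f x + complex_of_real (m x) * d x)"
    by (rule L2n_difference_le[OF sq_int_real_mult[OF f_sq mb(1) m] is_H1_deriv_mult[OF W f_sq fd]]) (use e in simp)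
  also have "\<dots> \<le> (e - - e) * (L * L2n f + K * L2n d)"
    using e by (intro mult_left_mono order_trans[OF L2n_triangle[OF sq_int_real_mult[OF f_sq mb(2) m'] sq_int_real_mult[OF d_sq mb(1) m]]]
       add_mono L2n_real_mult[OF f_sq mb(2) m'] L2n_real_mult[OF d_sq mb(1) m]) auto
  finally show ?thesis by simp
qed

lemma L2n_central_difference:
  assumes "0 \<le> e" shows "L2n (\<lambda>x. f (x + e) - f (x - e)) \<le> 2 * e * L2n d"
  using L2n_difference_le[OF f_sq fd, of "- e" e] assms by simp

text \<open>Uniform in \<open>e\<close>: together with the bound for the delta term it provides the
  dominating constant when \<open>e\<close> tends to 0 under the time integral.\<close>

lemma commutator_bound:
  assumes e: "0 < e"
  shows "\<bar>Re (L2inner d (Aop e (virial_weight_deriv a e) f)) / (4 * e)\<bar> \<le> a * (L2n d * (L2n d + a * L2n f))"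
proof -
  let ?c1 = "L2inner (\<lambda>x. complex_of_real (expw (2 * a) x) * d x) (\<lambda>x. f (x + e) - f (x - e))"
  let ?c2 = "L2inner d (\<lambda>x. complex_of_real (expw (2 * a) (x + e)) * f (x + e) - complex_of_real (expw (2 * a) (x - e)) * f (x - e))"
  have "cmod ?c1 \<le> L2n (\<lambda>x. complex_of_real (expw (2 * a) x) * d x) * L2n (\<lambda>x. f (x + e) - f (x - e))"
    by (intro L2_Cauchy_Schwarz real_mults d_sq sq_int_diff sq_int_shift f_sq sq_int_shift_minus)
  also have "\<dots> \<le> (1 * L2n d) * (2 * e * L2n d)"
    using e by (intro mult_mono L2n_real_mult[OF d_sq expw_measurable psi_le(1)] L2n_central_difference) auto
  finally have 1: "cmod ?c1 \<le> 2 * e * (L2n d * L2n d)" by (simp only: mult_1 mult_ac)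
  have "cmod ?c2 \<le> L2n d * L2n (\<lambda>x. complex_of_real (expw (2 * a) (x + e)) * f (x + e) - complex_of_real (expw (2 * a) (x - e)) * f (x - e))"
    by (intro L2_Cauchy_Schwarz d_sq sq_int_diff sq_int_shift[OF real_mults(1)[OF f_sq]] sq_int_shift_minus[OF real_mults(1)[OF f_sq]])
  also have "\<dots> \<le> L2n d * (2 * e * (2 * a * L2n f + 1 * L2n d))"
  proof (intro mult_left_mono L2n_product_deriv)
    show "W1inf (expw (2 * a)) (\<lambda>x. - (2 * a) * sgn x * expw (2 * a) x)" using a by (intro W1inf_expw) simp
    show "\<bar>- (2 * a) * sgn x * expw (2 * a) x\<bar> \<le> 2 * a" for x
      using sgn_psi_le(1)[of x] a mult_left_mono[of "\<bar>sgn x * expw (2 * a) x\<bar>" 1 "2 * a"] by (simp add: abs_mult mult.assoc)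
  qed (use e psi_le in auto)
  also have "\<dots> = 2 * e * (L2n d * (L2n d + 2 * a * L2n f))" by algebra
  finally have 2: "cmod ?c2 \<le> 2 * e * (L2n d * (L2n d + 2 * a * L2n f))" .
  have "\<bar>Re (L2inner d (Aop e (virial_weight_deriv a e) f))\<bar> \<le> cmod (L2inner d (Aop e (virial_weight_deriv a e) f))" by (rule abs_Re_le_cmod)
  also have "\<dots> = a * cmod (?c1 + ?c2)" unfolding commutator_split norm_mult using a by simp
  also have "\<dots> \<le> a * (2 * e * (L2n d * L2n d) + 2 * e * (L2n d * (L2n d + 2 * a * L2n f)))"
    using a 1 2 by (intro mult_left_mono order_trans[OF norm_triangle_ineq]) auto
  also have "\<dots> = 4 * e * (a * (L2n d * (L2n d + a * L2n f)))" by algebra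
  finally show ?thesis using e by (simp add: abs_div pos_divide_le_eq mult.commute)
qed

text \<open>Unlike \<open>Aop_L2n\<close> this is linear in \<open>e\<close>, so it survives the
  division by 4e. The price is the derivative of \<open>f\<close>, with weight 1/2 from each of the
  two summands.\<close>

lemma Aop_phi_bound:
  assumes e: "0 < e"
  shows "L2n (Aop e (virial_weight a e) f) \<le> 2 * e * (L2n d + a * L2n f)"
proof -
  let ?u = "\<lambda>x. complex_of_real (phi a x) * (f (x + e) - f (x - e))"
  let ?v = "\<lambda>x. complex_of_real (phi a (x + e)) * f (x + e) - complex_of_real (phi a (x - e)) * f (x - e)"
  have W: "W1inf (phi a) (\<lambda>x. a * expw (2 * a) x)" using a by (rule W1inf_phi)
  have pm: "phi a \<in> borel_measurable borel" using W by (simp add: W1inf_def)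
  note p = phi_bound[OF a]
  have "Aop e (virial_weight a e) f = (\<lambda>x. ?u x + ?v x)"
    using Aop_sum_weight[of e "phi a" f] by (auto simp: virial_weight_def[abs_def])
  then have "L2n (Aop e (virial_weight a e) f) \<le> L2n ?u + L2n ?v"
    by (simp only:, intro L2n_triangle sq_int_real_mult[OF _ pm p] sq_int_diff sq_int_shift f_sq sq_int_shift_minus
        sq_int_shift[OF sq_int_real_mult[OF f_sq pm p]] sq_int_shift_minus[OF sq_int_real_mult[OF f_sq pm p]])
  also have "L2n ?u \<le> 1 / 2 * (2 * e * L2n d)"
    using e by (intro order_trans[OF L2n_real_mult[OF _ pm p]] mult_left_mono L2n_central_difference
        sq_int_diff sq_int_shift f_sq sq_int_shift_minus) auto
  also have "L2n ?v \<le> 2 * e * (a * L2n f + 1 / 2 * L2n d)"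
  proof (rule L2n_product_deriv[OF W p])
    show "\<bar>a * expw (2 * a) x\<bar> \<le> a" for x using psi_le(1)[of x] a by (simp add: abs_mult)
  qed (use e in simp)
  finally show ?thesis by (simp add: algebra_simps)
qed

lemma Aop_H1: "H1 (Aop e (virial_weight a e) f)"
  by (rule H1I[OF Aop_sq_int[OF virial_weight_measurable(1)[OF a] virial_weight_bound[OF a] f_sq] Aop_deriv[OF W1inf_virial_weight[OF a] f_sq fd]])

text \<open>Not small in \<open>e\<close>, but it serves at fixed \<open>e\<close>: it makes
  \<open>Aop\<close> applied to the solution continuous in time with values in H1.\<close>

lemma Aop_H1n: "H1n (Aop e (virial_weight a e) f) \<le> (4 + 4 * a) * H1n f"
proof -
  let ?A = "Aop e (virial_weight a e) f"
  have "H1n ?A \<le> L2n ?A + L2n (H1_deriv ?A)"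
    by (simp add: H1sq_def sqrt_add_le_add_sqrt)
  also have "L2n ?A \<le> 2 * 1 * L2n f" by (rule Aop_L2n[OF virial_weight_measurable(1)[OF a] virial_weight_bound[OF a] f_sq])
  also have "L2n (H1_deriv ?A) = L2n (\<lambda>x. Aop e (virial_weight_deriv a e) f x + Aop e (virial_weight a e) d x)"
    by (simp add: L2sq_H1_deriv[OF Aop_deriv[OF W1inf_virial_weight[OF a] f_sq fd]])
  also have "\<dots> \<le> 2 * (2 * a) * L2n f + 2 * 1 * L2n d"
    by (intro order_trans[OF L2n_triangle] add_mono Aop_sq_int[OF virial_weight_measurable(2)[OF a] virial_weight_deriv_bound[OF a] f_sq]
      Aop_sq_int[OF virial_weight_measurable(1)[OF a] virial_weight_bound[OF a] d_sq]
      Aop_L2n[OF virial_weight_measurable(2)[OF a] virial_weight_deriv_bound[OF a] f_sq] Aop_L2n[OF virial_weight_measurable(1)[OF a] virial_weight_bound[OF a] d_sq])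
  also have "2 * 1 * L2n f + (2 * (2 * a) * L2n f + 2 * 1 * L2n d) \<le> 2 * 1 * H1n f + (2 * (2 * a) * H1n f + 2 * 1 * H1n f)"
    using a L2n_le_H1n[of f] unfolding d_def by (intro add_mono mult_left_mono) auto
  finally show ?thesis by (simp add: algebra_simps)
qed

text \<open>By the Leibniz rule the derivative of \<open>Aop\<close> splits in two, and the part
  acting on f' drops out by antisymmetry. At the origin, oddness of \<open>phi\<close> and
  \<open>phi a 0 = 0\<close> reduce both weights to \<open>phi a e\<close> up to sign.\<close>

lemma Re_Hq_form_Aop:
  "Re (Hq_form q f (Aop e (virial_weight a e) f)) = Re (L2inner d (Aop e (virial_weight_deriv a e) f)) - q * phi a e * Re (f 0 * cnj (f e + f (- e)))"
proof -
  have "L2inner (H1_deriv f) (H1_deriv (Aop e (virial_weight a e) f)) = L2inner d (\<lambda>x. Aop e (virial_weight_deriv a e) f x + Aop e (virial_weight a e) d x)"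
    using L2inner_H1_deriv_right[OF Aop_deriv[OF W1inf_virial_weight[OF a] f_sq fd] d_sq] by (simp add: d_def)
  also have "\<dots> = L2inner d (Aop e (virial_weight_deriv a e) f) + L2inner d (Aop e (virial_weight a e) d)"
    by (intro L2inner_add_right d_sq Aop_sq_int[OF virial_weight_measurable(2)[OF a] virial_weight_deriv_bound[OF a] f_sq]
      Aop_sq_int[OF virial_weight_measurable(1)[OF a] virial_weight_bound[OF a] d_sq])
  finally have "Re (L2inner (H1_deriv f) (H1_deriv (Aop e (virial_weight a e) f))) = Re (L2inner d (Aop e (virial_weight_deriv a e) f))"
    using Re_Aop_self[OF virial_weight_measurable(1)[OF a] virial_weight_bound[OF a] d_sq] by simp
  moreover have "Aop e (virial_weight a e) f 0 = complex_of_real (phi a e) * (f e + f (- e))"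
    by (simp add: Aop_def virial_weight_def phi_minus algebra_simps)
  ultimately show ?thesis by (simp add: Hq_form_def algebra_simps)
qed

lemma Hq_form_Aop_tendsto:
  "((\<lambda>e. Re (Hq_form q f (Aop e (virial_weight a e) f)) / (4 * e)) \<longlongrightarrow>
     a * (L2sq (weighted_deriv a f) - (q / 2 + a) * (cmod (f 0))\<^sup>2)) (at_right 0)"
proof -
  have c: "isCont f 0" using H1_continuous[OF H1f] by (simp add: continuous_on_eq_continuous_at)
  have l1: "((\<lambda>e. f e) \<longlongrightarrow> f 0) (at_right 0)"
    using c unfolding isCont_def by (rule tendsto_within_subset) simp
  have "((\<lambda>e::real. - e) \<longlongrightarrow> 0) (at_right 0)"
    using tendsto_minus[OF tendsto_ident_at[of 0 "{0<..}"]] by simp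
  then have l2: "((\<lambda>e. f (- e)) \<longlongrightarrow> f 0) (at_right 0)" using c isCont_tendsto_compose by blast
  have "((\<lambda>e. Re (L2inner d (Aop e (virial_weight_deriv a e) f)) / (4 * e) - q / 4 * (phi a e / e) * Re (f 0 * cnj (f e + f (- e)))) \<longlongrightarrow>
     a * (L2sq (weighted_deriv a f) - a * (cmod (f 0))\<^sup>2) - q / 4 * a * Re (f 0 * cnj (f 0 + f 0))) (at_right 0)"
    by (intro tendsto_diff commutator_tendsto tendsto_mult tendsto_const phi_ratio tendsto_Re tendsto_cnj tendsto_add l1 l2)
  moreover have "a * (L2sq (weighted_deriv a f) - a * (cmod (f 0))\<^sup>2) - q / 4 * a * Re (f 0 * cnj (f 0 + f 0))
     = a * (L2sq (weighted_deriv a f) - (q / 2 + a) * (cmod (f 0))\<^sup>2)"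
    unfolding cmod_power2 by (simp add: power2_eq_square algebra_simps)
  ultimately show ?thesis
    unfolding Re_Hq_form_Aop by (simp add: diff_divide_distrib mult.assoc)
qed

lemma Hq_form_Aop_bound:
  assumes e: "0 < e" and B: "\<And>x. cmod (f x) \<le> B"
  shows "\<bar>Re (Hq_form q f (Aop e (virial_weight a e) f)) / (4 * e)\<bar> \<le> a * (L2n d * (L2n d + a * L2n f)) + \<bar>q\<bar> * a * B\<^sup>2"
proof -
  have B0: "0 \<le> B" using B[of 0] norm_ge_zero order_trans by blast
  have "\<bar>Re (f 0 * cnj (f e + f (- e)))\<bar> \<le> cmod (f 0) * cmod (f e + f (- e))"
    using abs_Re_le_cmod[of "f 0 * cnj (f e + f (- e))"] by (simp only: norm_mult complex_mod_cnj)
  also have "\<dots> \<le> B * (B + B)"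
    using B B0 by (intro mult_mono order_trans[OF norm_triangle_ineq] add_mono) auto
  finally have 1: "\<bar>Re (f 0 * cnj (f e + f (- e)))\<bar> \<le> 2 * B\<^sup>2" by (simp add: power2_eq_square)
  have "\<bar>q * phi a e * Re (f 0 * cnj (f e + f (- e)))\<bar> \<le> \<bar>q\<bar> * (a * e) * (2 * B\<^sup>2)"
    unfolding abs_mult using phi_le[OF a, of e] e 1 by (intro mult_mono) auto
  also have "\<dots> \<le> (\<bar>q\<bar> * a * B\<^sup>2) * (4 * e)"
    using a e by (simp add: algebra_simps mult_left_mono)
  finally have "\<bar>q * phi a e * Re (f 0 * cnj (f e + f (- e))) / (4 * e)\<bar> \<le> \<bar>q\<bar> * a * B\<^sup>2"
    using e by (simp add: abs_div pos_divide_le_eq)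
  then show ?thesis
    using commutator_bound[OF e] unfolding Re_Hq_form_Aop diff_divide_distrib by linarith
qed

end

section \<open>The virial identity\<close>

lemma (in nonlinearity) Nl_shift: "Nl (\<lambda>x. f (x + e)) x = Nl f (x + e)"
  by (simp add: Nl_def)

text \<open>Summation by parts: after a translation the increment falls on the weight, which is
  nondecreasing, while \<open>defect\<close> is nonnegative. The commutator error is of order e^2,
  hence O(e) after division by 4e.\<close>

lemma (in nonlinearity) Nl_Aop_lower_bound:
  assumes a: "0 < a"
  obtains C where "0 \<le> C" "\<And>e f. 0 < e \<Longrightarrow> H1 f \<Longrightarrow> (\<And>x. (cmod (f x))\<^sup>2 \<le> R) \<Longrightarrow>
     - (C * e\<^sup>2 * L2sq (H1_deriv f)) \<le> Re (L2inner (Nl f) (Aop e (virial_weight a e) f))"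
proof -
  obtain C where C: "0 \<le> C" "\<And>(m :: real \<Rightarrow> real) a b. m \<in> borel_measurable borel \<Longrightarrow> \<forall>x. \<bar>m x\<bar> \<le> 1 \<Longrightarrow> sq_int a \<Longrightarrow> sq_int b \<Longrightarrow>
     \<forall>x. (cmod (a x))\<^sup>2 \<le> R \<Longrightarrow> \<forall>x. (cmod (b x))\<^sup>2 \<le> R \<Longrightarrow>
     \<bar>Re (L2inner (\<lambda>x. complex_of_real (m x) * Nl b x) a) - Re (L2inner (\<lambda>x. complex_of_real (m x) * Nl a x) b)
       - (\<integral>x. m x * (defect ((cmod (b x))\<^sup>2) - defect ((cmod (a x))\<^sup>2)) \<partial>lborel)\<bar>
     \<le> C * L2sq (\<lambda>x. b x - a x)"
    using Nl_commutator[of R] by blast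
  show thesis
  proof (rule that[OF C(1)])
    fix e :: real and f assume e: "0 < e" and f: "H1 f" and R: "\<And>x. (cmod (f x))\<^sup>2 \<le> R"
    let ?m = "virial_weight a e" and ?K = "\<lambda>x. defect ((cmod (f x))\<^sup>2)"
    note mb = virial_weight_measurable(1)[OF a, of e] virial_weight_bound[OF a, of e]
    have fs: "sq_int f" and ds: "sq_int (H1_deriv f)" and fd: "is_H1_deriv f (H1_deriv f)"
      using f by (simp_all add: H1_sq_int H1_deriv_sq_int H1_deriv_is)
    have N: "sq_int (Nl f)" by (rule sq_int_Nl[OF fs R])
    have msm: "(\<lambda>x. ?m (x - e)) \<in> borel_measurable borel" by (rule measurable_shift_minus[OF mb])
    have "L2inner (Nl f) (Aop e ?m f) = L2inner (Nl f) (\<lambda>x. complex_of_real (?m x) * f (x + e))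
        - L2inner (Nl f) (\<lambda>x. complex_of_real (?m (x - e)) * f (x - e))"
      unfolding Aop_def[abs_def]
      by (intro L2inner_diff_right N sq_int_real_mult[OF _ mb] sq_int_real_mult[OF _ msm mb(2)]
          sq_int_shift sq_int_shift_minus fs)
    also have "L2inner (Nl f) (\<lambda>x. complex_of_real (?m x) * f (x + e)) = L2inner (\<lambda>x. complex_of_real (?m x) * Nl f x) (\<lambda>x. f (x + e))"
      by (rule L2inner_real_mult[symmetric])
    also have "L2inner (Nl f) (\<lambda>x. complex_of_real (?m (x - e)) * f (x - e))
        = L2inner (\<lambda>x. Nl f (x + e)) (\<lambda>x. complex_of_real (?m x) * f x)"
      using L2inner_shift[of "Nl f" e "\<lambda>x. complex_of_real (?m (x - e)) * f (x - e)"] by simp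
    also have "\<dots> = L2inner (\<lambda>x. complex_of_real (?m x) * Nl (\<lambda>x. f (x + e)) x) f"
      unfolding Nl_shift by (rule L2inner_real_mult[symmetric])
    finally have eq: "Re (L2inner (Nl f) (Aop e ?m f)) =
       Re (L2inner (\<lambda>x. complex_of_real (?m x) * Nl f x) (\<lambda>x. f (x + e)))
       - Re (L2inner (\<lambda>x. complex_of_real (?m x) * Nl (\<lambda>x. f (x + e)) x) f)" by simp
    have Ki: "integrable lborel ?K" by (rule integrable_defect[OF fs R])
    have Kp: "0 \<le> ?K x" for x by (rule defect_nonneg) simp
    have bm: "integrable lborel (\<lambda>x. w x * k x)"
      if "w \<in> borel_measurable borel" "\<And>x. \<bar>w x\<bar> \<le> 1" "integrable lborel k" for w k :: "real \<Rightarrow> real"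
    proof (rule Bochner_Integration.integrable_bound[OF that(3)])
      show "(\<lambda>x. w x * k x) \<in> borel_measurable lborel" using that(1) borel_measurable_integrable[OF that(3)] by simp
      show "AE x in lborel. norm (w x * k x) \<le> norm (k x)"
        using that(2) by (intro AE_I2) (simp add: abs_mult mult_left_le_one_le)
    qed
    have Ks: "integrable lborel (\<lambda>x. ?K (x + e))" using Ki by (subst integrable_shift)
    have "(\<integral>x. ?m x * (?K x - ?K (x + e)) \<partial>lborel) = (\<integral>x. ?m x * ?K x \<partial>lborel) - (\<integral>x. ?m x * ?K (x + e) \<partial>lborel)"
      unfolding right_diff_distrib by (intro Bochner_Integration.integral_diff bm mb Ki Ks)
    also have "(\<integral>x. ?m x * ?K (x + e) \<partial>lborel) = (\<integral>x. ?m (x - e) * ?K x \<partial>lborel)"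
      using integral_shift[of "\<lambda>x. ?m x * ?K (x + e)" "- e"] by simp
    also have "(\<integral>x. ?m x * ?K x \<partial>lborel) - (\<integral>x. ?m (x - e) * ?K x \<partial>lborel) = (\<integral>x. ?m x * ?K x - ?m (x - e) * ?K x \<partial>lborel)"
      by (intro Bochner_Integration.integral_diff[symmetric] bm mb Ki msm)
    also have "\<dots> \<ge> 0"
    proof (rule Bochner_Integration.integral_nonneg)
      fix x
      have "?m (x - e) \<le> ?m x" unfolding virial_weight_def using a e by (intro add_mono phi_mono) auto
      then have "?m (x - e) * ?K x \<le> ?m x * ?K x" using Kp by (rule mult_right_mono)
      then show "0 \<le> ?m x * ?K x - ?m (x - e) * ?K x" by simp
    qed
    finally have pos: "0 \<le> (\<integral>x. ?m x * (?K x - ?K (x + e)) \<partial>lborel)" .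
    have "\<bar>Re (L2inner (Nl f) (Aop e ?m f)) - (\<integral>x. ?m x * (?K x - ?K (x + e)) \<partial>lborel)\<bar> \<le> C * L2sq (\<lambda>x. f x - f (x + e))"
      unfolding eq by (rule C(2)) (use mb fs R sq_int_shift in auto)
    moreover have "L2sq (\<lambda>x. f x - f (x + e)) \<le> e\<^sup>2 * L2sq (H1_deriv f)"
    proof -
      have "L2n (\<lambda>x. f x - f (x + e)) \<le> e * L2n (H1_deriv f)"
        using L2n_difference_le[OF fs fd, of 0 e] e by (subst L2n_minus_commute) simp
      from power_mono[OF this, of 2] show ?thesis by (simp add: power_mult_distrib)
    qed
    then have "C * L2sq (\<lambda>x. f x - f (x + e)) \<le> C * (e\<^sup>2 * L2sq (H1_deriv f))"
      using C(1) by (rule mult_left_mono)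
    ultimately show "- (C * e\<^sup>2 * L2sq (H1_deriv f)) \<le> Re (L2inner (Nl f) (Aop e ?m f))"
      using pos unfolding mult.assoc by linarith
  qed
qed

lemma L2cont_Aop:
  assumes v: "L2cont v" and m: "m \<in> borel_measurable borel" "\<And>x. \<bar>m x\<bar> \<le> K"
  shows "L2cont (\<lambda>t. Aop e m (v t))"
proof -
  have "L2cont (\<lambda>t x. complex_of_real (m x) * v t (x + e))"
    by (rule L2cont_mult[OF L2cont_shift[OF v], where K = K]) (use m in auto)
  moreover have "L2cont (\<lambda>t x. complex_of_real (m (x - e)) * v t (x - e))"
    using L2cont_mult[OF L2cont_shift[OF v, of "- e"], of "\<lambda>x. complex_of_real (m (x - e))" K]
      measurable_shift_minus[OF m] m(2) by simp
  ultimately show ?thesis unfolding Aop_def[abs_def] by (rule L2cont_diff)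
qed

context nls begin

lemma virial_derivative:
  assumes a: "0 < a" and e: "0 < e" and t: "0 \<le> t"
  shows "((\<lambda>s. Im (L2inner (u s) (Aop e (virial_weight a e) (u s))) / (4 * e)) has_real_derivative
     - 2 * (Re (Hq_form q (u t) (Aop e (virial_weight a e) (u t))) / (4 * e)
           + Re (L2inner (Nl (u t)) (Aop e (virial_weight a e) (u t))) / (4 * e))) (at t within {0..})"
proof -
  let ?A = "Aop e (virial_weight a e)"
  have AH: "H1 (?A (u s))" if "0 \<le> s" for s by (rule Aop_H1[OF a u_H1[OF that]])
  obtain C where C': "\<And>r s \<phi>. 0 \<le> r \<Longrightarrow> r \<le> t + 1 \<Longrightarrow> 0 \<le> s \<Longrightarrow> s \<le> t + 1 \<Longrightarrow> H1 \<phi> \<Longrightarrow>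
     cmod (L2inner (u r) \<phi> - L2inner (u s) \<phi>) \<le> C * \<bar>r - s\<bar> * H1n \<phi>"
    using u_weak_Lipschitz[of "t + 1"] by metis
  have C: "cmod (L2inner (u s) \<phi> - L2inner (u t) \<phi>) \<le> C * \<bar>s - t\<bar> * H1n \<phi>"
    if "0 \<le> s" "s \<le> t + 1" "H1 \<phi>" for s \<phi>
    using C'[of s t \<phi>] that t by simp
  have "((\<lambda>s. - L2inner (?A (u t)) (u s)) has_vector_derivative - cnj (rhs t (?A (u t)))) (at t within {0..})"
    by (intro has_vector_derivative_minus u_equation_right t AH)
  then have D2: "((\<lambda>s. L2inner (u t) (?A (u s))) has_vector_derivative - cnj (rhs t (?A (u t)))) (at t within {0..})"
    by (rule has_vector_derivative_transform[rotated 2])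
       (use t Aop_antisym[OF virial_weight_measurable(1)[OF a] virial_weight_bound[OF a]] u_sq_int in auto)
  have lim: "((\<lambda>s. H1n (\<lambda>x. ?A (u s) x - ?A (u t) x)) \<longlongrightarrow> 0) (at t within {0..})"
  proof (rule Lim_null_comparison)
    show "eventually (\<lambda>s. norm (H1n (\<lambda>x. ?A (u s) x - ?A (u t) x)) \<le> (4 + 4 * a) * H1n (\<lambda>x. u s x - u t x)) (at t within {0..})"
      using eventually_nonneg_within
    proof eventually_elim
      case (elim s)
      have "(\<lambda>x. ?A (u s) x - ?A (u t) x) = ?A (\<lambda>x. u s x - u t x)"
        by (rule ext) (simp add: Aop_def algebra_simps)
      then show ?case using Aop_H1n[OF a H1_diff[OF u_H1[OF elim] u_H1[OF t]]] by simp
    qed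
    show "((\<lambda>s. (4 + 4 * a) * H1n (\<lambda>x. u s x - u t x)) \<longlongrightarrow> 0) (at t within {0..})"
      by (intro tendsto_mult_right_zero u_tendsto t)
  qed
  have "((\<lambda>s. L2inner (u s) (?A (u s))) has_vector_derivative rhs t (?A (u t)) + - cnj (rhs t (?A (u t)))) (at t within {0..})"
    by (rule weak_product_rule[OF t u_H1 AH u_equation[OF t AH[OF t]] D2 C lim])
  from bounded_linear.has_vector_derivative[OF bounded_linear_Im this]
  have D: "((\<lambda>s. Im (L2inner (u s) (?A (u s)))) has_real_derivative Im (rhs t (?A (u t)) + - cnj (rhs t (?A (u t))))) (at t within {0..})"
    by (simp only: has_real_derivative_iff_has_vector_derivative)
  have V: "Im (rhs t (?A (u t)) + - cnj (rhs t (?A (u t)))) / (4 * e)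
     = - 2 * (Re (Hq_form q (u t) (?A (u t))) / (4 * e) + Re (L2inner (Nl (u t)) (?A (u t))) / (4 * e))"
    using e by (simp add: rhs_def field_simps)
  show ?thesis using DERIV_cdivide[OF D, of "4 * e"] unfolding V .
qed

lemma mass_nonneg: "0 \<le> mass u0" by (simp add: mass_def)

lemma energy_nonneg: "0 \<le> energy q g u0"
  using order_trans[OF L2sq_nonneg energy_ge_dx[of 0]] by simp

lemma virial_functional_bound:
  assumes a: "0 < a" and e: "0 < e" and t: "0 \<le> t"
  shows "\<bar>Im (L2inner (u t) (Aop e (virial_weight a e) (u t))) / (4 * e)\<bar> \<le> sqrt (energy q g u0 * mass u0) + a * mass u0"
proof -
  let ?A = "Aop e (virial_weight a e)"
  have "\<bar>Im (L2inner (u t) (?A (u t)))\<bar> \<le> cmod (L2inner (u t) (?A (u t)))" by (rule abs_Im_le_cmod)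
  also have "\<dots> \<le> L2n (u t) * L2n (?A (u t))"
    by (intro L2_Cauchy_Schwarz u_sq_int t H1_sq_int Aop_H1 a u_H1)
  also have "\<dots> \<le> L2n (u t) * (2 * e * (L2n (dx t) + a * L2n (u t)))"
    by (intro mult_left_mono Aop_phi_bound a u_H1 t e) auto
  finally have le: "\<bar>Im (L2inner (u t) (?A (u t)))\<bar> \<le> L2n (u t) * (2 * e * (L2n (dx t) + a * L2n (u t)))" .
  have "\<bar>Im (L2inner (u t) (?A (u t))) / (4 * e)\<bar> = \<bar>Im (L2inner (u t) (?A (u t)))\<bar> / (4 * e)"
    using e by (simp add: abs_div)
  also have "\<dots> \<le> L2n (u t) * (2 * e * (L2n (dx t) + a * L2n (u t))) / (4 * e)"
    by (rule divide_right_mono[OF le]) (use e in simp)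
  also have "\<dots> = (L2n (u t) * L2n (dx t) + a * (L2n (u t) * L2n (u t))) / 2"
    using e by (simp add: field_simps)
  also have "L2n (u t) * L2n (u t) = 2 * mass u0"
    using mass_conservation[OF t] by (simp add: mass_def)
  also have "L2n (u t) * L2n (dx t) \<le> sqrt (2 * mass u0) * sqrt (2 * energy q g u0)"
    using mass_conservation[OF t] energy_ge_dx[OF t] mass_nonneg
    by (intro mult_mono real_sqrt_le_mono) (auto simp: mass_def)
  also have "sqrt (2 * mass u0) * sqrt (2 * energy q g u0) = sqrt (4 * (energy q g u0 * mass u0))"
    by (simp add: ac_simps flip: real_sqrt_mult)
  also have "\<dots> = 2 * sqrt (energy q g u0 * mass u0)" by (simp add: real_sqrt_mult)
  finally show ?thesis by simp
qed

definition virial_rate :: "real \<Rightarrow> real \<Rightarrow> real" where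
  "virial_rate a t = a * (L2sq (weighted_deriv a (u t)) - (q / 2 + a) * (cmod (u t 0))\<^sup>2)"

text \<open>The discrete virial identity is integrated in time at fixed \<open>e\<close> and
  \<open>e\<close> tends to 0 afterwards. This order works because the bound on the virial
  functional is uniform in both \<open>e\<close> and time.\<close>

lemma virial_integral:
  assumes a: "0 < a" and T: "0 \<le> T"
  shows "virial_rate a integrable_on {0..T}"
    and "integral {0..T} (virial_rate a) \<le> sqrt (energy q g u0 * mass u0) + a * mass u0"
proof -
  let ?X = "sqrt (energy q g u0 * mass u0) + a * mass u0"
  let ?A = "\<lambda>e. Aop e (virial_weight a e)"
  let ?Q = "\<lambda>e t. Re (Hq_form q (u t) (?A e (u t))) / (4 * e)"
  let ?N = "\<lambda>e t. Re (L2inner (Nl (u t)) (?A e (u t))) / (4 * e)"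
  let ?J = "\<lambda>e t. Im (L2inner (u t) (?A e (u t))) / (4 * e)"
  let ?e = "\<lambda>n. inverse (real (Suc n))"
  have e0: "0 < ?e n" for n by simp
  obtain R where R: "\<And>t x. 0 \<le> t \<Longrightarrow> t \<le> T \<Longrightarrow> (cmod (u t x))\<^sup>2 \<le> R"
    using u_sup_bounded[of T] by blast
  obtain C where C: "0 \<le> C" "\<And>e f. 0 < e \<Longrightarrow> H1 f \<Longrightarrow> (\<And>x. (cmod (f x))\<^sup>2 \<le> R) \<Longrightarrow>
     - (C * e\<^sup>2 * L2sq (H1_deriv f)) \<le> Re (L2inner (Nl f) (Aop e (virial_weight a e) f))"
    using Nl_Aop_lower_bound[OF a, of R] by metis
  obtain B where B: "0 \<le> B" "\<And>t. 0 \<le> t \<Longrightarrow> t \<le> T \<Longrightarrow> H1n (u t) \<le> B"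
    using u_bounded[of T] by blast
  \<comment> \<open>The nonlinear error C e^2 ||u'||^2 with ||u'||^2 <= 2E, divided by 4e, equals
    \<open>D * e\<close>.\<close>
  define D where "D = C * energy q g u0 / 2"
  have Nlow: "- (D * e) \<le> ?N e t" if t: "0 \<le> t" "t \<le> T" and e: "0 < e" for e t
  proof -
    have "C * e\<^sup>2 * L2sq (dx t) \<le> C * e\<^sup>2 * (2 * energy q g u0)"
      using C(1) energy_ge_dx[OF t(1)] by (intro mult_left_mono) auto
    then have "- (C * e\<^sup>2 * (2 * energy q g u0)) \<le> Re (L2inner (Nl (u t)) (?A e (u t)))"
      using C(2)[OF e u_H1[OF t(1)] R[OF t]] by linarith
    then have "- (C * e\<^sup>2 * (2 * energy q g u0)) / (4 * e) \<le> ?N e t"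
      using e by (intro divide_right_mono) auto
    moreover have "- (C * e\<^sup>2 * (2 * energy q g u0)) / (4 * e) = - (D * e)"
      using e by (simp add: D_def power2_eq_square)
    ultimately show ?thesis by simp
  qed
  have Qcont: "continuous_on {0..} (?Q e)" for e
  proof -
    have "continuous_on {0..} (\<lambda>t. (Re (L2inner (dx t) (Aop e (virial_weight_deriv a e) (u t))) - q * phi a e * Re (u t 0 * cnj (u t e + u t (- e)))) / (4 * e))"
    proof (cases "e = 0")
      case False
      then show ?thesis
        by (intro continuous_intros L2cont_inner L2cont_dx L2cont_Aop[OF L2cont_u virial_weight_measurable(2)[OF a] virial_weight_deriv_bound[OF a]]
          u_at_continuous) auto
    qed simp
    then show ?thesis
      by (rule continuous_on_eq) (auto simp: Re_Hq_form_Aop[OF a u_H1])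
  qed
  have Qint: "?Q e integrable_on {0..T}" for e
    by (intro integrable_continuous_real continuous_on_subset[OF Qcont]) auto
  have Qup: "integral {0..T} (?Q e) \<le> ?X + D * T * e" if e: "0 < e" for e
  proof -
    have I: "((\<lambda>t. - 2 * (?Q e t + ?N e t)) has_integral ?J e T - ?J e 0) {0..T}"
    proof (rule fundamental_theorem_of_calculus[OF T])
      fix t assume "t \<in> {0..T}"
      then have "(?J e has_real_derivative - 2 * (?Q e t + ?N e t)) (at t within {0..T})"
        by (intro DERIV_subset[OF virial_derivative[OF a e]]) auto
      then show "(?J e has_vector_derivative - 2 * (?Q e t + ?N e t)) (at t within {0..T})"
        by (simp only: has_real_derivative_iff_has_vector_derivative)
    qed
    have half: "(- 1 / 2) * (- 2 * z) = z" for z :: real by simp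
    from has_integral_mult_right[OF I, of "- 1 / 2"]
    have "((\<lambda>t. ?Q e t + ?N e t) has_integral (- 1 / 2) * (?J e T - ?J e 0)) {0..T}" by (simp only: half)
    moreover have "((\<lambda>t. D * e) has_integral D * e * T) {0..T}"
      using has_integral_const_real[of "D * e" 0 T] T by (simp add: mult.commute)
    ultimately have S: "((\<lambda>t. ?Q e t + ?N e t + D * e) has_integral (- 1 / 2) * (?J e T - ?J e 0) + D * e * T) {0..T}"
      by (rule has_integral_add)
    have "integral {0..T} (?Q e) \<le> (- 1 / 2) * (?J e T - ?J e 0) + D * e * T"
    proof (rule has_integral_le[OF integrable_integral[OF Qint] S])
      fix t assume "t \<in> {0..T}"
      then show "?Q e t \<le> ?Q e t + ?N e t + D * e" using Nlow[of t e] e by simp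
    qed
    \<comment> \<open>The two end values each cost \<open>?X\<close>, and the factor 1/2 from the
      virial identity compensates for having two of them.\<close>
    also have "(- 1 / 2) * (?J e T - ?J e 0) \<le> ?X"
    proof -
      have "(- 1 / 2) * (y - x) \<le> Z" if "\<bar>x\<bar> \<le> Z" "\<bar>y\<bar> \<le> Z" for x y Z :: real
        using that unfolding abs_le_iff by argo
      then show ?thesis using virial_functional_bound[OF a e] T by blast
    qed
    finally show ?thesis by (simp add: mult.commute mult.left_commute)
  qed
  have elim: "filterlim ?e (at_right 0) sequentially"
    unfolding filterlim_at using LIMSEQ_inverse_real_of_nat by auto
  have conv: "(\<lambda>n. ?Q (?e n) t) \<longlonglongrightarrow> virial_rate a t" if "t \<in> {0..T}" for t
    unfolding virial_rate_def
    by (rule filterlim_compose[OF Hq_form_Aop_tendsto[OF a u_H1] elim]) (use that in auto)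
  have bound: "norm (?Q (?e n) t) \<le> a * (B * (B + a * B)) + \<bar>q\<bar> * a * (2 * B)\<^sup>2" if t: "t \<in> {0..T}" for n t
  proof -
    have t': "0 \<le> t" "t \<le> T" using t by auto
    have "norm (?Q (?e n) t) \<le> a * (L2n (dx t) * (L2n (dx t) + a * L2n (u t))) + \<bar>q\<bar> * a * (2 * B)\<^sup>2"
      unfolding real_norm_def
      by (rule Hq_form_Aop_bound[OF a u_H1[OF t'(1)] e0])
         (use H1_sup_bound'[OF u_H1[OF t'(1)]] B(2)[OF t'] in \<open>meson mult_left_mono order_trans zero_le_numeral\<close>)
    also have "\<dots> \<le> a * (B * (B + a * B)) + \<bar>q\<bar> * a * (2 * B)\<^sup>2"
      using a B(1) by (intro add_right_mono mult_left_mono mult_mono add_mono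
        order_trans[OF L2n_le_H1n(1) B(2)[OF t']] order_trans[OF L2n_le_H1n(2) B(2)[OF t']]) auto
    finally show ?thesis .
  qed
  have cint: "(\<lambda>_. a * (B * (B + a * B)) + \<bar>q\<bar> * a * (2 * B)\<^sup>2) integrable_on {0..T}"
    by (intro integrable_continuous_real continuous_intros)
  note DC = dominated_convergence[of "\<lambda>n. ?Q (?e n)", OF Qint cint bound conv]
  show "virial_rate a integrable_on {0..T}" by (rule DC(1))
  show "integral {0..T} (virial_rate a) \<le> ?X"
  proof (rule LIMSEQ_le[OF DC(2)])
    have "(\<lambda>n. ?X + D * T * ?e n) \<longlonglongrightarrow> ?X + D * T * 0"
      by (intro tendsto_intros LIMSEQ_inverse_real_of_nat)
    then show "(\<lambda>n. ?X + D * T * ?e n) \<longlonglongrightarrow> ?X" by simp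
    show "\<exists>N. \<forall>n\<ge>N. integral {0..T} (?Q (?e n)) \<le> ?X + D * T * ?e n"
      using Qup[OF e0] by blast
  qed
qed

end

section \<open>The weighted estimate\<close>

lemma expw_integrable:
  assumes b: "0 < b" shows "integrable lborel (expw b)"
proof -
  let ?h = "\<lambda>x::real. indicator {0..} x *\<^sub>R exp (- b * x)"
  have "(\<lambda>x. exp (- b * x)) absolutely_integrable_on {0..}"
    by (rule nonnegative_absolutely_integrable_1[OF integrable_on_exp_minus_to_infinity[OF b]]) simp
  then have "integrable lebesgue ?h" by (simp add: set_integrable_def)
  then have h: "integrable lborel ?h" by (subst (asm) integrable_completion) auto
  have "integrable lborel (\<lambda>x. ?h (0 + (-1) * x))"
    by (rule lborel_integrable_real_affine[OF h]) simp
  then have "integrable lborel (\<lambda>x. ?h x + ?h (0 + (-1) * x))"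
    using h by (rule Bochner_Integration.integrable_add[rotated])
  then show ?thesis
    by (rule Bochner_Integration.integrable_bound)
       (auto simp: expw_def indicator_def abs_if)
qed

text \<open>Half of the exponential decay absorbs the linear growth, since y <= exp y.\<close>

lemma abs_times_expw: assumes b: "0 < b" shows "\<bar>x\<bar> * expw (2 * b) x \<le> expw b x / b"
proof -
  have "b * \<bar>x\<bar> \<le> exp (b * \<bar>x\<bar>)" using exp_ge_add_one_self[of "b * \<bar>x\<bar>"] by linarith
  then have "b * \<bar>x\<bar> * expw (2 * b) x \<le> exp (b * \<bar>x\<bar>) * expw (2 * b) x"
    by (rule mult_right_mono) (simp add: expw_def)
  also have "\<dots> = expw b x" by (simp add: expw_def flip: exp_add)
  finally show ?thesis using b by (simp add: field_simps)
qed

text \<open>The rate controls w' and w(0) but not the L2 norm of w. Since |w(x)|^2 <= 2 |w(0)|^2 + 2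
  |x| ||w'||^2, the extra decay with exponent c - a > 0 makes w square integrable.\<close>

lemma H1w_sq_bound:
  assumes a: "0 < a" and ac: "a < c"
  obtains C where "0 < C" "\<And>f. H1 f \<Longrightarrow> H1w_sq c f \<le> C * (L2sq (weighted_deriv a f) + (cmod (f 0))\<^sup>2)"
proof -
  define b where "b = c - a"
  have b: "0 < b" using ac by (simp add: b_def)
  define I where "I = (\<integral>x. expw b x \<partial>lborel)"
  have I: "0 \<le> I" unfolding I_def by (rule Bochner_Integration.integral_nonneg) (simp add: expw_def)
  \<comment> \<open>\<open>(2 + 2 / b) * I\<close> bounds the weighted L2 part. The product rule for
    the extra weight, whose logarithmic derivative has modulus at most b, adds the
    \<open>2 * b\<^sup>2\<close> and the final 2.\<close>
  define K where "K = (1 + 2 * b\<^sup>2) * ((2 + 2 / b) * I) + 2"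
  have K: "0 < K" using b I by (simp add: K_def add_nonneg_pos)
  show thesis
  proof (rule that[OF K])
    fix f assume f: "H1 f"
    let ?w = "\<lambda>x. complex_of_real (expw a x) * f x" and ?w' = "weighted_deriv a f"
    let ?Ew = "\<lambda>x. complex_of_real (expw b x) * ?w x"
    let ?S = "L2sq ?w' + (cmod (f 0))\<^sup>2"
    have eb: "\<bar>expw b x\<bar> \<le> 1" "\<bar>expw a x\<bar> \<le> 1" "\<bar>- b * sgn x * expw b x\<bar> \<le> b" for x
      using a b expw_bounds[of a x] expw_bounds[of b x] by (auto simp: abs_mult sgn_if)
    have ws: "sq_int ?w" by (rule sq_int_real_mult[OF H1_sq_int[OF f] expw_measurable eb(2)])
    have wd: "is_H1_deriv ?w ?w'" by (rule weighted_deriv_is[OF a f])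
    have w's: "sq_int ?w'" by (rule is_H1_deriv_sq_int[OF wd])
    have sm: "(\<lambda>x. - b * sgn x * expw b x) \<in> borel_measurable borel" by measurable
    have Es: "sq_int ?Ew" by (rule sq_int_real_mult[OF ws expw_measurable eb(1)])
    have E's: "sq_int (\<lambda>x. complex_of_real (- b * sgn x * expw b x) * ?w x)" by (rule sq_int_real_mult[OF ws sm eb(3)])
    have ED: "is_H1_deriv ?Ew (\<lambda>x. complex_of_real (- b * sgn x * expw b x) * ?w x + complex_of_real (expw b x) * ?w' x)"
      by (rule is_H1_deriv_mult[OF W1inf_expw[OF b] ws wd])
    have "(\<lambda>x. complex_of_real (exp (- c * \<bar>x\<bar>)) * f x) = ?Ew"
      using expw_add[of b _ a] by (auto simp: b_def expw_def mult.assoc[symmetric] simp flip: of_real_mult)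
    then have eq: "H1w_sq c f = L2sq ?Ew + L2sq (\<lambda>x. complex_of_real (- b * sgn x * expw b x) * ?w x + complex_of_real (expw b x) * ?w' x)"
      unfolding H1w_sq_def H1sq_def by (simp only: L2sq_H1_deriv[OF ED])
    have "L2sq (\<lambda>x. complex_of_real (- b * sgn x * expw b x) * ?w x + complex_of_real (expw b x) * ?w' x)
       \<le> (\<integral>x. 2 * (b\<^sup>2 * (cmod (?Ew x))\<^sup>2) + 2 * (cmod (?w' x))\<^sup>2 \<partial>lborel)"
      unfolding L2sq_def
    proof (rule integral_mono)
      show "integrable lborel (\<lambda>x. (cmod (complex_of_real (- b * sgn x * expw b x) * ?w x + complex_of_real (expw b x) * ?w' x))\<^sup>2)"
        by (rule sq_int_integrable[OF is_H1_deriv_sq_int[OF ED]])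
      show "integrable lborel (\<lambda>x. 2 * (b\<^sup>2 * (cmod (?Ew x))\<^sup>2) + 2 * (cmod (?w' x))\<^sup>2)"
        using sq_int_integrable[OF Es] sq_int_integrable[OF w's] by (intro Bochner_Integration.integrable_add integrable_mult_right)
      fix x
      have "(cmod (complex_of_real (- b * sgn x * expw b x) * ?w x))\<^sup>2 \<le> b\<^sup>2 * (cmod (?Ew x))\<^sup>2"
        using b by (simp add: norm_mult abs_mult power_mult_distrib sgn_if)
      moreover have "(cmod (complex_of_real (expw b x) * ?w' x))\<^sup>2 \<le> (cmod (?w' x))\<^sup>2"
        using eb(1)[of x] by (intro power_mono) (auto simp: norm_mult mult_left_le_one_le)
      ultimately show "(cmod (complex_of_real (- b * sgn x * expw b x) * ?w x + complex_of_real (expw b x) * ?w' x))\<^sup>2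
         \<le> 2 * (b\<^sup>2 * (cmod (?Ew x))\<^sup>2) + 2 * (cmod (?w' x))\<^sup>2"
        by (intro order_trans[OF sum_sq_bound]) linarith
    qed
    also have "\<dots> = 2 * (b\<^sup>2 * L2sq ?Ew) + 2 * L2sq ?w'"
      using sq_int_integrable[OF Es] sq_int_integrable[OF w's] by (simp add: L2sq_def)
    finally have 1: "H1w_sq c f \<le> (1 + 2 * b\<^sup>2) * L2sq ?Ew + 2 * L2sq ?w'"
      unfolding eq by (simp only: distrib_right mult_1_left mult.assoc add.assoc)
    have "L2sq ?Ew \<le> (\<integral>x. (2 * (cmod (f 0))\<^sup>2 + 2 / b * L2sq ?w') * expw b x \<partial>lborel)"
      unfolding L2sq_def[of ?Ew]
    proof (rule integral_mono)
      show "integrable lborel (\<lambda>x. (cmod (?Ew x))\<^sup>2)" by (rule sq_int_integrable[OF Es])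
      show "integrable lborel (\<lambda>x. (2 * (cmod (f 0))\<^sup>2 + 2 / b * L2sq ?w') * expw b x)"
        using expw_integrable[OF b] by (rule integrable_mult_right)
      fix x
      have "(cmod (?w x))\<^sup>2 \<le> 2 * (cmod (?w 0))\<^sup>2 + 2 * (\<bar>x\<bar> * L2sq ?w')"
        using sum_sq_bound[of "?w 0" "?w x - ?w 0"] H1_deriv_increment_sq[OF wd, of x 0] by simp
      also have "?w 0 = f 0" by (simp add: expw_def)
      finally have "expw (2 * b) x * (cmod (?w x))\<^sup>2 \<le> expw (2 * b) x * (2 * (cmod (f 0))\<^sup>2 + 2 * (\<bar>x\<bar> * L2sq ?w'))"
        using expw_bounds(2)[of "2 * b" x] by (intro mult_left_mono) auto
      also have "\<dots> = 2 * (cmod (f 0))\<^sup>2 * expw (2 * b) x + 2 * L2sq ?w' * (\<bar>x\<bar> * expw (2 * b) x)"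
        by (simp add: algebra_simps)
      also have "\<dots> \<le> 2 * (cmod (f 0))\<^sup>2 * expw b x + 2 * L2sq ?w' * (expw b x / b)"
      proof (intro add_mono mult_left_mono abs_times_expw b)
        show "expw (2 * b) x \<le> expw b x" using b by (simp add: expw_def mult_right_mono)
      qed auto
      also have "\<dots> = (2 * (cmod (f 0))\<^sup>2 + 2 / b * L2sq ?w') * expw b x" by (simp add: algebra_simps)
      also have "expw (2 * b) x * (cmod (?w x))\<^sup>2 = (cmod (?Ew x))\<^sup>2"
        using expw_add[of b x b] expw_bounds(2)[of b x] by (simp add: norm_mult power_mult_distrib power2_eq_square)
      finally show "(cmod (?Ew x))\<^sup>2 \<le> (2 * (cmod (f 0))\<^sup>2 + 2 / b * L2sq ?w') * expw b x" .
    qed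
    also have "\<dots> = (2 * (cmod (f 0))\<^sup>2 + 2 / b * L2sq ?w') * I" by (simp add: I_def)
    also have "\<dots> \<le> ((2 + 2 / b) * ?S) * I"
      using b I by (intro mult_right_mono) (auto simp: algebra_simps)
    finally have 2: "L2sq ?Ew \<le> (2 + 2 / b) * I * ?S" by (simp add: mult_ac)
    have "H1w_sq c f \<le> (1 + 2 * b\<^sup>2) * ((2 + 2 / b) * I * ?S) + 2 * ?S"
      using 1 2 by (intro order_trans[OF 1] add_mono mult_left_mono) auto
    also have "\<dots> = K * ?S" unfolding K_def by (simp only: distrib_right mult.assoc)
    finally show "H1w_sq c f \<le> K * ?S" .
  qed
qed

lemma nn_integral_half_line_le:
  assumes F: "continuous_on {0..} F" "\<And>t. 0 \<le> t \<Longrightarrow> 0 \<le> F t"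
    and Y: "\<And>n. integral {0..real n} F \<le> Y"
  shows "(\<integral>\<^sup>+ t\<in>{0..}. ennreal (F t) \<partial>lborel) \<le> ennreal Y"
proof -
  let ?f = "\<lambda>n t. ennreal (F t) * indicator {0..real n} t"
  have meas: "?f n \<in> borel_measurable lborel" for n
  proof -
    have "(\<lambda>t. indicator {0..real n} t *\<^sub>R F t) \<in> borel_measurable borel"
      by (rule borel_measurable_continuous_on_indicator) (auto intro: continuous_on_subset[OF F(1)])
    then have "(\<lambda>t. ennreal (indicator {0..real n} t *\<^sub>R F t)) \<in> borel_measurable lborel" by simp
    moreover have "(\<lambda>t. ennreal (indicator {0..real n} t *\<^sub>R F t)) = ?f n"
      by (auto simp: indicator_def)
    ultimately show ?thesis by simp
  qed
  have inc: "incseq ?f"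
    by (intro incseq_SucI le_funI mult_left_mono) (auto simp: indicator_def)
  have sup: "(SUP n. ?f n t) = ennreal (F t) * indicator {0..} t" for t
  proof (rule antisym)
    show "(SUP n. ?f n t) \<le> ennreal (F t) * indicator {0..} t"
      by (intro SUP_least mult_left_mono) (auto simp: indicator_def)
    obtain n :: nat where "t \<le> real n" using real_arch_simple by blast
    then have "ennreal (F t) * indicator {0..} t = ?f n t" by (auto simp: indicator_def)
    then show "ennreal (F t) * indicator {0..} t \<le> (SUP n. ?f n t)" by (auto intro: SUP_upper2[of n])
  qed
  have "(\<integral>\<^sup>+ t\<in>{0..}. ennreal (F t) \<partial>lborel) = (SUP n. integral\<^sup>N lborel (?f n))"
    unfolding sup[symmetric] by (rule nn_integral_monotone_convergence_SUP[OF inc meas])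
  also have "\<dots> \<le> ennreal Y"
  proof (rule SUP_least)
    fix n
    have "F integrable_on {0..real n}"
      by (intro integrable_continuous_real continuous_on_subset[OF F(1)]) auto
    then have "integral\<^sup>N lborel (?f n) = ennreal (integral {0..real n} F)"
      by (intro nn_integral_has_integral_lebesgue' integrable_integral) (auto intro: F(2))
    then show "integral\<^sup>N lborel (?f n) \<le> ennreal Y" using Y[of n] by (simp add: ennreal_leI)
  qed
  finally show ?thesis .
qed

context nls begin

lemma weighted_deriv_L2cont: assumes "0 < a" shows "L2cont (\<lambda>t. weighted_deriv a (u t))"
proof -
  have "cmod (complex_of_real (- a * sgn x * expw a x)) \<le> a" "cmod (complex_of_real (expw a x)) \<le> 1" for x
    unfolding norm_of_real using assms expw_bounds[of a x] by (auto simp: abs_mult sgn_if)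
  then show ?thesis
    unfolding weighted_deriv_def[abs_def]
    by (intro L2cont_add L2cont_mult[OF L2cont_u, where K = a] L2cont_mult[OF L2cont_dx, where K = 1]) measurable
qed

text \<open>Zero mass forces \<open>u0 = 0\<close> only a.e.; continuity of H1 functions extends
  this to every point. It is needed for the strict inequality.\<close>

lemma mass_pos: assumes "u0 \<noteq> (\<lambda>_. 0)" shows "0 < mass u0"
proof (rule ccontr)
  assume "\<not> 0 < mass u0"
  then have "L2sq u0 = 0" using L2sq_nonneg[of u0] by (simp add: mass_def)
  have u: "H1 u0" using u_H1[of 0] by (simp add: u_initial)
  have ae: "AE x in lborel. u0 x = 0"
  proof -
    have "AE x in lborel. (cmod (u0 x))\<^sup>2 = 0"
      using \<open>L2sq u0 = 0\<close> sq_int_integrable[OF H1_sq_int[OF u]]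
      by (subst (asm) L2sq_def, subst (asm) integral_nonneg_eq_0_iff_AE) auto
    then show ?thesis by eventually_elim simp
  qed
  have "u0 x = 0" for x
  proof -
    let ?k = "\<lambda>y. cmod (u0 y)"
    have c: "continuous_on {x..x+1} ?k"
      by (intro continuous_intros continuous_on_subset[OF H1_continuous[OF u]]) auto
    then have s: "set_integrable lborel {x..x+1} ?k"
      unfolding set_integrable_def by (intro borel_integrable_compact) auto
    have "(\<integral>y. indicator {x..x+1} y *\<^sub>R ?k y \<partial>lborel) = 0"
      by (rule integral_eq_zero_AE) (use ae in eventually_elim, simp)
    then have "(?k has_integral 0) {x..x+1}" using has_integral_LBINT[OF s] by simp
    then have "?k x = 0"
      using has_integral_0_cbox_imp_0[of x "x + 1" ?k x] c by simp
    then show ?thesis by simp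
  qed
  then show False using assms by auto
qed

end

lemma nls_weighted_bound:
  assumes g: "nonlinearity g" and q: "q < 0" and c: "0 < c"
  obtains C where "0 < C" "\<And>u0 u. NLS_solution q g u u0 \<Longrightarrow>
     (\<integral>\<^sup>+ t\<in>{0..}. ennreal (H1w_sq c (u t)) \<partial>lborel)
       \<le> ennreal (C * (sqrt (energy q g u0 * mass u0) + mass u0))"
proof -
  \<comment> \<open>\<open>a < c\<close> leaves room for \<open>H1w_sq_bound\<close>, and
    \<open>a \<le> - q / 4\<close> keeps the boundary coefficient -(q/2 + a) at least -q/4 >
    0.\<close>
  define a where "a = min c (- q / 2) / 2"
  have a: "0 < a" "a < c" "a \<le> - q / 4" using q c by (auto simp: a_def)
  obtain K where K: "0 < K" "\<And>f. H1 f \<Longrightarrow> H1w_sq c f \<le> K * (L2sq (weighted_deriv a f) + (cmod (f 0))\<^sup>2)"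
    using H1w_sq_bound[OF a(1,2)] by metis
  \<comment> \<open>A common lower bound for the coefficients of ||w'||^2 and |w(0)|^2 in the
    rate.\<close>
  define k where "k = min 1 (- q / 4)"
  have k: "0 < k" "k \<le> 1" "k \<le> - (q / 2 + a)" using q a by (auto simp: k_def)
  show thesis
  \<comment> \<open>\<open>a * k\<close> is the coercivity constant of the rate, \<open>K\<close>
    the cost of passing to the H1 norm, and \<open>1 + a\<close> turns \<open>?E + a * ?M\<close>
    into a multiple of \<open>?E + ?M\<close>.\<close>
  proof (rule that[of "K * (1 + a) / (a * k)"])
    show "0 < K * (1 + a) / (a * k)" using K a k by simp
    fix u0 u assume "NLS_solution q g u u0"
    with g q interpret nls g q u u0 by (intro nls.intro nls_axioms.intro)
    let ?E = "sqrt (energy q g u0 * mass u0)" and ?M = "mass u0"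
    let ?F = "\<lambda>t. K * (L2sq (weighted_deriv a (u t)) + (cmod (u t 0))\<^sup>2)"
    have Fc: "continuous_on {0..} ?F"
      by (intro continuous_intros L2cont_L2sq weighted_deriv_L2cont a(1) u_at_continuous)
    have Fk: "(a * k) * ?F t \<le> K * virial_rate a t" for t
    proof -
      have "k * (L2sq (weighted_deriv a (u t)) + (cmod (u t 0))\<^sup>2) \<le> 1 * L2sq (weighted_deriv a (u t)) + (- (q / 2 + a)) * (cmod (u t 0))\<^sup>2"
        unfolding distrib_left using k by (intro add_mono mult_right_mono) auto
      also have "\<dots> = L2sq (weighted_deriv a (u t)) - (q / 2 + a) * (cmod (u t 0))\<^sup>2"
        by (simp only: mult_1_left mult_minus_left add_uminus_conv_diff)
      finally have "K * a * (k * (L2sq (weighted_deriv a (u t)) + (cmod (u t 0))\<^sup>2)) \<le> K * a * (L2sq (weighted_deriv a (u t)) - (q / 2 + a) * (cmod (u t 0))\<^sup>2)"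
        using K a by (intro mult_left_mono) auto
      then show ?thesis unfolding virial_rate_def by (simp only: mult_ac)
    qed
    have EM: "0 \<le> ?E" "0 \<le> ?M" using energy_nonneg mass_nonneg by auto
    have Y: "integral {0..real n} ?F \<le> K * (1 + a) / (a * k) * (?E + ?M)" for n
    proof -
      have Fi: "?F integrable_on {0..real n}"
        by (intro integrable_continuous_real continuous_on_subset[OF Fc]) auto
      note vi = virial_integral[OF a(1), of "real n", OF of_nat_0_le_iff]
      have "(a * k) * integral {0..real n} ?F = integral {0..real n} (\<lambda>t. (a * k) * ?F t)" by simp
      also have "\<dots> \<le> integral {0..real n} (\<lambda>t. K * virial_rate a t)"
        by (intro integral_le integrable_on_mult_right Fi vi Fk)
      also have "\<dots> = K * integral {0..real n} (virial_rate a)" by simp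
      also have "\<dots> \<le> K * (?E + a * ?M)" using K(1) vi(2) by (intro mult_left_mono) auto
      also have "\<dots> \<le> K * ((1 + a) * (?E + ?M))"
        using K(1) a(1) EM by (intro mult_left_mono) (auto simp: algebra_simps)
      finally show ?thesis using a(1) k(1) by (simp add: field_simps)
    qed
    \<comment> \<open>Monotonicity of the nonnegative integral asks for no measurability of the
      weighted norm in t; that question arises only for the continuous majorant
      \<open>?F\<close>.\<close>
    have "(\<integral>\<^sup>+ t\<in>{0..}. ennreal (H1w_sq c (u t)) \<partial>lborel) \<le> (\<integral>\<^sup>+ t\<in>{0..}. ennreal (?F t) \<partial>lborel)"
    proof (rule nn_integral_mono)
      fix t :: real
      show "ennreal (H1w_sq c (u t)) * indicator {0..} t \<le> ennreal (?F t) * indicator {0..} t"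
        using K(2)[OF u_H1[of t]] by (auto simp: indicator_def intro!: ennreal_leI)
    qed
    also have "\<dots> \<le> ennreal (K * (1 + a) / (a * k) * (?E + ?M))"
      using K(1) by (intro nn_integral_half_line_le Fc Y) auto
    finally show "(\<integral>\<^sup>+ t\<in>{0..}. ennreal (H1w_sq c (u t)) \<partial>lborel)
       \<le> ennreal (K * (1 + a) / (a * k) * (?E + ?M))" .
  qed
qed

text \<open>On (0, 1] the case k = 1 of the power bound gives s |g'(s)| <= c0 s^p <= c0; on [1, R]
  continuity of \<open>deriv g\<close> and compactness suffice.\<close>

lemma power_law_imp_nonlinearity:
  fixes g :: "real \<Rightarrow> real" and p c0 :: real
  assumes g_cont: "continuous_on {0..} g"
    and g_C3: "\<forall>k<3. \<forall>s>0. ((deriv ^^ k) g has_real_derivative (deriv ^^ Suc k) g s) (at s)"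
    and p_pos: "p > 0" and c0_pos: "c0 > 0"
    and g_bound: "\<forall>k\<le>3. \<forall>s\<in>{0<..1}. \<bar>(deriv ^^ k) g s\<bar> \<le> c0 * s powr (p - real k)"
    and g_nonneg: "\<forall>s\<ge>0. g s \<ge> 0"
    and g_G: "\<forall>s\<ge>0. s * g s - prim g s \<ge> 0"
  shows "nonlinearity g"
proof
  show "(g has_real_derivative deriv g s) (at s)" if "0 < s" for s
    using g_C3[rule_format, of 0 s] that by simp
  show "\<exists>C. \<forall>s. 0 < s \<longrightarrow> s \<le> R \<longrightarrow> \<bar>s * deriv g s\<bar> \<le> C" for R
  proof -
    have "continuous_on {1..R} (\<lambda>s. s * deriv g s)"
    proof (intro continuous_intros)
      have "isCont (deriv g) s" if "0 < s" for s
        using g_C3[rule_format, of 1 s] that by (auto intro: DERIV_isCont)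
      then show "continuous_on {1..R} (deriv g)"
        by (intro continuous_at_imp_continuous_on) auto
    qed
    then have "compact ((\<lambda>s. s * deriv g s) ` {1..R})" by (intro compact_continuous_image) auto
    then obtain D where D: "\<And>s. s \<in> {1..R} \<Longrightarrow> \<bar>s * deriv g s\<bar> \<le> D"
      by (force dest!: compact_imp_bounded simp: bounded_iff)
    have "\<bar>s * deriv g s\<bar> \<le> c0" if "0 < s" "s \<le> 1" for s
    proof -
      have "\<bar>deriv g s\<bar> \<le> c0 * s powr (p - 1)"
        using g_bound[rule_format, of 1 s] that by simp
      then have "s * \<bar>deriv g s\<bar> \<le> s * (c0 * s powr (p - 1))"
        using that by (intro mult_left_mono) auto
      also have "\<dots> = c0 * s powr p" using that powr_mult_base[of s "p - 1"] by simp
      also have "\<dots> \<le> c0 * 1"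
        using that p_pos c0_pos powr_mono2[of p s 1] by (intro mult_left_mono) auto
      finally show ?thesis using that by (simp add: abs_mult)
    qed
    note small = this
    have "\<bar>s * deriv g s\<bar> \<le> max c0 D" if "0 < s" "s \<le> R" for s
      using small[of s] D[of s] that by (cases "s \<le> 1") auto
    then show ?thesis by blast
  qed
qed (use g_cont g_nonneg g_G in auto)

theorem theorem1p4:
  fixes g :: "real \<Rightarrow> real" and p c0 q :: real
  assumes g_cont: "continuous_on {0..} g"
    and g_C3: "\<forall>k<3. \<forall>s>0. ((deriv ^^ k) g has_real_derivative (deriv ^^ Suc k) g s) (at s)"
    and g_C3': "continuous_on {0<..} ((deriv ^^ 3) g)"
    and p_pos: "p > 0" and c0_pos: "c0 > 0"
    and g_bound: "\<forall>k\<le>3. \<forall>s\<in>{0<..1}. \<bar>(deriv ^^ k) g s\<bar> \<le> c0 * s powr (p - real k)"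
    and q_neg: "q < 0"
    and g_nonneg: "\<forall>s\<ge>0. g s \<ge> 0"
    and g_G: "\<forall>s\<ge>0. s * g s - prim g s \<ge> 0"
  shows "\<forall>\<gamma>>0. \<exists>C\<gamma>>0. \<forall>u0 u. H1 u0 \<longrightarrow> NLS_solution q g u u0 \<longrightarrow>
     (let I = (\<integral>\<^sup>+ t\<in>{0..}. ennreal (H1w_sq \<gamma> (u t)) \<partial>lborel);
          R = ennreal (C\<gamma> * (sqrt (energy q g u0 * mass u0) + mass u0))
      in I \<le> R \<and> (u0 \<noteq> (\<lambda>_. 0) \<longrightarrow> I < R))"
proof (intro allI impI)
  have g: "nonlinearity g"
    by (rule power_law_imp_nonlinearity[OF g_cont g_C3 p_pos c0_pos g_bound g_nonneg g_G])
  fix \<gamma> :: real assume "0 < \<gamma>"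
  then obtain C where C: "0 < C" "\<And>u0 u. NLS_solution q g u u0 \<Longrightarrow>
     (\<integral>\<^sup>+ t\<in>{0..}. ennreal (H1w_sq \<gamma> (u t)) \<partial>lborel)
       \<le> ennreal (C * (sqrt (energy q g u0 * mass u0) + mass u0))"
    using nls_weighted_bound[OF g q_neg] by metis
  show "\<exists>C\<gamma>>0. \<forall>u0 u. H1 u0 \<longrightarrow> NLS_solution q g u u0 \<longrightarrow>
     (let I = (\<integral>\<^sup>+ t\<in>{0..}. ennreal (H1w_sq \<gamma> (u t)) \<partial>lborel);
          R = ennreal (C\<gamma> * (sqrt (energy q g u0 * mass u0) + mass u0))
      in I \<le> R \<and> (u0 \<noteq> (\<lambda>_. 0) \<longrightarrow> I < R))"
  \<comment> \<open>Doubling the constant makes the inequality strict as soon as the right side is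
    positive, that is, for nonzero data. For \<open>u0 = 0\<close> energy and mass vanish and only
    the weak inequality is possible.\<close>
  proof (intro exI[of _ "2 * C"] conjI allI impI)
    show "0 < 2 * C" using C(1) by simp
    fix u0 u assume sol: "NLS_solution q g u u0"
    with g q_neg interpret nls g q u u0 by (intro nls.intro nls_axioms.intro)
    let ?X = "sqrt (energy q g u0 * mass u0) + mass u0"
    have X: "0 \<le> ?X" using energy_nonneg mass_nonneg by simp
    have "ennreal (C * ?X) \<le> ennreal (2 * C * ?X)"
      using C(1) X by (intro ennreal_leI mult_right_mono) auto
    moreover have "ennreal (C * ?X) < ennreal (2 * C * ?X)" if "u0 \<noteq> (\<lambda>_. 0)"
    proof -
      have "0 < ?X" using mass_pos[OF that] energy_nonneg by (intro add_nonneg_pos) auto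
      then show ?thesis using C(1) by (intro ennreal_lessI) auto
    qed
    ultimately show "let I = (\<integral>\<^sup>+ t\<in>{0..}. ennreal (H1w_sq \<gamma> (u t)) \<partial>lborel); R = ennreal (2 * C * ?X)
      in I \<le> R \<and> (u0 \<noteq> (\<lambda>_. 0) \<longrightarrow> I < R)"
      unfolding Let_def using C(2)[OF sol] by (meson order_trans order_le_less_trans)
  qed
qed

end
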